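(* Let $d\ge1$ and let $\Omega\subset\mathbb{R}^d$ be an open bounded set with Lipschitz continuous boundary. Let $\{s_n\}_{n\in\mathbb{N}}\subset(0,1)$ be such that $s_n\to0^+$ as $n\to+\infty$. (i) (Compactness) Let $\{u^n\}_{n\in\mathbb{N}}\subset L^2(\Omega)$ be such that $$\hat F^{s_n}(u^n)+2|\Omega|\,\|u^n\|_{L^2(\Omega)}^2\le M$$ for some constant $M$ independent of $n$. Then, up to a subsequence, $u^n\to u$ strongly in $L^2(\Omega)$ for some $u\in\mathcal{H}^0_0(\Omega)$. (ii) ($\Gamma$-liminf inequality) For every $u\in L^2(\Omega)$ and for every $\{u^n\}_{n\in\mathbb{N}}\subset L^2(\Omega)$ with $u^n\to u$ in $L^2(\Omega)$, it holds $$\hat F^0(u)\le\liminf_{n\to+\infty}\hat F^{s_n}(u^n).$$ (iii) ($\Gamma$-limsup inequality) For every $u\in\mathcal{H}^0_0(\Omega)$ there exists $\{u^n\}_{n\in\mathbb{N}}\subset L^2(\Omega)$ with $u^n\to u$ in $L^2(\Omega)$ such that $$\hat F^0(u)=\lim_{n\to+\infty}\hat F^{s_n}(u^n).$$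
   Context: For measurable $u:\Omega\to\mathbb{R}$, $\tilde u$ denotes its extension by $0$ to $\mathbb{R}^d$; $|\Omega|$ is the Lebesgue measure of $\Omega$ and $\omega_d$ that of the unit ball of $\mathbb{R}^d$. For $s\in(0,1)$ and $u\in L^2(\Omega)$, $$F^s(u):=\frac12\int_{\mathbb{R}^d}\int_{\mathbb{R}^d}\frac{|\tilde u(x)-\tilde u(y)|^2}{|x-y|^{d+2s}}\,dy\,dx\in[0,+\infty],\qquad F^0(u):=\frac{d\omega_d}{2}\|u\|_{L^2(\Omega)}^2,$$ and $\hat F^s(u):=F^s(u)-\frac1sF^0(u)\in(-\infty,+\infty]$. Let $\mathcal{B}_1:=\{(x,y)\in\mathbb{R}^d\times\mathbb{R}^d:|x-y|<1\}$. For $s\in[0,1)$ and $u\in L^2(\Omega)$ set $$G^s_1(u):=\frac12\iint_{\mathcal{B}_1}\frac{|\tilde u(x)-\tilde u(y)|^2}{|x-y|^{d+2s}}\,dy\,dx\in[0,+\infty],\qquad J^s_1(u):=-\iint_{\mathbb{R}^{2d}\setminus\overline{\mathcal{B}}_1}\frac{\tilde u(x)\tilde u(y)}{|x-y|^{d+2s}}\,dy\,dx\in\mathbb{R}.$$ One has $\hat F^s=G^s_1+J^s_1$ for every $s\in(0,1)$. For $s=0$ define $\hat F^0(u):=G^0_1(u)+J^0_1(u)\in(-\infty,+\infty]$, and $\mathcal{H}^0_0(\Omega):=\{u\in L^2(\Omega):G^0_1(u)<+\infty\}$. *)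

theory Defs
  imports "HOL-Analysis.Analysis"
begin

text \<open>
  The space \<open>\<real>\<^sup>d\<close> is an arbitrary Euclidean space \<open>'a\<close>, with \<open>d = DIM('a)\<close>. A function on
  \<open>\<Omega>\<close> is represented by a total function \<open>'a \<Rightarrow> real\<close> of which only the values on \<open>\<Omega>\<close> are
  ever used, and an element of \<open>L\<^sup>2(\<Omega>)\<close> by any of its Lebesgue measurable representatives.
\<close>

text \<open>
  Near each boundary point, \<open>\<Omega>\<close> is the strict subgraph, in some direction \<open>e\<close>, of a Lipschitz
  function \<open>g\<close> on the hyperplane orthogonal to \<open>e\<close>; \<open>x - (x \<bullet> e) *\<^sub>R e\<close> is the orthogonal
  projection of \<open>x\<close> onto that hyperplane.
\<close>

definition lipschitz_boundary :: "'a::euclidean_space set \<Rightarrow> bool" where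
  "lipschitz_boundary \<Omega> \<longleftrightarrow>
     (\<forall>p\<in>frontier \<Omega>. \<exists>e r L. \<exists>g::'a \<Rightarrow> real.
        norm e = 1 \<and> r > 0 \<and> L-lipschitz_on {y. y \<bullet> e = 0} g \<and>
        \<Omega> \<inter> ball p r = {x \<in> ball p r. x \<bullet> e < g (x - (x \<bullet> e) *\<^sub>R e)})"

definition L2 :: "'a::euclidean_space set \<Rightarrow> ('a \<Rightarrow> real) set" where
  "L2 \<Omega> = {u. u \<in> borel_measurable (lebesgue_on \<Omega>) \<and> integrable (lebesgue_on \<Omega>) (\<lambda>x. (u x)\<^sup>2)}"

definition L2_norm :: "'a::euclidean_space set \<Rightarrow> ('a \<Rightarrow> real) \<Rightarrow> real" where
  "L2_norm \<Omega> u = sqrt (\<integral>x. (u x)\<^sup>2 \<partial>lebesgue_on \<Omega>)"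

definition L2_tendsto ::
  "'a::euclidean_space set \<Rightarrow> (nat \<Rightarrow> 'a \<Rightarrow> real) \<Rightarrow> ('a \<Rightarrow> real) \<Rightarrow> bool" where
  "L2_tendsto \<Omega> u v \<longleftrightarrow> (\<lambda>n. L2_norm \<Omega> (\<lambda>x. u n x - v x)) \<longlonglongrightarrow> 0"

definition ext0 :: "'a::euclidean_space set \<Rightarrow> ('a \<Rightarrow> real) \<Rightarrow> 'a \<Rightarrow> real" where
  "ext0 \<Omega> u x = (if x \<in> \<Omega> then u x else 0)"

text \<open>
  In the integrands below the value on the diagonal \<open>x = y\<close>, a null set, is \<open>0\<close> by the
  convention \<open>a / 0 = 0\<close>.
\<close>

definition F :: "'a::euclidean_space set \<Rightarrow> real \<Rightarrow> ('a \<Rightarrow> real) \<Rightarrow> ennreal" where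
  "F \<Omega> s u = ennreal (1/2) *
     (\<integral>\<^sup>+x. (\<integral>\<^sup>+y. ennreal (\<bar>ext0 \<Omega> u x - ext0 \<Omega> u y\<bar>\<^sup>2 / norm (x - y) powr (real DIM('a) + 2 * s))
        \<partial>lebesgue) \<partial>lebesgue)"

definition F0 :: "'a::euclidean_space set \<Rightarrow> ('a \<Rightarrow> real) \<Rightarrow> real" where
  "F0 \<Omega> u = real DIM('a) * measure lebesgue (ball (0::'a) 1) / 2 * (L2_norm \<Omega> u)\<^sup>2"

definition B1 :: "('a::euclidean_space \<times> 'a) set" where
  "B1 = {(x, y). norm (x - y) < 1}"

definition G1 :: "'a::euclidean_space set \<Rightarrow> real \<Rightarrow> ('a \<Rightarrow> real) \<Rightarrow> ennreal" where
  "G1 \<Omega> s u = ennreal (1/2) *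
     (\<integral>\<^sup>+(x, y)\<in>B1. ennreal (\<bar>ext0 \<Omega> u x - ext0 \<Omega> u y\<bar>\<^sup>2 / norm (x - y) powr (real DIM('a) + 2 * s))
        \<partial>lebesgue)"

definition J1 :: "'a::euclidean_space set \<Rightarrow> real \<Rightarrow> ('a \<Rightarrow> real) \<Rightarrow> real" where
  "J1 \<Omega> s u =
     - (LINT (x, y) : - closure B1 | lebesgue.
          ext0 \<Omega> u x * ext0 \<Omega> u y / norm (x - y) powr (real DIM('a) + 2 * s))"

text \<open>
  The value \<open>-\<infinity>\<close> does not occur, because the subtracted, resp. added, term is finite.
\<close>

definition Fhat :: "'a::euclidean_space set \<Rightarrow> real \<Rightarrow> ('a \<Rightarrow> real) \<Rightarrow> ereal" where
  "Fhat \<Omega> s u =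
     (if s = 0 then enn2ereal (G1 \<Omega> 0 u) + ereal (J1 \<Omega> 0 u)
      else enn2ereal (F \<Omega> s u) - ereal (1 / s * F0 \<Omega> u))"

definition H00 :: "'a::euclidean_space set \<Rightarrow> ('a \<Rightarrow> real) set" where
  "H00 \<Omega> = {u \<in> L2 \<Omega>. G1 \<Omega> 0 u < \<infinity>}"

end

theory Submission
  imports Defs "HOL-Complex_Analysis.Great_Picard"
begin

text \<open>
  Write \<open>D(z) = \<parallel>u(\<cdot> + z) - u\<parallel>\<^sup>2\<close>. Then \<open>2 G\<^sup>s\<^sub>1(u)\<close> is the integral of \<open>D(z) / |z|\<^sup>d\<^sup>+\<^sup>2\<^sup>s\<close> over the unit ball, which
  increases with \<open>s\<close>, and \<open>J\<^sup>s\<^sub>1\<close> is an integral of the autocorrelation of \<open>u\<close>, which is continuous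
  in \<open>L\<^sup>2\<close>; the liminf inequality is Fatou's lemma in \<open>z\<close>. Since \<open>J\<^sup>s\<^sub>1(u) \<ge> - |\<Omega>| \<parallel>u\<parallel>\<^sup>2\<close>, the bound in the
  compactness statement controls both \<open>\<parallel>u\<parallel>\<close> and \<open>G\<^sup>0\<^sub>1(u)\<close>. For a probability density \<open>\<rho> \<le> c / |z|\<^sup>d\<close> supported in the
  unit ball, Jensen's inequality bounds the squared \<open>L\<^sup>2\<close> distance of \<open>u\<close> to its \<open>\<rho>\<close>-average by \<open>2 c G\<^sup>0\<^sub>1(u)\<close>,
  and \<open>c\<close> can be made arbitrarily small because \<open>1 / |z|\<^sup>d\<close> is not integrable at the origin. Averages against a
  fixed Lipschitz density are equi-Lipschitz, which gives compactness.

  For the recovery sequence it suffices to approximate \<open>u\<close> in energy by Lipschitz functions supported in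
  \<open>\<Omega>\<close>, on which \<open>G\<^sup>s\<^sub>1\<close> tends to \<open>G\<^sup>0\<^sub>1\<close>. Averaging does not increase the energy but enlarges the support, so
  \<open>u\<close> is first multiplied by a cutoff of the distance \<open>t\<close> to the boundary. The exterior cone condition
  makes \<open>G\<^sup>0\<^sub>1(u)\<close> control the integral of \<open>u\<^sup>2 ln (1 / t)\<close>, which dominates the error of the cutoff.
\<close>

section \<open>Radial integrals over cones\<close>

text \<open>At \<open>s = 0\<close> the kernel fails to be integrable at the origin only
  logarithmically. Finite energy therefore gives no fractional derivative and no Sobolev embedding;
  the divergence of the mass of the kernel is all there is to exploit. A density spread over one
  scale \<open>r\<close>, of size \<open>r^-d\<close>, would give an error bounded by the energy but
  not small. Smallness needs densities proportional to the kernel itself over a long range of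
  scales, and this is why truncated kernels serve as mollifiers. Hence the detour through Lipschitz
  functions, whose energies are continuous in \<open>s\<close>, and a diagonal choice. The
  regularity of the boundary enters through the cutoff only. Because functions are extended by zero,
  their interaction with the exterior of \<Omega> is part of the energy, and an exterior cone makes
  this part diverge like \<open>ln (1 / t)\<close> near the boundary. The increments of a cutoff
  diverge at the same rate, so the energy already present pays for them.\<close>

lemma emeasure_cone_cball:
  fixes S :: "'a::euclidean_space set"
  assumes S[measurable]: "S \<in> sets borel" and cone: "\<And>c z. c > 0 \<Longrightarrow> z \<in> S \<Longrightarrow> c *\<^sub>R z \<in> S"
    and t: "t \<ge> 0"
  shows "emeasure lborel (S \<inter> cball 0 t) = ennreal (measure lborel (S \<inter> cball 0 1) * t ^ DIM('a))"
proof (cases "t = 0")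
  case True
  have "emeasure lborel (S \<inter> cball 0 t) \<le> emeasure lborel {0::'a}"
    by (rule emeasure_mono) (auto simp: True)
  then show ?thesis using True by simp
next
  case False
  with t have t0: "t > 0" by simp
  have fin: "emeasure lborel (S \<inter> cball 0 1) \<noteq> \<infinity>"
    using emeasure_mono[of "S \<inter> cball 0 1" "cball 0 1" lborel]
      emeasure_lborel_cball_finite[of "0::'a" 1] by (auto simp: top_unique)
  have vim: "(\<lambda>x. 0 + t *\<^sub>R x) -` (S \<inter> cball 0 t) = S \<inter> cball 0 1"
  proof -
    have "t *\<^sub>R x \<in> S \<longleftrightarrow> x \<in> S" for x
      using cone[of "1/t" "t *\<^sub>R x"] cone[of t x] t0 by auto
    then show ?thesis using t0 by auto
  qed
  have "emeasure lborel (S \<inter> cball 0 t) =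
      emeasure (density (distr lborel borel (\<lambda>x::'a. 0 + t *\<^sub>R x)) (\<lambda>_. \<bar>t\<bar>^DIM('a))) (S \<inter> cball 0 t)"
    by (subst lborel_affine[of t 0]) (use t0 in auto)
  also have "\<dots> = ennreal (\<bar>t\<bar>^DIM('a)) * emeasure lborel (S \<inter> cball 0 1)"
    by (subst emeasure_density) (simp_all add: nn_integral_cmult_indicator emeasure_distr vim[simplified])
  also have "\<dots> = ennreal (measure lborel (S \<inter> cball 0 1) * t ^ DIM('a))"
    using fin t0 by (subst emeasure_eq_ennreal_measure) (auto simp: ennreal_mult mult.commute)
  finally show ?thesis .
qed

text \<open>Polar coordinates without a surface measure: by homogeneity of the cone, the image of
  Lebesgue measure on \<open>S\<close> under \<open>norm\<close> and the stated density both give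
  mass \<open>c * t ^ d\<close> to \<open>{..t}\<close>, and half-lines form an intersection-stable
  generator of the Borel sets.\<close>

lemma nn_integral_radial:
  fixes S :: "'a::euclidean_space set" and f :: "real \<Rightarrow> ennreal"
  assumes S[measurable]: "S \<in> sets borel" and cone: "\<And>c z. c > 0 \<Longrightarrow> z \<in> S \<Longrightarrow> c *\<^sub>R z \<in> S"
    and f[measurable]: "f \<in> borel_measurable borel"
  shows "(\<integral>\<^sup>+z. indicator S z * f (norm z) \<partial>lborel) =
    (\<integral>\<^sup>+r. ennreal (measure lborel (S \<inter> cball 0 1) * DIM('a) * r ^ (DIM('a) - 1)) *
       indicator {0..} r * f r \<partial>lborel)"
proof -
  define c where "c = measure lborel (S \<inter> cball 0 1)"
  define M where "M = distr (density lborel (indicator S)) borel (norm :: 'a \<Rightarrow> real)"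
  define N where "N = density lborel (\<lambda>r. ennreal (c * DIM('a) * r ^ (DIM('a) - 1)) * indicator {0..} r)"
  have c0: "c \<ge> 0" by (simp add: c_def)
  have M_eq: "emeasure M {..t} = emeasure lborel (S \<inter> cball 0 t)" for t :: real
  proof -
    have "norm -` {..t} = cball (0::'a) t" by auto
    then show ?thesis
      unfolding M_def by (subst emeasure_distr) (simp_all add: emeasure_restricted)
  qed
  have eq: "emeasure M {..t} = emeasure N {..t}" for t :: real
  proof (cases "t \<ge> 0")
    case True
    have "emeasure M {..t} = ennreal (c * t ^ DIM('a))"
      unfolding M_eq using emeasure_cone_cball[OF S cone True] by (simp add: c_def)
    also have "\<dots> = (\<integral>\<^sup>+r. ennreal (c * DIM('a) * r ^ (DIM('a) - 1)) * indicator {0..t} r \<partial>lborel)"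
      using True c0
      by (subst nn_integral_FTC_Icc[where F="\<lambda>r. c * r ^ DIM('a)"])
        (auto intro!: derivative_eq_intros simp: power_0_left)
    also have "\<dots> = emeasure N {..t}"
      unfolding N_def by (subst emeasure_density) (auto intro!: nn_integral_cong split: split_indicator)
    finally show ?thesis .
  next
    case False
    have "emeasure M {..t} = 0"
      unfolding M_eq using False by simp
    moreover have "emeasure N {..t} = 0"
      using False unfolding N_def
      by (subst emeasure_density; (simp; fail)?)
        (auto simp: nn_integral_0_iff_AE split: split_indicator)
    ultimately show ?thesis by simp
  qed
  have "M = N"
  proof (rule measure_eqI_generator_eq[where E="range (\<lambda>a::real. {..a})" and \<Omega>=UNIV and A="\<lambda>n. {..real n}"])
    show "Int_stable (range (\<lambda>a::real. {..a}))"
      by (auto simp: Int_stable_def)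
    show "sets M = sigma_sets UNIV (range (\<lambda>a::real. {..a}))" "sets N = sigma_sets UNIV (range (\<lambda>a::real. {..a}))"
      unfolding M_def N_def by (simp_all add: borel_eq_atMost)
    show "(\<Union>i. {..real i}) = UNIV" by (auto intro: real_arch_simple)
    show "emeasure M {..real i} \<noteq> \<infinity>" for i
      unfolding M_eq using emeasure_cone_cball[OF S cone, of "real i"] by simp
  qed (auto simp: eq)
  have "(\<integral>\<^sup>+z. indicator S z * f (norm z) \<partial>lborel) = (\<integral>\<^sup>+r. f r \<partial>M)"
    unfolding M_def by (simp add: nn_integral_distr nn_integral_density)
  also have "\<dots> = (\<integral>\<^sup>+r. ennreal (c * DIM('a) * r ^ (DIM('a) - 1)) * indicator {0..} r * f r \<partial>lborel)"
    unfolding \<open>M = N\<close> N_def by (simp add: nn_integral_density)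
  finally show ?thesis unfolding c_def .
qed


section \<open>The kernel and its integrals over exteriors, annuli and balls\<close>

definition kern :: "real \<Rightarrow> 'a::euclidean_space \<Rightarrow> real" where
  "kern s z = 1 / norm z powr (real DIM('a) + 2 * s)"

lemma kern_nonneg[simp]: "kern s z \<ge> 0"
  by (simp add: kern_def)

lemma kern_uminus[simp]: "kern s (- z) = kern s z"
  by (simp add: kern_def)

lemma kern_measurable[measurable]: "kern s \<in> borel_measurable borel"
  unfolding kern_def[abs_def] by measurable

lemma kern_le_1: "s \<ge> 0 \<Longrightarrow> norm z \<ge> 1 \<Longrightarrow> kern s z \<le> 1"
  by (auto simp: kern_def divide_simps ge_one_powr_ge_zero)

lemma kern_mono:
  fixes z :: "'a::euclidean_space"
  assumes "s \<le> s'" "norm z \<le> 1"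
  shows "kern s z \<le> kern s' z"
\<comment> \<open>At the origin both sides are 0, since \<open>0 powr a = 0\<close> and
  \<open>1 / 0 = 0\<close>. This convention is why bounds of a positive quantity by
  \<open>kern\<close> are later stated away from the origin.\<close>
proof (cases "z = 0")
  case False
  then have "norm z powr (real DIM('a) + 2 * s') \<le> norm z powr (real DIM('a) + 2 * s)"
    using assms by (intro powr_mono') auto
  with False show ?thesis by (auto simp: kern_def intro!: divide_left_mono)
qed (simp add: kern_def)

lemma tendsto_kern: "s \<longlonglongrightarrow> s0 \<Longrightarrow> (\<lambda>n. kern (s n) z) \<longlonglongrightarrow> kern s0 z"
  by (cases "z = 0") (auto simp: kern_def intro!: tendsto_intros)

text \<open>The Jacobian \<open>r ^ (d - 1)\<close> absorbs the dimension in the exponent of the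
  kernel. At \<open>s = 0\<close> the remaining weight is \<open>1 / r\<close>, the source of all
  logarithms below.\<close>

lemma nn_integral_radial_kern:
  fixes S :: "'a::euclidean_space set" and f :: "real \<Rightarrow> ennreal"
  assumes S[measurable]: "S \<in> sets borel" and cone: "\<And>c z. c > 0 \<Longrightarrow> z \<in> S \<Longrightarrow> c *\<^sub>R z \<in> S"
    and f[measurable]: "f \<in> borel_measurable borel"
  shows "(\<integral>\<^sup>+z. indicator S z * (ennreal (kern s z) * f (norm z)) \<partial>lborel) =
    (\<integral>\<^sup>+r. ennreal (measure lborel (S \<inter> cball 0 1) * DIM('a) * r powr (- 1 - 2 * s)) *
       indicator {0<..} r * f r \<partial>lborel)"
proof -
  let ?d = "real DIM('a)" and ?c = "measure lborel (S \<inter> cball 0 1) * DIM('a)"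
  have "(\<integral>\<^sup>+z. indicator S z * (ennreal (kern s z) * f (norm z)) \<partial>lborel) =
    (\<integral>\<^sup>+r. ennreal (?c * r ^ (DIM('a) - 1)) * indicator {0..} r *
       (ennreal (1 / r powr (?d + 2 * s)) * f r) \<partial>lborel)"
    using nn_integral_radial[OF S cone, of "\<lambda>r. ennreal (1 / r powr (?d + 2 * s)) * f r"]
    by (simp add: kern_def)
  also have "\<dots> = (\<integral>\<^sup>+r. ennreal (?c * r powr (- 1 - 2 * s)) * indicator {0<..} r * f r \<partial>lborel)"
  proof (rule nn_integral_cong)
    fix r :: real
    consider "r < 0" | "r = 0" | "r > 0" by linarith
    then show "ennreal (?c * r ^ (DIM('a) - 1)) * indicator {0..} r *
       (ennreal (1 / r powr (?d + 2 * s)) * f r) = ennreal (?c * r powr (- 1 - 2 * s)) * indicator {0<..} r * f r"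
    proof cases
      case 3
      have "r ^ (DIM('a) - 1) = r powr (?d - 1)"
        using 3 by (simp add: powr_realpow[symmetric] of_nat_diff)
      moreover have "r powr (?d - 1) / r powr (?d + 2 * s) = r powr ((?d - 1) - (?d + 2 * s))"
        by (simp only: powr_diff)
      moreover have "(?d - 1) - (?d + 2 * s) = - 1 - 2 * s" by simp
      ultimately have "?c * r ^ (DIM('a) - 1) * (1 / r powr (?d + 2 * s)) = ?c * r powr (- 1 - 2 * s)"
        by (metis mult.assoc times_divide_eq_right mult.right_neutral)
      then show ?thesis using 3
        by (simp add: mult.assoc[symmetric] ennreal_mult[symmetric])
    qed auto
  qed
  finally show ?thesis .
qed

text \<open>This mass explains the term subtracted in \<open>Fhat\<close>: multiplied by the squared
  norm of \<open>u\<close> it is exactly \<open>F0 / s\<close>.\<close>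

lemma nn_integral_kern_outside:
  assumes "s > 0"
  shows "(\<integral>\<^sup>+z. ennreal (kern s z) * indicator {1..} (norm (z::'a::euclidean_space)) \<partial>lborel) =
    ennreal (measure lborel (ball (0::'a) 1) * DIM('a) / (2 * s))"
proof -
  let ?c = "measure lborel (cball (0::'a) 1) * DIM('a)"
  have "(\<integral>\<^sup>+z. ennreal (kern s z) * indicator {1..} (norm (z::'a)) \<partial>lborel) =
      (\<integral>\<^sup>+r. ennreal (?c * r powr (- 1 - 2 * s)) * indicator {0<..} r * indicator {1..} r \<partial>lborel)"
    using nn_integral_radial_kern[of "UNIV :: 'a set" "indicator {1..}" s] by simp
  also have "\<dots> = (\<integral>\<^sup>+r. ennreal (?c * r powr (- 1 - 2 * s)) * indicator {1..} r \<partial>lborel)"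
    by (intro nn_integral_cong) (auto split: split_indicator)
  also have "\<dots> = ennreal (0 - (- ?c / (2 * s) * 1 powr (- 2 * s)))"
  proof (rule nn_integral_FTC_atLeast[where F="\<lambda>r. - ?c / (2 * s) * r powr (- 2 * s)"])
    show "((\<lambda>r. - ?c / (2 * s) * r powr (- 2 * s)) \<longlongrightarrow> 0) at_top"
      using assms by (intro tendsto_mult_right_zero tendsto_neg_powr filterlim_ident) auto
    show "((\<lambda>r. - ?c / (2 * s) * r powr (- 2 * s)) has_real_derivative ?c * r powr (- 1 - 2 * s)) (at r)"
      if "1 \<le> r" for r
    proof -
      have eq: "r powr (- (2 * s) - 1) = r powr (- 1 - 2 * s)"
        by (rule arg_cong) simp
      show ?thesis
        using that assms by (auto intro!: derivative_eq_intros simp: eq simp del: add_uminus_conv_diff)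
    qed
  qed auto
  finally show ?thesis by (simp add: content_ball content_cball)
qed

text \<open>With \<open>S = UNIV\<close> it normalises the mollifiers; with an exterior cone it
  bounds the interaction with the complement from below.\<close>

lemma nn_integral_cone_kern_annulus:
  fixes S :: "'a::euclidean_space set"
  assumes S: "S \<in> sets borel" and cone: "\<And>c z. c > 0 \<Longrightarrow> z \<in> S \<Longrightarrow> c *\<^sub>R z \<in> S"
    and ab: "0 < a" "a \<le> b"
  shows "(\<integral>\<^sup>+z. indicator S z * (ennreal (kern 0 z) * indicator {a..b} (norm z)) \<partial>lborel) =
    ennreal (measure lborel (S \<inter> cball 0 1) * DIM('a) * (ln b - ln a))"
proof -
  let ?c = "measure lborel (S \<inter> cball 0 1) * DIM('a)"
  have "(\<integral>\<^sup>+z. indicator S z * (ennreal (kern 0 z) * indicator {a..b} (norm z)) \<partial>lborel) =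
      (\<integral>\<^sup>+r. ennreal (?c * r powr (- 1)) * indicator {0<..} r * indicator {a..b} r \<partial>lborel)"
    using nn_integral_radial_kern[OF S cone, of "indicator {a..b}" 0] by simp
  also have "\<dots> = (\<integral>\<^sup>+r. ennreal (?c * r powr (- 1)) * indicator {a..b} r \<partial>lborel)"
    using ab by (intro nn_integral_cong) (auto split: split_indicator)
  also have "\<dots> = ennreal (?c * ln b - ?c * ln a)"
    using ab by (intro nn_integral_FTC_Icc)
      (auto intro!: derivative_eq_intros simp: powr_minus field_simps)
  finally show ?thesis by (simp add: algebra_simps)
qed

lemma nn_integral_kern_moment:
  fixes b :: real
  shows "(\<integral>\<^sup>+z. ennreal (kern s z * (norm z)\<^sup>2) * indicator {..b} (norm (z::'a::euclidean_space)) \<partial>lborel) =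
    (\<integral>\<^sup>+r. ennreal (measure lborel (cball (0::'a) 1) * DIM('a) * r powr (1 - 2 * s)) * indicator {0<..b} r \<partial>lborel)"
proof -
  let ?c = "measure lborel (cball (0::'a) 1) * DIM('a)"
  have "(\<integral>\<^sup>+z. ennreal (kern s z * (norm z)\<^sup>2) * indicator {..b} (norm (z::'a)) \<partial>lborel) =
      (\<integral>\<^sup>+r. ennreal (?c * r powr (- 1 - 2 * s)) * indicator {0<..} r * (ennreal (r\<^sup>2) * indicator {..b} r) \<partial>lborel)"
    using nn_integral_radial_kern[of "UNIV :: 'a set" "\<lambda>r. ennreal (r\<^sup>2) * indicator {..b} r" s]
    by (simp add: ennreal_mult mult.assoc)
  also have "\<dots> = (\<integral>\<^sup>+r. ennreal (?c * r powr (1 - 2 * s)) * indicator {0<..b} r \<partial>lborel)"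
  proof (intro nn_integral_cong)
    fix r :: real
    have "r powr (- 1 - 2 * s) * r\<^sup>2 = r powr (1 - 2 * s)" if "r > 0"
    proof -
      have "r\<^sup>2 = r powr 2" using that by simp
      then have "r powr (- 1 - 2 * s) * r\<^sup>2 = r powr ((- 1 - 2 * s) + 2)"
        by (simp only: powr_add)
      also have "(- 1 - 2 * s) + 2 = 1 - 2 * s" by simp
      finally show ?thesis .
    qed
    then show "ennreal (?c * r powr (- 1 - 2 * s)) * indicator {0<..} r * (ennreal (r\<^sup>2) * indicator {..b} r)
      = ennreal (?c * r powr (1 - 2 * s)) * indicator {0<..b} r"
      by (cases "0 < r \<and> r \<le> b") (auto simp: ennreal_mult[symmetric] mult.assoc)
  qed
  finally show ?thesis .
qed

lemma nn_integral_kern_0_moment_le: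
  assumes b: "0 \<le> b"
  shows "(\<integral>\<^sup>+z. ennreal (kern 0 z * (norm z)\<^sup>2) * indicator {..b} (norm (z::'a::euclidean_space)) \<partial>lborel) \<le>
    ennreal (measure lborel (cball (0::'a) 1) * DIM('a) * b\<^sup>2)"
proof -
  let ?c = "measure lborel (cball (0::'a) 1) * DIM('a)"
  \<comment> \<open>The weight \<open>r\<close> is replaced by \<open>2 * r\<close>, so that the
    primitive is simply \<open>r\<^sup>2\<close>.\<close>
  have "(\<integral>\<^sup>+z. ennreal (kern 0 z * (norm z)\<^sup>2) * indicator {..b} (norm (z::'a)) \<partial>lborel)
    \<le> (\<integral>\<^sup>+r. ennreal (?c * (2 * r)) * indicator {0..b} r \<partial>lborel)"
    unfolding nn_integral_kern_moment
    by (intro nn_integral_mono) (auto intro!: ennreal_leI mult_left_mono split: split_indicator)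
  also have "\<dots> = ennreal (?c * b\<^sup>2 - ?c * 0\<^sup>2)"
    using b by (intro nn_integral_FTC_Icc) (auto intro!: derivative_eq_intros simp: field_simps)
  finally show ?thesis by simp
qed

text \<open>The exponent 1/2 is convenient because the radial weight
  \<open>r powr (1 - 2 * s)\<close> is then constant; by monotonicity of the kernel in the unit ball
  it dominates all smaller exponents.\<close>

lemma nn_integral_kern_half_moment_finite:
  "(\<integral>\<^sup>+z. ennreal (kern (1/2) z * (norm z)\<^sup>2) * indicator {..b} (norm (z::'a::euclidean_space)) \<partial>lborel) < \<infinity>"
proof -
  let ?c = "measure lborel (cball (0::'a) 1) * DIM('a)"
  have "(\<integral>\<^sup>+z. ennreal (kern (1/2) z * (norm z)\<^sup>2) * indicator {..b} (norm (z::'a)) \<partial>lborel)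
    \<le> (\<integral>\<^sup>+r. ennreal ?c * indicator {0..b} r \<partial>lborel)"
    unfolding nn_integral_kern_moment by (intro nn_integral_mono) (auto split: split_indicator)
  also have "\<dots> < \<infinity>"
    by (subst nn_integral_cmult_indicator) (auto simp: ennreal_mult_less_top emeasure_lborel_Icc_eq)
  finally show ?thesis .
qed

section \<open>Square integrable functions\<close>

lemma integrable_mult_squares:
  fixes f g :: "'a \<Rightarrow> real"
  assumes [measurable]: "f \<in> borel_measurable M" "g \<in> borel_measurable M"
    and "integrable M (\<lambda>x. (f x)\<^sup>2)" "integrable M (\<lambda>x. (g x)\<^sup>2)"
  shows "integrable M (\<lambda>x. f x * g x)"
proof (rule Bochner_Integration.integrable_bound[OF Bochner_Integration.integrable_add[OF assms(3,4)]])
  show "AE x in M. norm (f x * g x) \<le> norm ((f x)\<^sup>2 + (g x)\<^sup>2)"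
  proof (intro AE_I2)
    fix x
    have "2 * (\<bar>f x\<bar> * \<bar>g x\<bar>) \<le> (f x)\<^sup>2 + (g x)\<^sup>2"
      using sum_squares_bound[of "\<bar>f x\<bar>" "\<bar>g x\<bar>"] by simp
    moreover have "0 \<le> \<bar>f x\<bar> * \<bar>g x\<bar>" by simp
    ultimately show "norm (f x * g x) \<le> norm ((f x)\<^sup>2 + (g x)\<^sup>2)"
      unfolding real_norm_def abs_mult by linarith
  qed
qed measurable

lemma integral_Cauchy_Schwarz:
  fixes f g :: "'a \<Rightarrow> real"
  assumes [measurable]: "f \<in> borel_measurable M" "g \<in> borel_measurable M"
    and f: "integrable M (\<lambda>x. (f x)\<^sup>2)" and g: "integrable M (\<lambda>x. (g x)\<^sup>2)"
  shows "\<bar>\<integral>x. f x * g x \<partial>M\<bar> \<le> sqrt (\<integral>x. (f x)\<^sup>2 \<partial>M) * sqrt (\<integral>x. (g x)\<^sup>2 \<partial>M)"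
proof -
  define A B C where "A = (\<integral>x. (f x)\<^sup>2 \<partial>M)" and "B = (\<integral>x. f x * g x \<partial>M)" and "C = (\<integral>x. (g x)\<^sup>2 \<partial>M)"
  note fg = integrable_mult_squares[OF assms]
  have C0: "C \<ge> 0" and A0: "A \<ge> 0" unfolding A_def C_def by simp_all
  have q: "0 \<le> A - 2 * t * B + t\<^sup>2 * C" for t
  proof -
    have "0 \<le> (\<integral>x. (f x - t * g x)\<^sup>2 \<partial>M)" by simp
    also have "\<dots> = (\<integral>x. (f x)\<^sup>2 - 2 * t * (f x * g x) + t\<^sup>2 * (g x)\<^sup>2 \<partial>M)"
      by (intro Bochner_Integration.integral_cong) (auto simp: power2_eq_square algebra_simps)
    also have "\<dots> = A - 2 * t * B + t\<^sup>2 * C"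
      unfolding A_def B_def C_def using f g fg by simp
    finally show ?thesis .
  qed
  have "B\<^sup>2 \<le> A * C"
  proof (cases "C = 0")
    case True
    then have "AE x in M. (g x)\<^sup>2 = 0"
      using integral_nonneg_eq_0_iff_AE[OF g] by (auto simp: C_def)
    then have "B = 0" unfolding B_def by (intro integral_eq_zero_AE) auto
    then show ?thesis using True by simp
  next
    case False
    then show ?thesis
      \<comment> \<open>The parameter \<open>B / C\<close> minimises the quadratic
        polynomial.\<close>
      using q[of "B / C"] C0 by (simp add: field_simps power2_eq_square)
  qed
  then have "sqrt (B\<^sup>2) \<le> sqrt (A * C)" by (rule real_sqrt_le_mono)
  then show ?thesis by (simp add: A_def B_def C_def real_sqrt_mult)
qed

section \<open>Square integrable functions on the whole space, their autocorrelations and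
  increments\<close>

definition sq_int :: "('a::euclidean_space \<Rightarrow> real) \<Rightarrow> bool" where
  "sq_int U \<longleftrightarrow> U \<in> borel_measurable borel \<and> integrable lborel (\<lambda>x. (U x)\<^sup>2)"

definition sqn :: "('a::euclidean_space \<Rightarrow> real) \<Rightarrow> real" where
  "sqn U = (\<integral>x. (U x)\<^sup>2 \<partial>lborel)"

definition corr :: "('a::euclidean_space \<Rightarrow> real) \<Rightarrow> 'a \<Rightarrow> real" where
  "corr U z = (\<integral>x. U (x + z) * U x \<partial>lborel)"

definition diff2 :: "('a::euclidean_space \<Rightarrow> real) \<Rightarrow> 'a \<Rightarrow> real" where
  "diff2 U z = sqn (\<lambda>x. U (x + z) - U x)"

lemma sq_int_measurable[measurable_dest]: "sq_int U \<Longrightarrow> U \<in> borel_measurable borel"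
  by (simp add: sq_int_def)

lemma sq_int_integrable: "sq_int U \<Longrightarrow> integrable lborel (\<lambda>x. (U x)\<^sup>2)"
  by (simp add: sq_int_def)

lemma sqn_nonneg[simp]: "sqn U \<ge> 0"
  by (simp add: sqn_def)

lemma diff2_nonneg[simp]: "diff2 U z \<ge> 0"
  by (simp add: diff2_def)

lemma nn_integral_sqn: "sq_int U \<Longrightarrow> (\<integral>\<^sup>+x. ennreal ((U x)\<^sup>2) \<partial>lborel) = ennreal (sqn U)"
  unfolding sqn_def by (intro nn_integral_eq_integral sq_int_integrable) auto

lemma sq_intI:
  assumes "U \<in> borel_measurable borel" "(\<integral>\<^sup>+x. ennreal ((U x)\<^sup>2) \<partial>lborel) < \<infinity>"
  shows "sq_int U"
  using assms by (auto simp: sq_int_def intro!: integrableI_nonneg)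

lemma sq_int_mult_integrable:
  "sq_int U \<Longrightarrow> sq_int V \<Longrightarrow> integrable lborel (\<lambda>x. U x * V x)"
  by (rule integrable_mult_squares) (auto simp: sq_int_def)

lemma sq_int_Cauchy_Schwarz:
  "sq_int U \<Longrightarrow> sq_int V \<Longrightarrow> \<bar>\<integral>x. U x * V x \<partial>lborel\<bar> \<le> sqrt (sqn U) * sqrt (sqn V)"
  unfolding sqn_def by (rule integral_Cauchy_Schwarz) (auto simp: sq_int_def)

lemma sq_int_cmult: "sq_int U \<Longrightarrow> sq_int (\<lambda>x. c * U x)"
  by (auto simp: sq_int_def power_mult_distrib)

lemma sq_int_add:
  assumes "sq_int U" "sq_int V"
  shows "sq_int (\<lambda>x. U x + V x)"
proof -
  have "integrable lborel (\<lambda>x. (U x)\<^sup>2 + (V x)\<^sup>2 + 2 * (U x * V x))"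
    using assms by (intro Bochner_Integration.integrable_add sq_int_integrable
        integrable_mult_right sq_int_mult_integrable)
  then show ?thesis
    using assms by (auto simp: sq_int_def power2_sum mult.assoc)
qed

lemma sq_int_diff: "sq_int U \<Longrightarrow> sq_int V \<Longrightarrow> sq_int (\<lambda>x. U x - V x)"
  using sq_int_add[of U "\<lambda>x. - 1 * V x"] sq_int_cmult[of V "- 1"] by simp

lemma integrable_lborel_translate:
  fixes f :: "'a::euclidean_space \<Rightarrow> real"
  assumes "integrable lborel f"
  shows "integrable lborel (\<lambda>x. f (x + z))"
proof -
  have [measurable]: "f \<in> borel_measurable borel" using assms by auto
  have "integrable (distr lborel borel ((+) z)) f" using assms by (simp add: lborel_distr_plus)
  then show ?thesis by (subst (asm) integrable_distr_eq) (auto simp: add.commute)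
qed

lemma integral_lborel_translate:
  fixes f :: "'a::euclidean_space \<Rightarrow> real"
  assumes [measurable]: "f \<in> borel_measurable borel"
  shows "(\<integral>x. f (x + z) \<partial>lborel) = (\<integral>x. f x \<partial>lborel)"
proof -
  have "(\<integral>x. f x \<partial>distr lborel borel ((+) z)) = (\<integral>x. f (z + x) \<partial>lborel)"
    by (rule integral_distr) auto
  then show ?thesis by (simp add: lborel_distr_plus add.commute)
qed

lemma nn_integral_lborel_translate:
  fixes f :: "'a::euclidean_space \<Rightarrow> ennreal"
  assumes [measurable]: "f \<in> borel_measurable borel"
  shows "(\<integral>\<^sup>+x. f (x + z) \<partial>lborel) = (\<integral>\<^sup>+x. f x \<partial>lborel)"
proof -
  have "(\<integral>\<^sup>+x. f x \<partial>distr lborel borel ((+) z)) = (\<integral>\<^sup>+x. f (z + x) \<partial>lborel)"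
    by (rule nn_integral_distr) auto
  then show ?thesis by (simp add: lborel_distr_plus add.commute)
qed

lemma sq_int_translate:
  assumes "sq_int U"
  shows "sq_int (\<lambda>x. U (x + z))"
  using assms integrable_lborel_translate[of "\<lambda>x. (U x)\<^sup>2" z] unfolding sq_int_def by auto

lemma sqn_translate:
  assumes "sq_int U"
  shows "sqn (\<lambda>x. U (x + z)) = sqn U"
proof -
  have [measurable]: "U \<in> borel_measurable borel" using assms by measurable
  show ?thesis using integral_lborel_translate[of "\<lambda>x. (U x)\<^sup>2" z] by (simp add: sqn_def)
qed

lemma sqn_diff_expand:
  assumes "sq_int U" "sq_int V"
  shows "sqn (\<lambda>x. U x - V x) = sqn U + sqn V - 2 * (\<integral>x. U x * V x \<partial>lborel)"
proof -
  have "sqn (\<lambda>x. U x - V x) = (\<integral>x. (U x)\<^sup>2 + (V x)\<^sup>2 - 2 * (U x * V x) \<partial>lborel)"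
    unfolding sqn_def by (intro Bochner_Integration.integral_cong) (auto simp: power2_diff mult.assoc)
  then show ?thesis
    using assms by (simp add: sqn_def sq_int_integrable sq_int_mult_integrable)
qed

lemma sqn_add_le:
  assumes "sq_int U" "sq_int V"
  shows "sqn (\<lambda>x. U x + V x) \<le> 2 * sqn U + 2 * sqn V"
proof -
  have "sqn (\<lambda>x. U x + V x) \<le> (\<integral>x. 2 * (U x)\<^sup>2 + 2 * (V x)\<^sup>2 \<partial>lborel)"
    unfolding sqn_def
  proof (rule integral_mono)
    fix x
    show "(U x + V x)\<^sup>2 \<le> 2 * (U x)\<^sup>2 + 2 * (V x)\<^sup>2"
      using sum_squares_bound[of "U x" "V x"] by (simp add: power2_sum)
  qed (use assms sq_int_add[OF assms] in \<open>auto simp: sq_int_integrable\<close>)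
  then show ?thesis using assms by (simp add: sqn_def sq_int_integrable)
qed

lemma sqn_minus: "sqn (\<lambda>x. - U x) = sqn U"
  by (simp add: sqn_def)

lemma sqn_commute: "sqn (\<lambda>x. U x - V x) = sqn (\<lambda>x. V x - U x)"
  by (simp add: sqn_def power2_commute)

lemma sqn_diff_le:
  assumes "sq_int U" "sq_int V"
  shows "sqn (\<lambda>x. U x - V x) \<le> 2 * sqn U + 2 * sqn V"
  using sqn_add_le[OF assms(1) sq_int_cmult[OF assms(2), of "- 1"]] by (simp add: sqn_minus)

lemma corr_0: "corr U 0 = sqn U"
  by (simp add: corr_def sqn_def power2_eq_square)

lemma corr_measurable[measurable]:
  assumes [measurable]: "U \<in> borel_measurable borel"
  shows "corr U \<in> borel_measurable borel"
  unfolding corr_def by measurable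

lemma abs_corr_le:
  assumes "sq_int U"
  shows "\<bar>corr U z\<bar> \<le> sqn U"
  using sq_int_Cauchy_Schwarz[OF sq_int_translate[OF assms, of z] assms]
  by (simp add: corr_def sqn_translate assms)

text \<open>Links the near part, an integral of \<open>diff2\<close>, to the far part, an integral
  of \<open>corr\<close>; continuity of \<open>corr\<close> thus serves both.\<close>

lemma diff2_eq_corr:
  assumes "sq_int U"
  shows "diff2 U z = 2 * sqn U - 2 * corr U z"
  unfolding diff2_def corr_def
  by (subst sqn_diff_expand[OF sq_int_translate[OF assms] assms]) (simp add: sqn_translate assms)

lemma diff2_measurable[measurable]:
  assumes [measurable]: "U \<in> borel_measurable borel"
  shows "diff2 U \<in> borel_measurable borel"
  unfolding diff2_def sqn_def by measurable

lemma nn_integral_diff2: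
  "sq_int U \<Longrightarrow> (\<integral>\<^sup>+x. ennreal ((U (x + z) - U x)\<^sup>2) \<partial>lborel) = ennreal (diff2 U z)"
  unfolding diff2_def by (intro nn_integral_sqn sq_int_diff sq_int_translate)

text \<open>\<open>corr\<close> is the diagonal of a bilinear form, so the difference is split by
  changing one factor at a time. Translations are isometries, hence the bound does not depend on
  \<open>z\<close>.\<close>

lemma corr_diff_le:
  assumes U: "sq_int U" and V: "sq_int V"
  shows "\<bar>corr U z - corr V z\<bar> \<le> sqrt (sqn (\<lambda>x. U x - V x)) * (sqrt (sqn U) + sqrt (sqn V))"
proof -
  define D where "D = (\<lambda>x. U x - V x)"
  have D: "sq_int D" unfolding D_def using assms by (rule sq_int_diff)
  note tr = sq_int_translate[where z=z]
  have "corr U z - corr V z = (\<integral>x. U (x + z) * U x - V (x + z) * V x \<partial>lborel)"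
    unfolding corr_def using assms tr by (simp add: sq_int_mult_integrable)
  also have "\<dots> = (\<integral>x. D (x + z) * U x + V (x + z) * D x \<partial>lborel)"
    by (simp add: D_def algebra_simps)
  also have "\<dots> = (\<integral>x. D (x + z) * U x \<partial>lborel) + (\<integral>x. V (x + z) * D x \<partial>lborel)"
    using assms tr D by (simp add: sq_int_mult_integrable)
  also have "\<bar>\<dots>\<bar> \<le> sqrt (sqn D) * sqrt (sqn U) + sqrt (sqn V) * sqrt (sqn D)"
    using sq_int_Cauchy_Schwarz[OF tr[OF D] U] sq_int_Cauchy_Schwarz[OF tr[OF V] D]
    by (simp add: sqn_translate D V)
  finally show ?thesis by (simp add: D_def algebra_simps)
qed

text \<open>Only the first limit needs an estimate: \<open>sqn\<close> is \<open>corr\<close> at 0,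
  and \<open>diff2\<close> is a combination of the two.\<close>

lemma
  fixes U :: "nat \<Rightarrow> 'a::euclidean_space \<Rightarrow> real"
  assumes U: "\<And>n. sq_int (U n)" and V: "sq_int V"
    and lim: "(\<lambda>n. sqn (\<lambda>x. U n x - V x)) \<longlonglongrightarrow> 0"
  shows tendsto_corr: "(\<lambda>n. corr (U n) z) \<longlonglongrightarrow> corr V z"
    and tendsto_sqn: "(\<lambda>n. sqn (U n)) \<longlonglongrightarrow> sqn V"
    and tendsto_diff2: "(\<lambda>n. diff2 (U n) z) \<longlonglongrightarrow> diff2 V z"
proof -
  define e where "e n = sqn (\<lambda>x. U n x - V x)" for n
  have e: "e \<longlonglongrightarrow> 0" using lim unfolding e_def .
  have bd: "sqn (U n) \<le> 2 * e n + 2 * sqn V" for n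
    using sqn_add_le[OF sq_int_diff[OF U V] V, of n] by (simp add: e_def)
  have c: "(\<lambda>n. corr (U n) z) \<longlonglongrightarrow> corr V z" for z
  proof (rule Lim_transform2[OF tendsto_const], rule Lim_null_comparison)
    show "\<forall>\<^sub>F n in sequentially. norm (corr V z - corr (U n) z) \<le>
        sqrt (e n) * (sqrt (2 * e n + 2 * sqn V) + sqrt (sqn V))"
    proof (intro always_eventually allI)
      fix n
      have "norm (corr V z - corr (U n) z) \<le> sqrt (e n) * (sqrt (sqn (U n)) + sqrt (sqn V))"
        using corr_diff_le[OF U V, of n z] by (simp add: e_def abs_minus_commute)
      also have "\<dots> \<le> sqrt (e n) * (sqrt (2 * e n + 2 * sqn V) + sqrt (sqn V))"
        using bd[of n] by (intro mult_left_mono) (auto simp: e_def)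
      finally show "norm (corr V z - corr (U n) z) \<le>
        sqrt (e n) * (sqrt (2 * e n + 2 * sqn V) + sqrt (sqn V))" .
    qed
    have "(\<lambda>n. sqrt (e n) * (sqrt (2 * e n + 2 * sqn V) + sqrt (sqn V))) \<longlonglongrightarrow>
        sqrt 0 * (sqrt (2 * 0 + 2 * sqn V) + sqrt (sqn V))"
      by (intro tendsto_intros e)
    then show "(\<lambda>n. sqrt (e n) * (sqrt (2 * e n + 2 * sqn V) + sqrt (sqn V))) \<longlonglongrightarrow> 0" by simp
  qed
  show "(\<lambda>n. corr (U n) z) \<longlonglongrightarrow> corr V z" by (rule c)
  show s: "(\<lambda>n. sqn (U n)) \<longlonglongrightarrow> sqn V" using c[of 0] by (simp add: corr_0)
  show "(\<lambda>n. diff2 (U n) z) \<longlonglongrightarrow> diff2 V z"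
    unfolding diff2_eq_corr[OF U] diff2_eq_corr[OF V] by (intro tendsto_intros s c)
qed

section \<open>The energy as an integral over translations\<close>

lemma nn_integral_shear:
  fixes h :: "'a::euclidean_space \<Rightarrow> 'a \<Rightarrow> ennreal"
  assumes [measurable]: "case_prod h \<in> borel_measurable (borel \<Otimes>\<^sub>M borel)"
  shows "(\<integral>\<^sup>+x. \<integral>\<^sup>+y. h x y \<partial>lborel \<partial>lborel) = (\<integral>\<^sup>+z. \<integral>\<^sup>+x. h x (x + z) \<partial>lborel \<partial>lborel)"
proof -
  have "(\<integral>\<^sup>+y. h x y \<partial>lborel) = (\<integral>\<^sup>+z. h x (z + x) \<partial>lborel)" for x
    by (subst nn_integral_lborel_translate) auto
  then have "(\<integral>\<^sup>+x. \<integral>\<^sup>+y. h x y \<partial>lborel \<partial>lborel) = (\<integral>\<^sup>+x. \<integral>\<^sup>+z. h x (x + z) \<partial>lborel \<partial>lborel)"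
    by (simp add: add.commute)
  also have "\<dots> = (\<integral>\<^sup>+z. \<integral>\<^sup>+x. h x (x + z) \<partial>lborel \<partial>lborel)"
    by (rule lborel_pair.Fubini') simp
  finally show ?thesis .
qed

text \<open>Measure preservation of the shear, as an identity of measures: the integrand of
  \<open>J1\<close> changes sign, so the version for nonnegative integrals does not cover
  it.\<close>

lemma distr_shear:
  "distr (lborel \<Otimes>\<^sub>M lborel) (borel \<Otimes>\<^sub>M borel) (\<lambda>(z, x). (x, x + z)) =
    (lborel \<Otimes>\<^sub>M lborel :: ('a::euclidean_space \<times> 'a) measure)"
proof (rule measure_eqI)
  fix A :: "('a \<times> 'a) set"
  assume "A \<in> sets (distr (lborel \<Otimes>\<^sub>M lborel) (borel \<Otimes>\<^sub>M borel) (\<lambda>(z, x). (x, x + z)))"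
  then have A[measurable]: "A \<in> sets (borel \<Otimes>\<^sub>M borel)" by simp
  have "emeasure (distr (lborel \<Otimes>\<^sub>M lborel) (borel \<Otimes>\<^sub>M borel) (\<lambda>(z, x). (x, x + z))) A =
    (\<integral>\<^sup>+p. indicator A p \<partial>distr (lborel \<Otimes>\<^sub>M lborel) (borel \<Otimes>\<^sub>M borel) (\<lambda>(z, x). (x, x + z)))"
    by simp
  also have "\<dots> = (\<integral>\<^sup>+p. indicator A (case p of (z, x) \<Rightarrow> (x, x + z)) \<partial>(lborel \<Otimes>\<^sub>M lborel))"
    by (rule nn_integral_distr) auto
  also have "\<dots> = (\<integral>\<^sup>+z. \<integral>\<^sup>+x. indicator A (x, x + z) \<partial>lborel \<partial>lborel)"
    by (subst lborel.nn_integral_fst[symmetric]) auto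
  also have "\<dots> = (\<integral>\<^sup>+x. \<integral>\<^sup>+y. indicator A (x, y) \<partial>lborel \<partial>lborel)"
    by (subst nn_integral_shear[of "\<lambda>x y. indicator A (x, y)"]) auto
  also have "\<dots> = emeasure (lborel \<Otimes>\<^sub>M lborel) A"
    by (subst lborel.nn_integral_fst) auto
  finally show "emeasure (distr (lborel \<Otimes>\<^sub>M lborel) (borel \<Otimes>\<^sub>M borel) (\<lambda>(z, x). (x, x + z))) A =
    emeasure (lborel \<Otimes>\<^sub>M lborel) A" .
qed (simp cong: sets_pair_measure_cong)

text \<open>Twice \<open>G1\<close>, expressed through translations.\<close>

definition energy :: "real \<Rightarrow> ('a::euclidean_space \<Rightarrow> real) \<Rightarrow> ennreal" where
  "energy s U = (\<integral>\<^sup>+z. ennreal (kern s z) * indicator (ball 0 1) z * ennreal (diff2 U z) \<partial>lborel)"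

definition tail :: "real \<Rightarrow> ('a::euclidean_space \<Rightarrow> real) \<Rightarrow> real" where
  "tail s U = - (\<integral>z. kern s z * indicator (- cball 0 1) z * corr U z \<partial>lborel)"

text \<open>Bochner integrals over the completed measure are compared for measurable integrands,
  while expressions in \<open>ext0\<close> are only almost everywhere equal to Borel functions;
  completeness bridges the gap.\<close>

lemma completion_measurable_AE:
  fixes f g :: "'a \<Rightarrow> 'b::topological_space"
  assumes f: "f \<in> borel_measurable M" and eq: "AE x in M. g x = f x"
  shows "g \<in> borel_measurable (completion M)"
proof (rule measurableI)
  fix A :: "'b set" assume A: "A \<in> sets borel"
  show "g -` A \<inter> space (completion M) \<in> sets (completion M)"
  proof (rule completion.in_sets_AE)
    show "f -` A \<inter> space M \<in> sets (completion M)"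
      using measurable_sets[OF f A] by simp
    show "AE x in completion M. (x \<in> f -` A \<inter> space M) = (x \<in> g -` A \<inter> space (completion M))"
      using AE_completion[OF eq] AE_space by eventually_elim auto
  qed auto
qed auto

lemma AE_lborel_fst:
  assumes "AE x in lborel. P (x::'a::euclidean_space)"
  shows "AE p in lborel \<Otimes>\<^sub>M (lborel :: 'b::euclidean_space measure). P (fst p)"
proof -
  obtain N where N: "{x \<in> space lborel. \<not> P x} \<subseteq> N" "N \<in> null_sets lborel"
    using assms by (auto elim!: AE_E simp: null_setsI)
  then have [measurable]: "N \<in> sets borel" and "emeasure lborel N = 0" by auto
  then have "emeasure (lborel \<Otimes>\<^sub>M (lborel :: 'b measure)) (N \<times> UNIV) = 0"
    by (subst lborel.emeasure_pair_measure_Times) auto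
  then have "N \<times> UNIV \<in> null_sets (lborel \<Otimes>\<^sub>M (lborel :: 'b measure))"
    by (intro null_setsI) auto
  then show ?thesis by (rule AE_I') (use N in auto)
qed

lemma AE_lborel_snd:
  assumes "AE x in lborel. P (x::'a::euclidean_space)"
  shows "AE p in (lborel :: 'b::euclidean_space measure) \<Otimes>\<^sub>M lborel. P (snd p)"
proof -
  obtain N where N: "{x \<in> space lborel. \<not> P x} \<subseteq> N" "N \<in> null_sets lborel"
    using assms by (auto elim!: AE_E simp: null_setsI)
  then have [measurable]: "N \<in> sets borel" and "emeasure lborel N = 0" by auto
  then have "emeasure ((lborel :: 'b measure) \<Otimes>\<^sub>M lborel) (UNIV \<times> N) = 0"
    by (subst lborel.emeasure_pair_measure_Times) auto
  then have "UNIV \<times> N \<in> null_sets ((lborel :: 'b measure) \<Otimes>\<^sub>M lborel)"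
    by (intro null_setsI) auto
  then show ?thesis by (rule AE_I') (use N in auto)
qed

section \<open>Borel representatives\<close>

text \<open>A Borel function keeps \<open>U (x + z)\<close> jointly measurable in \<open>x\<close>
  and \<open>z\<close>. It vanishes everywhere off \<Omega>, not just almost everywhere, so that
  arguments about supports can be pointwise. \<open>repr \<Omega> U U\<close> says that
  \<open>U\<close> represents itself.\<close>

definition repr :: "'a::euclidean_space set \<Rightarrow> ('a \<Rightarrow> real) \<Rightarrow> ('a \<Rightarrow> real) \<Rightarrow> bool" where
  "repr \<Omega> u U \<longleftrightarrow> sq_int U \<and> (\<forall>x. x \<notin> \<Omega> \<longrightarrow> U x = 0) \<and> (AE x in lborel. ext0 \<Omega> u x = U x)"

lemma lebesgue_on_ext0_sq:
  fixes u :: "'a::euclidean_space \<Rightarrow> real"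
  shows "indicator \<Omega> x * (u x)\<^sup>2 = (ext0 \<Omega> u x)\<^sup>2"
  by (auto simp: ext0_def)

lemma repr_exists:
  assumes u: "u \<in> L2 \<Omega>" and \<Omega>: "open \<Omega>"
  obtains U where "repr \<Omega> u U"
proof -
  have \<Omega>'[measurable]: "\<Omega> \<in> sets borel" using \<Omega> by simp
  have "(\<lambda>x. indicator \<Omega> x *\<^sub>R u x) \<in> borel_measurable lebesgue"
    using u unfolding L2_def by (subst (asm) borel_measurable_restrict_space_iff) auto
  moreover have "(\<lambda>x. indicator \<Omega> x *\<^sub>R u x) = ext0 \<Omega> u"
    by (auto simp: ext0_def)
  ultimately have m: "ext0 \<Omega> u \<in> borel_measurable lebesgue" by simp
  then obtain g where g[measurable]: "g \<in> borel_measurable borel" and ae: "AE x in lborel. ext0 \<Omega> u x = g x"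
    using completion_ex_borel_measurable_real[of "ext0 \<Omega> u" lborel] by auto
  \<comment> \<open>The Borel version \<open>g\<close> vanishes off \<Omega> only almost everywhere;
    the indicator restores exact vanishing.\<close>
  define U where "U x = indicator \<Omega> x * g x" for x
  have [measurable]: "U \<in> borel_measurable borel" unfolding U_def by measurable
  have ae': "AE x in lborel. ext0 \<Omega> u x = U x"
    using ae by eventually_elim (auto simp: U_def ext0_def split: split_indicator)
  have "integrable lebesgue (\<lambda>x. (ext0 \<Omega> u x)\<^sup>2)"
    using u unfolding L2_def by (simp add: integrable_restrict_space lebesgue_on_ext0_sq)
  moreover have "AE x in lebesgue. ext0 \<Omega> u x = U x" using ae' by (rule AE_completion)
  moreover have "U \<in> borel_measurable lebesgue" by (simp add: measurable_completion)
  ultimately have "integrable lebesgue (\<lambda>x. (U x)\<^sup>2)"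
    using m by (subst integrable_cong_AE[where g="\<lambda>x. (ext0 \<Omega> u x)\<^sup>2"]) (auto elim: AE_mp)
  then have "integrable lborel (\<lambda>x. (U x)\<^sup>2)" by (simp add: integrable_completion)
  then have "repr \<Omega> u U" unfolding repr_def sq_int_def using ae' by (auto simp: U_def)
  then show thesis by (rule that)
qed

lemma repr_self:
  assumes "sq_int U" "\<And>x. x \<notin> \<Omega> \<Longrightarrow> U x = 0"
  shows "repr \<Omega> U U"
  using assms by (auto simp: repr_def ext0_def intro!: AE_I2)

lemma repr_L2:
  assumes "repr \<Omega> U U" and \<Omega>: "open \<Omega>"
  shows "U \<in> L2 \<Omega>"
proof -
  have sq: "sq_int U" and z: "\<And>x. x \<notin> \<Omega> \<Longrightarrow> U x = 0" using assms(1) by (auto simp: repr_def)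
  have [measurable]: "U \<in> borel_measurable borel" using sq by measurable
  have "ext0 \<Omega> U = U" using z by (auto simp: ext0_def)
  then have "integrable (lebesgue_on \<Omega>) (\<lambda>x. (U x)\<^sup>2)"
    using sq_int_integrable[OF sq] \<Omega>
    by (simp add: integrable_restrict_space lebesgue_on_ext0_sq integrable_completion)
  moreover have "U \<in> borel_measurable (lebesgue_on \<Omega>)"
    by (intro measurable_restrict_space1 measurable_completion) simp
  ultimately show ?thesis by (simp add: L2_def)
qed

lemma repr_diff: "repr \<Omega> u U \<Longrightarrow> repr \<Omega> v V \<Longrightarrow> repr \<Omega> (\<lambda>x. u x - v x) (\<lambda>x. U x - V x)"
  unfolding repr_def by (auto simp: ext0_def intro: sq_int_diff elim!: AE_mp)

lemma L2_norm_eq: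
  assumes r: "repr \<Omega> u U" and \<Omega>: "open \<Omega>"
  shows "L2_norm \<Omega> u = sqrt (sqn U)"
proof -
  have sq: "sq_int U" and ae: "AE x in lborel. ext0 \<Omega> u x = U x" using r by (auto simp: repr_def)
  have [measurable]: "U \<in> borel_measurable borel" using sq by measurable
  have [measurable]: "U \<in> borel_measurable lebesgue" by (simp add: measurable_completion)
  have m: "ext0 \<Omega> u \<in> borel_measurable lebesgue"
    by (rule completion_measurable_AE[OF _ ae]) simp
  have "(\<integral>x. (u x)\<^sup>2 \<partial>lebesgue_on \<Omega>) = (\<integral>x. (ext0 \<Omega> u x)\<^sup>2 \<partial>lebesgue)"
    using \<Omega> by (simp add: integral_restrict_space lebesgue_on_ext0_sq)
  also have "\<dots> = (\<integral>x. (U x)\<^sup>2 \<partial>lebesgue)"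
    using m AE_completion[OF ae] by (intro integral_cong_AE) (auto elim: AE_mp)
  also have "\<dots> = sqn U" unfolding sqn_def by (rule integral_completion) simp
  finally show ?thesis by (simp add: L2_norm_def)
qed

lemma L2_tendsto_iff:
  assumes "\<And>n. repr \<Omega> (u n) (U n)" "repr \<Omega> v V" "open \<Omega>"
  shows "L2_tendsto \<Omega> u v \<longleftrightarrow> (\<lambda>n. sqn (\<lambda>x. U n x - V x)) \<longlonglongrightarrow> 0"
proof -
  have eq: "L2_norm \<Omega> (\<lambda>x. u n x - v x) = sqrt (sqn (\<lambda>x. U n x - V x))" for n
    by (rule L2_norm_eq[OF repr_diff]) (use assms in auto)
  have "(\<lambda>n. sqn (\<lambda>x. U n x - V x)) \<longlonglongrightarrow> 0"
    if "(\<lambda>n. sqrt (sqn (\<lambda>x. U n x - V x))) \<longlonglongrightarrow> 0"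
    using tendsto_power[OF that, of 2] by simp
  moreover have "(\<lambda>n. sqrt (sqn (\<lambda>x. U n x - V x))) \<longlonglongrightarrow> 0"
    if "(\<lambda>n. sqn (\<lambda>x. U n x - V x)) \<longlonglongrightarrow> 0"
    using tendsto_real_sqrt[OF that] by simp
  ultimately show ?thesis unfolding L2_tendsto_def eq by blast
qed

section \<open>The functionals on \<Omega> in terms of a Borel representative\<close>

lemma F0_eq:
  fixes U :: "'a::euclidean_space \<Rightarrow> real"
  assumes "repr \<Omega> u U" "open \<Omega>"
  shows "F0 \<Omega> u = real DIM('a) * measure lborel (ball (0::'a) 1) / 2 * sqn U"
  unfolding F0_def L2_norm_eq[OF assms] by simp

text \<open>Replacing \<open>lebesgue\<close> by \<open>lborel\<close> asks for no measurability of
  a nonnegative integrand, so the null set where \<open>ext0 \<Omega> u\<close> and \<open>U\<close>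
  differ can be discarded in one variable at a time.\<close>

lemma F_eq:
  fixes U :: "'a::euclidean_space \<Rightarrow> real"
  assumes r: "repr \<Omega> u U"
  shows "F \<Omega> s u = ennreal (1/2) * (\<integral>\<^sup>+z. ennreal (kern s z) * ennreal (diff2 U z) \<partial>lborel)"
proof -
  have sq: "sq_int U" and ae: "AE x in lborel. ext0 \<Omega> u x = U x" using r by (auto simp: repr_def)
  have [measurable]: "U \<in> borel_measurable borel" using sq by measurable
  let ?f = "\<lambda>U x y. ennreal (\<bar>U x - U y\<bar>\<^sup>2 / norm (x - y) powr (real DIM('a) + 2 * s))"
  have "(\<integral>\<^sup>+x. \<integral>\<^sup>+y. ?f (ext0 \<Omega> u) x y \<partial>lebesgue \<partial>lebesgue) = (\<integral>\<^sup>+x. \<integral>\<^sup>+y. ?f (ext0 \<Omega> u) x y \<partial>lborel \<partial>lborel)"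
    by (simp add: nn_integral_completion)
  also have "\<dots> = (\<integral>\<^sup>+x. \<integral>\<^sup>+y. ?f U x y \<partial>lborel \<partial>lborel)"
    using ae
  proof (intro nn_integral_cong_AE, eventually_elim)
    fix x assume x: "ext0 \<Omega> u x = U x"
    show "(\<integral>\<^sup>+y. ?f (ext0 \<Omega> u) x y \<partial>lborel) = (\<integral>\<^sup>+y. ?f U x y \<partial>lborel)"
      using ae by (intro nn_integral_cong_AE, eventually_elim) (simp add: x)
  qed
  also have "\<dots> = (\<integral>\<^sup>+z. \<integral>\<^sup>+x. ?f U x (x + z) \<partial>lborel \<partial>lborel)"
    by (rule nn_integral_shear) measurable
  also have "\<dots> = (\<integral>\<^sup>+z. ennreal (kern s z) * ennreal (diff2 U z) \<partial>lborel)"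
  proof (intro nn_integral_cong)
    fix z
    have "(\<integral>\<^sup>+x. ?f U x (x + z) \<partial>lborel) = (\<integral>\<^sup>+x. ennreal (kern s z) * ennreal ((U (x + z) - U x)\<^sup>2) \<partial>lborel)"
      by (intro nn_integral_cong) (simp add: kern_def ennreal_mult[symmetric] power2_commute)
    also have "\<dots> = ennreal (kern s z) * ennreal (diff2 U z)"
      using sq by (subst nn_integral_cmult) (auto simp: nn_integral_diff2)
    finally show "(\<integral>\<^sup>+x. ?f U x (x + z) \<partial>lborel) = ennreal (kern s z) * ennreal (diff2 U z)" .
  qed
  finally show ?thesis unfolding F_def by simp
qed

lemma G1_eq:
  fixes U :: "'a::euclidean_space \<Rightarrow> real"
  assumes r: "repr \<Omega> u U"
  shows "G1 \<Omega> s u = ennreal (1/2) * energy s U"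
proof -
  have sq: "sq_int U" and ae: "AE x in lborel. ext0 \<Omega> u x = U x" using r by (auto simp: repr_def)
  have [measurable]: "U \<in> borel_measurable borel" using sq by measurable
  have B1[measurable]: "(B1 :: ('a \<times> 'a) set) \<in> sets (borel \<Otimes>\<^sub>M borel)"
  proof -
    have "{p \<in> space (borel \<Otimes>\<^sub>M borel). norm (fst p - snd p :: 'a) < 1} \<in> sets (borel \<Otimes>\<^sub>M borel)"
      by measurable
    then show ?thesis by (simp add: B1_def split_beta' space_pair_measure)
  qed
  let ?f = "\<lambda>U x y. ennreal (\<bar>U x - U y\<bar>\<^sup>2 / norm (x - y) powr (real DIM('a) + 2 * s)) * indicator B1 (x, y)"
  have "(\<integral>\<^sup>+(x, y)\<in>B1. ennreal (\<bar>ext0 \<Omega> u x - ext0 \<Omega> u y\<bar>\<^sup>2 / norm (x - y) powr (real DIM('a) + 2 * s)) \<partial>lebesgue)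
    = (\<integral>\<^sup>+p. ?f (ext0 \<Omega> u) (fst p) (snd p) \<partial>(lborel \<Otimes>\<^sub>M lborel))"
    by (simp add: nn_integral_completion lborel_prod split_beta)
  also have "\<dots> = (\<integral>\<^sup>+p. ?f U (fst p) (snd p) \<partial>(lborel \<Otimes>\<^sub>M lborel))"
    using AE_lborel_fst[OF ae] AE_lborel_snd[OF ae] by (intro nn_integral_cong_AE, eventually_elim) simp
  also have "\<dots> = (\<integral>\<^sup>+x. \<integral>\<^sup>+y. ?f U x y \<partial>lborel \<partial>lborel)"
    by (subst lborel.nn_integral_fst[symmetric]) auto
  also have "\<dots> = (\<integral>\<^sup>+z. \<integral>\<^sup>+x. ?f U x (x + z) \<partial>lborel \<partial>lborel)"
    by (rule nn_integral_shear) measurable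
  also have "\<dots> = energy s U"
    unfolding energy_def
  proof (intro nn_integral_cong)
    fix z
    have "(\<integral>\<^sup>+x. ?f U x (x + z) \<partial>lborel) =
      (\<integral>\<^sup>+x. ennreal (kern s z) * indicator (ball 0 1) z * ennreal ((U (x + z) - U x)\<^sup>2) \<partial>lborel)"
      by (intro nn_integral_cong)
        (auto simp: kern_def B1_def ennreal_mult[symmetric] power2_commute split: split_indicator)
    also have "\<dots> = ennreal (kern s z) * indicator (ball 0 1) z * ennreal (diff2 U z)"
      using sq by (subst nn_integral_cmult) (auto simp: nn_integral_diff2)
    finally show "(\<integral>\<^sup>+x. ?f U x (x + z) \<partial>lborel) = \<dots>" .
  qed
  finally show ?thesis unfolding G1_def by simp
qed

text \<open>Identifies the region of integration of \<open>J1\<close>. For the second inclusion it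
  suffices to move the second coordinate into the open ball around the first.\<close>

lemma closure_B1: "closure (B1 :: ('a::euclidean_space \<times> 'a) set) = {(x, y). norm (x - y) \<le> 1}"
proof
  have "closed {p :: 'a \<times> 'a. norm (fst p - snd p) \<le> 1}"
    by (intro closed_Collect_le continuous_intros)
  then show "closure (B1 :: ('a \<times> 'a) set) \<subseteq> {(x, y). norm (x - y) \<le> 1}"
    by (intro closure_minimal) (auto simp: B1_def split_beta')
  show "{(x, y). norm (x - y) \<le> 1} \<subseteq> closure (B1 :: ('a \<times> 'a) set)"
  proof safe
    fix x y :: 'a assume "norm (x - y) \<le> 1"
    then have y: "y \<in> closure (ball x 1)" by (simp add: dist_norm)
    show "(x, y) \<in> closure B1"
      unfolding closure_approachable
    proof safe
      fix e :: real assume "e > 0"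
      then obtain y' where "y' \<in> ball x 1" "dist y' y < e" using y unfolding closure_approachable by blast
      then show "\<exists>p\<in>B1. dist p (x, y) < e"
        by (intro bexI[of _ "(x, y')"]) (auto simp: B1_def dist_norm dist_Pair_Pair)
    qed
  qed
qed

text \<open>Cauchy-Schwarz against the indicator of \<Omega>, which has finite measure; this is
  where the factor \<open>measure lebesgue \<Omega>\<close> of the compactness bound
  originates.\<close>

lemma repr_integrable:
  assumes r: "repr \<Omega> u U" and \<Omega>: "open \<Omega>" "bounded \<Omega>"
  shows "integrable lborel U" "(\<integral>x. \<bar>U x\<bar> \<partial>lborel)\<^sup>2 \<le> measure lebesgue \<Omega> * sqn U"
proof -
  have sq: "sq_int U" and z: "\<And>x. x \<notin> \<Omega> \<Longrightarrow> U x = 0" using r by (auto simp: repr_def)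
  have [measurable]: "U \<in> borel_measurable borel" using sq by measurable
  have [measurable]: "\<Omega> \<in> sets borel" using \<Omega> by simp
  have fin: "emeasure lborel \<Omega> < \<infinity>"
    using \<Omega> emeasure_bounded_finite by blast
  have ind2: "(indicator \<Omega> x :: real)\<^sup>2 = indicator \<Omega> x" for x
    by (simp split: split_indicator)
  have I: "sq_int (indicator \<Omega> :: _ \<Rightarrow> real)"
    using fin by (intro sq_intI) (auto simp: ind2 ennreal_indicator)
  have "(\<lambda>x. indicator \<Omega> x * U x) = U" using z by (auto split: split_indicator)
  then show "integrable lborel U" using sq_int_mult_integrable[OF I sq] by metis
  have aU: "sq_int (\<lambda>x. \<bar>U x\<bar>)" using sq by (auto simp: sq_int_def)
  have "sqn (indicator \<Omega> :: _ \<Rightarrow> real) = measure lborel \<Omega>"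
    unfolding sqn_def by (simp add: ind2)
  moreover have "sqn (\<lambda>x. \<bar>U x\<bar>) = sqn U" by (simp add: sqn_def)
  moreover have "(\<lambda>x. indicator \<Omega> x * \<bar>U x\<bar>) = (\<lambda>x. \<bar>U x\<bar>)"
    using z by (auto split: split_indicator)
  ultimately have "\<bar>\<integral>x. \<bar>U x\<bar> \<partial>lborel\<bar> \<le> sqrt (measure lborel \<Omega>) * sqrt (sqn U)"
    using sq_int_Cauchy_Schwarz[OF I aU] by metis
  then have "(\<integral>x. \<bar>U x\<bar> \<partial>lborel)\<^sup>2 \<le> (sqrt (measure lborel \<Omega>) * sqrt (sqn U))\<^sup>2"
    by (intro power_mono) auto
  then show "(\<integral>x. \<bar>U x\<bar> \<partial>lborel)\<^sup>2 \<le> measure lebesgue \<Omega> * sqn U"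
    by (simp add: power_mult_distrib)
qed

lemma integrable_shear_product:
  fixes U V :: "'a::euclidean_space \<Rightarrow> real"
  assumes U: "integrable lborel U" and V: "integrable lborel V"
  shows "integrable (lborel \<Otimes>\<^sub>M lborel) (\<lambda>(z, x). U x * V (x + z))"
proof -
  have "integrable (lborel \<Otimes>\<^sub>M lborel) (\<lambda>(x, y). U x * V y)"
  proof (rule lborel_pair.Fubini_integrable)
    show "integrable lborel (\<lambda>x. \<integral>y. norm (case (x, y) of (x, y) \<Rightarrow> U x * V y) \<partial>lborel)"
      using U by (simp add: abs_mult)
  qed (use U V in auto)
  then have "integrable (distr (lborel \<Otimes>\<^sub>M lborel) (borel \<Otimes>\<^sub>M borel) (\<lambda>(z, x). (x, x + z))) (\<lambda>(x, y). U x * V y)"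
    by (simp add: distr_shear)
  moreover have [measurable]: "U \<in> borel_measurable borel" "V \<in> borel_measurable borel" using U V by auto
  ultimately have "integrable (lborel \<Otimes>\<^sub>M lborel) (\<lambda>p. (\<lambda>(x, y). U x * V y) ((\<lambda>(z, x). (x, x + z)) p))"
    by (subst (asm) integrable_distr_eq) auto
  then show ?thesis by (simp add: split_beta')
qed

text \<open>For \<open>s \<ge> 0\<close> the kernel is at most 1 outside the unit ball, so
  integrability of \<open>U\<close> alone suffices.\<close>

lemma integrable_tail_pair:
  fixes U :: "'a::euclidean_space \<Rightarrow> real"
  assumes U: "integrable lborel U" and s: "s \<ge> 0"
  shows "integrable (lborel \<Otimes>\<^sub>M lborel)
    (\<lambda>(z, x). kern s z * indicator (- cball 0 1) z * (U (x + z) * U x))"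
proof (rule Bochner_Integration.integrable_bound[OF integrable_shear_product[OF U U]])
  have [measurable]: "U \<in> borel_measurable borel" using U by auto
  show "(\<lambda>(z, x). kern s z * indicator (- cball 0 1) z * (U (x + z) * U x))
    \<in> borel_measurable (lborel \<Otimes>\<^sub>M lborel)"
    by measurable
  show "AE p in lborel \<Otimes>\<^sub>M lborel.
    norm (case p of (z, x) \<Rightarrow> kern s z * indicator (- cball 0 1) z * (U (x + z) * U x))
    \<le> norm (case p of (z, x) \<Rightarrow> U x * U (x + z))"
  proof (intro AE_I2, safe)
    fix z x :: 'a
    have "kern s z * indicator (- cball 0 1) z \<le> 1"
      using kern_le_1[OF s, of z] by (auto split: split_indicator)
    then have "(kern s z * indicator (- cball 0 1) z) * \<bar>U (x + z) * U x\<bar> \<le> 1 * \<bar>U (x + z) * U x\<bar>"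
      by (intro mult_right_mono) auto
    then show "norm (kern s z * indicator (- cball 0 1) z * (U (x + z) * U x)) \<le> norm (U x * U (x + z))"
      by (simp add: abs_mult mult_ac)
  qed
qed

lemma tail_eq_pair:
  fixes U :: "'a::euclidean_space \<Rightarrow> real"
  assumes U: "integrable lborel U" and s: "s \<ge> 0"
  shows "(\<integral>(z, x). kern s z * indicator (- cball 0 1) z * (U (x + z) * U x) \<partial>(lborel \<Otimes>\<^sub>M lborel)) = - tail s U"
proof -
  have "(\<integral>(z, x). kern s z * indicator (- cball 0 1) z * (U (x + z) * U x) \<partial>(lborel \<Otimes>\<^sub>M lborel)) =
    (\<integral>z. \<integral>x. kern s z * indicator (- cball 0 1) z * (U (x + z) * U x) \<partial>lborel \<partial>lborel)"
    using lborel_pair.integral_fst'[OF integrable_tail_pair[OF U s]] by simp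
  then show ?thesis by (simp add: tail_def corr_def)
qed

text \<open>The integrand has no sign, so null sets are removed and variables changed on the product
  space directly rather than in iterated integrals.\<close>

lemma J1_eq:
  fixes U :: "'a::euclidean_space \<Rightarrow> real"
  assumes r: "repr \<Omega> u U" and \<Omega>: "open \<Omega>" "bounded \<Omega>" and s: "s \<ge> 0"
  shows "J1 \<Omega> s u = tail s U"
proof -
  have sq: "sq_int U" and ae: "AE x in lborel. ext0 \<Omega> u x = U x" using r by (auto simp: repr_def)
  have [measurable]: "U \<in> borel_measurable borel" using sq by measurable
  have U: "integrable lborel U" by (rule repr_integrable[OF r \<Omega>])
  let ?f = "\<lambda>U (x, y). kern s (x - y) * indicator (- cball 0 1) (x - y) * (U x * U y)"
  have m: "?f U \<in> borel_measurable (borel \<Otimes>\<^sub>M borel)" by measurable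
  have m': "?f U \<in> borel_measurable lborel"
    using m by (simp add: borel_prod)
  have ae2: "AE p in lborel. ?f (ext0 \<Omega> u) p = ?f U p"
    using AE_lborel_fst[OF ae, where ?'b='a] AE_lborel_snd[OF ae, where ?'b='a]
    unfolding lborel_prod by eventually_elim (auto simp: split_beta)
  have "(LINT (x, y) : - closure B1 | lebesgue.
          ext0 \<Omega> u x * ext0 \<Omega> u y / norm (x - y) powr (real DIM('a) + 2 * s))
     = (\<integral>p. ?f (ext0 \<Omega> u) p \<partial>lebesgue)"
    unfolding set_lebesgue_integral_def closure_B1
    by (intro Bochner_Integration.integral_cong) (auto simp: kern_def split: split_indicator)
  also have "\<dots> = (\<integral>p. ?f U p \<partial>lebesgue)"
    by (intro integral_cong_AE completion_measurable_AE[OF m' ae2] AE_completion[OF ae2]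
        measurable_completion m')
  also have "\<dots> = (\<integral>p. ?f U p \<partial>lborel)"
    by (rule integral_completion) (rule m')
  also have "\<dots> = (\<integral>p. ?f U p \<partial>distr (lborel \<Otimes>\<^sub>M lborel) (borel \<Otimes>\<^sub>M borel) (\<lambda>(z, x). (x, x + z)))"
    by (subst distr_shear) (simp only: lborel_prod)
  also have "\<dots> = (\<integral>p. ?f U ((\<lambda>(z, x). (x, x + z)) p) \<partial>(lborel \<Otimes>\<^sub>M lborel))"
    by (rule integral_distr) (use m in auto)
  also have "\<dots> = (\<integral>(z, x). kern s z * indicator (- cball 0 1) z * (U (x + z) * U x) \<partial>(lborel \<Otimes>\<^sub>M lborel))"
    by (intro Bochner_Integration.integral_cong) (auto simp: split: split_indicator)
  finally show ?thesis
    unfolding J1_def tail_eq_pair[OF U s] by simp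
qed

text \<open>Bounding the kernel by 1 leaves the integral of
  \<open>\<bar>U x\<bar> * \<bar>U y\<bar>\<close> over all pairs, which is the square of the
  \<open>L1\<close> norm. The bound is uniform in \<open>s\<close>.\<close>

lemma tail_ge:
  fixes U :: "'a::euclidean_space \<Rightarrow> real"
  assumes U: "integrable lborel U" and s: "s \<ge> 0"
  shows "- (\<integral>x. \<bar>U x\<bar> \<partial>lborel)\<^sup>2 \<le> tail s U"
proof -
  have [measurable]: "U \<in> borel_measurable borel" using U by auto
  have aU: "integrable lborel (\<lambda>x. \<bar>U x\<bar>)" using U by simp
  have i: "integrable (lborel \<Otimes>\<^sub>M lborel) (\<lambda>(z, x). \<bar>U x\<bar> * \<bar>U (x + z)\<bar>)"
    by (rule integrable_shear_product[OF aU aU])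
  have "- tail s U \<le> (\<integral>(z, x). \<bar>U x\<bar> * \<bar>U (x + z)\<bar> \<partial>(lborel \<Otimes>\<^sub>M lborel))"
    unfolding tail_eq_pair[OF U s, symmetric]
  proof (rule integral_mono[OF integrable_tail_pair[OF U s] i], safe)
    fix z x :: 'a
    have "0 \<le> kern s z * indicator (- cball 0 1) z" "kern s z * indicator (- cball 0 1) z \<le> 1"
      using kern_le_1[OF s, of z] by (auto split: split_indicator)
    then have "(kern s z * indicator (- cball 0 1) z) * (U (x + z) * U x) \<le> 1 * \<bar>U (x + z) * U x\<bar>"
      by (meson abs_ge_self abs_ge_zero mult_left_mono mult_right_mono order_trans)
    then show "kern s z * indicator (- cball 0 1) z * (U (x + z) * U x) \<le> \<bar>U x\<bar> * \<bar>U (x + z)\<bar>"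
      by (simp add: abs_mult mult_ac)
  qed
  also have "\<dots> = (\<integral>p. (\<lambda>(x, y). \<bar>U x\<bar> * \<bar>U y\<bar>) ((\<lambda>(z, x). (x, x + z)) p) \<partial>(lborel \<Otimes>\<^sub>M lborel))"
    by (intro Bochner_Integration.integral_cong) auto
  also have "\<dots> = (\<integral>(x, y). \<bar>U x\<bar> * \<bar>U y\<bar> \<partial>distr (lborel \<Otimes>\<^sub>M lborel) (borel \<Otimes>\<^sub>M borel) (\<lambda>(z, x). (x, x + z)))"
    by (rule integral_distr[symmetric]) auto
  also have "\<dots> = (\<integral>(x, y). \<bar>U x\<bar> * \<bar>U y\<bar> \<partial>(lborel \<Otimes>\<^sub>M lborel))"
    unfolding distr_shear ..
  also have "\<dots> = (\<integral>x. \<integral>y. \<bar>U x\<bar> * \<bar>U y\<bar> \<partial>lborel \<partial>lborel)"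
  proof -
    have "integrable (lborel \<Otimes>\<^sub>M lborel) (\<lambda>(x, y). \<bar>U x\<bar> * \<bar>U y\<bar>)"
    proof (rule lborel_pair.Fubini_integrable)
      show "integrable lborel (\<lambda>x. \<integral>y. norm (case (x, y) of (x, y) \<Rightarrow> \<bar>U x\<bar> * \<bar>U y\<bar>) \<partial>lborel)"
        using U by (simp add: abs_mult)
    qed (use U in auto)
    from lborel_pair.integral_fst'[OF this] show ?thesis by simp
  qed
  also have "\<dots> = (\<integral>x. \<bar>U x\<bar> \<partial>lborel)\<^sup>2" by (simp add: power2_eq_square)
  finally show ?thesis by linarith
qed

text \<open>Outside the unit ball \<open>diff2\<close> is \<open>2 * sqn U - 2 * corr U\<close>. The
  kernel has finite mass \<open>c\<close> there when \<open>s > 0\<close>; the \<open>sqn\<close>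
  part contributes \<open>sqn U * c\<close>, which is exactly the subtracted \<open>F0 / s\<close>,
  and the \<open>corr\<close> part is the tail.\<close>

lemma Fhat_eq:
  fixes U :: "'a::euclidean_space \<Rightarrow> real"
  assumes r: "repr \<Omega> u U" and \<Omega>: "open \<Omega>" "bounded \<Omega>" and s: "s \<ge> 0"
  shows "Fhat \<Omega> s u = enn2ereal (ennreal (1/2) * energy s U) + ereal (tail s U)"
proof (cases "s = 0")
  case True
  then show ?thesis by (simp add: Fhat_def G1_eq[OF r] J1_eq[OF r \<Omega>])
next
  case False
  then have s0: "s > 0" using s by simp
  have sq: "sq_int U" using r by (auto simp: repr_def)
  have [measurable]: "U \<in> borel_measurable borel" using sq by measurable
  have [measurable]: "ball (0::'a) 1 \<in> sets borel" by simp
  define k where "k z = kern s z * indicator (- cball 0 1) (z::'a)" for z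
  define c where "c = measure lborel (ball (0::'a) 1) * DIM('a) / (2 * s)"
  have k0: "k z \<ge> 0" for z by (simp add: k_def)
  have [measurable]: "k \<in> borel_measurable borel" unfolding k_def by measurable
  \<comment> \<open>The unit sphere belongs neither to the open ball nor to the complement of the
    closed one.\<close>
  have ne: "AE z in lborel. norm (z::'a) \<noteq> 1"
  proof (rule AE_I')
    show "sphere (0::'a) 1 \<in> null_sets lborel"
      using negligible_sphere[of "0::'a" 1] by (simp add: negligible_iff_null_sets null_sets_completion_iff)
  qed auto
  have kn: "(\<integral>\<^sup>+z. ennreal (k z) \<partial>lborel) = ennreal c"
    unfolding c_def nn_integral_kern_outside[OF s0, symmetric]
    using ne by (intro nn_integral_cong_AE, eventually_elim) (auto simp: k_def split: split_indicator)
  have c0: "c \<ge> 0" using s0 by (simp add: c_def)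
  have ki: "integrable lborel k" and kI: "(\<integral>z. k z \<partial>lborel) = c"
    using nn_integral_eq_integrable[of k lborel c] kn k0 c0 by auto
  have kci: "integrable lborel (\<lambda>z. k z * corr U z)"
  proof (rule Bochner_Integration.integrable_bound[OF integrable_mult_left[OF ki, of "sqn U"]])
    show "AE z in lborel. norm (k z * corr U z) \<le> norm (k z * sqn U)"
      using k0 abs_corr_le[OF sq] by (auto simp: abs_mult intro!: mult_left_mono)
  qed measurable
  have kdi: "integrable lborel (\<lambda>z. k z * diff2 U z)"
    unfolding diff2_eq_corr[OF sq] right_diff_distrib
    using ki kci by (simp add: mult.left_commute[of _ 2])
  define R where "R = (\<integral>z. k z * diff2 U z \<partial>lborel)"
  have "R = (\<integral>z. 2 * sqn U * k z - 2 * (k z * corr U z) \<partial>lborel)"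
    unfolding R_def diff2_eq_corr[OF sq] by (simp add: algebra_simps)
  also have "\<dots> = 2 * sqn U * c + 2 * tail s U"
    using ki kci by (simp add: kI) (simp add: k_def tail_def)
  finally have R: "R = 2 * sqn U * c + 2 * tail s U" .
  have R0: "R \<ge> 0" unfolding R_def using k0 by simp
  have "(\<integral>\<^sup>+z. ennreal (kern s z) * ennreal (diff2 U z) \<partial>lborel) =
    (\<integral>\<^sup>+z. ennreal (kern s z) * indicator (ball 0 1) z * ennreal (diff2 U z) + ennreal (k z * diff2 U z) \<partial>lborel)"
    using ne by (intro nn_integral_cong_AE, eventually_elim)
      (auto simp: k_def ennreal_mult split: split_indicator)
  also have "\<dots> = energy s U + (\<integral>\<^sup>+z. ennreal (k z * diff2 U z) \<partial>lborel)"
    unfolding energy_def by (rule nn_integral_add) measurable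
  also have "(\<integral>\<^sup>+z. ennreal (k z * diff2 U z) \<partial>lborel) = ennreal R"
    unfolding R_def by (rule nn_integral_eq_integral[OF kdi]) (use k0 in auto)
  finally have "F \<Omega> s u = ennreal (1/2) * (energy s U + ennreal R)"
    unfolding F_eq[OF r] by (simp only:)
  moreover have "ennreal (1/2) * ennreal R = ennreal (R / 2)"
    by (subst ennreal_mult[symmetric]) (use R0 in auto)
  ultimately have F: "F \<Omega> s u = ennreal (1/2) * energy s U + ennreal (R / 2)"
    by (simp only: distrib_left)
  have "1 / s * F0 \<Omega> u = sqn U * c"
    unfolding F0_eq[OF r \<Omega>(1)] c_def using s0 by (simp add: field_simps)
  then have "R / 2 - 1 / s * F0 \<Omega> u = tail s U" unfolding R by (simp add: field_simps)
  then have *: "ereal (R / 2) - ereal (1 / s * F0 \<Omega> u) = ereal (tail s U)" by simp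
  have "Fhat \<Omega> s u = enn2ereal (ennreal (1/2) * energy s U) + ereal (R / 2) - ereal (1 / s * F0 \<Omega> u)"
    using False R0 by (simp add: Fhat_def F plus_ennreal.rep_eq enn2ereal_ennreal)
  \<comment> \<open>Regrouping is legitimate even if the energy is infinite, because the other two
    terms are finite.\<close>
  also have "\<dots> = enn2ereal (ennreal (1/2) * energy s U) + (ereal (R / 2) - ereal (1 / s * F0 \<Omega> u))"
    by (cases "enn2ereal (ennreal (1/2) * energy s U)") auto
  finally show ?thesis unfolding * .
qed

section \<open>The liminf inequality\<close>

lemma energy_mono:
  fixes U :: "'a::euclidean_space \<Rightarrow> real"
  assumes "s \<le> s'"
  shows "energy s U \<le> energy s' U"
  unfolding energy_def
proof (rule nn_integral_mono, rule mult_right_mono)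
  fix z :: 'a
  show "ennreal (kern s z) * indicator (ball 0 1) z \<le> ennreal (kern s' z) * indicator (ball 0 1) z"
    using kern_mono[OF assms, of z] by (cases "norm z < 1") (auto intro!: ennreal_leI)
qed simp

lemma energy_lower_semicontinuous:
  fixes U :: "nat \<Rightarrow> 'a::euclidean_space \<Rightarrow> real"
  assumes U: "\<And>n. sq_int (U n)" and V: "sq_int V"
    and lim: "(\<lambda>n. sqn (\<lambda>x. U n x - V x)) \<longlonglongrightarrow> 0"
  shows "energy s V \<le> liminf (\<lambda>n. energy s (U n))"
proof -
  have [measurable]: "U n \<in> borel_measurable borel" for n using U by measurable
  have [measurable]: "ball (0::'a) 1 \<in> sets borel" by simp
  let ?k = "\<lambda>z::'a. ennreal (kern s z) * indicator (ball 0 1) z"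
  have "liminf (\<lambda>n. ?k z * ennreal (diff2 (U n) z)) = ?k z * ennreal (diff2 V z)" for z
  proof (rule lim_imp_Liminf)
    have "(\<lambda>n. ennreal (diff2 (U n) z)) \<longlonglongrightarrow> ennreal (diff2 V z)"
      by (intro tendsto_ennrealI tendsto_diff2[OF U V lim])
    then show "(\<lambda>n. ?k z * ennreal (diff2 (U n) z)) \<longlonglongrightarrow> ?k z * ennreal (diff2 V z)"
      by (intro ennreal_tendsto_cmult) (auto split: split_indicator)
  qed simp
  then have "energy s V = (\<integral>\<^sup>+z. liminf (\<lambda>n. ?k z * ennreal (diff2 (U n) z)) \<partial>lborel)"
    by (simp add: energy_def)
  also have "\<dots> \<le> liminf (\<lambda>n. energy s (U n))"
    unfolding energy_def by (rule nn_integral_liminf) measurable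
  finally show ?thesis .
qed

lemma corr_eq_0_far:
  fixes U :: "'a::euclidean_space \<Rightarrow> real"
  assumes "\<And>x. norm x > R \<Longrightarrow> U x = 0" "norm z > 2 * R"
  shows "corr U z = 0"
proof -
  have "U (x + z) * U x = 0" for x
    using assms(1)[of x] assms(1)[of "x + z"] assms(2) norm_triangle_ineq4[of "x + z" x] by fastforce
  then have "(\<lambda>x. U (x + z) * U x) = (\<lambda>_. 0)" by (rule ext)
  then show ?thesis unfolding corr_def by (simp only: integral_zero)
qed

text \<open>At \<open>s = 0\<close> the kernel is not integrable at infinity, so domination must
  come from \<open>corr\<close>: a common bound on the supports makes all autocorrelations vanish
  outside one ball, and they are uniformly bounded there.\<close>

lemma tendsto_tail:
  fixes U :: "nat \<Rightarrow> 'a::euclidean_space \<Rightarrow> real"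
  assumes U: "\<And>n. sq_int (U n)" and V: "sq_int V"
    and lim: "(\<lambda>n. sqn (\<lambda>x. U n x - V x)) \<longlonglongrightarrow> 0"
    and R: "\<And>n x. norm x > R \<Longrightarrow> U n x = 0"
    and s: "\<And>n. s n \<ge> 0" "s \<longlonglongrightarrow> s0"
  shows "(\<lambda>n. tail (s n) (U n)) \<longlonglongrightarrow> tail s0 V"
proof -
  have [measurable]: "U n \<in> borel_measurable borel" for n using U by measurable
  have [measurable]: "V \<in> borel_measurable borel" using V by measurable
  obtain B where B: "\<And>n. \<bar>sqn (U n)\<bar> \<le> B"
    using convergent_imp_Bseq[OF convergentI[OF tendsto_sqn[OF U V lim]]]
    unfolding Bseq_def real_norm_def by blast
  then have B0: "B \<ge> 0" using order_trans[OF abs_ge_zero] by blast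
  have "(\<lambda>n. \<integral>z. kern (s n) z * indicator (- cball 0 1) z * corr (U n) z \<partial>lborel)
    \<longlonglongrightarrow> (\<integral>z. kern s0 z * indicator (- cball 0 1) z * corr V z \<partial>lborel)"
  proof (rule integral_dominated_convergence)
    show "integrable lborel (\<lambda>z::'a. B * indicator (cball 0 (2 * R)) z)"
      using emeasure_lborel_cball_finite[of "0::'a" "2 * R"] by simp
    show "AE z in lborel. (\<lambda>n. kern (s n) z * indicator (- cball 0 1) z * corr (U n) z)
      \<longlonglongrightarrow> kern s0 z * indicator (- cball 0 1) z * corr V z"
      by (intro AE_I2 tendsto_intros tendsto_kern s tendsto_corr[OF U V lim])
    fix n
    show "AE z in lborel. norm (kern (s n) z * indicator (- cball 0 1) z * corr (U n) z)
      \<le> B * indicator (cball 0 (2 * R)) z"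
    proof (intro AE_I2)
      fix z :: 'a
      have k: "0 \<le> kern (s n) z * indicator (- cball 0 1) z" "kern (s n) z * indicator (- cball 0 1) z \<le> 1"
        using kern_le_1[OF s(1), of z n] by (auto split: split_indicator)
      have "\<bar>corr (U n) z\<bar> \<le> B * indicator (cball 0 (2 * R)) z"
        using abs_corr_le[OF U, of n z] B[of n] corr_eq_0_far[of R "U n" z] R
        by (auto split: split_indicator)
      with k have "(kern (s n) z * indicator (- cball 0 1) z) * \<bar>corr (U n) z\<bar> \<le> 1 * (B * indicator (cball 0 (2 * R)) z)"
        by (intro mult_mono) auto
      then show "norm (kern (s n) z * indicator (- cball 0 1) z * corr (U n) z)
        \<le> B * indicator (cball 0 (2 * R)) z"
        using k by (simp add: abs_mult)
    qed
  qed measurable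
  then show ?thesis unfolding tail_def by (rule tendsto_minus)
qed

lemma repr_zero_far:
  assumes "repr \<Omega> u U" "\<Omega> \<subseteq> cball 0 R" "norm x > R"
  shows "U x = 0"
  using assms by (force simp: repr_def)

lemma liminf_Fhat:
  fixes U :: "nat \<Rightarrow> 'a::euclidean_space \<Rightarrow> real"
  assumes \<Omega>: "open \<Omega>" "bounded \<Omega>" and s: "\<And>n. s n \<ge> 0" "s \<longlonglongrightarrow> 0"
    and u: "\<And>n. repr \<Omega> (u n) (U n)" and v: "repr \<Omega> v V"
    and lim: "(\<lambda>n. sqn (\<lambda>x. U n x - V x)) \<longlonglongrightarrow> 0"
  shows "Fhat \<Omega> 0 v \<le> liminf (\<lambda>n. Fhat \<Omega> (s n) (u n))"
proof -
  have U: "sq_int (U n)" for n using u by (auto simp: repr_def)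
  have V: "sq_int V" using v by (auto simp: repr_def)
  obtain R where R: "\<Omega> \<subseteq> cball 0 R" using \<Omega>(2) unfolding bounded_iff by (auto simp: subset_iff)
  have t: "(\<lambda>n. tail (s n) (U n)) \<longlonglongrightarrow> tail 0 V"
    by (rule tendsto_tail[OF U V lim _ s]) (rule repr_zero_far[OF u R])
  \<comment> \<open>Halving followed by the embedding into the extended reals is continuous and
    monotone, hence commutes with \<open>liminf\<close>.\<close>
  let ?g = "\<lambda>x. enn2ereal (ennreal (1/2) * x)"
  have cont: "continuous_on UNIV ?g"
  proof -
    have "continuous_on UNIV (\<lambda>x. ennreal (1/2) * x)"
      unfolding continuous_on_def by (intro ballI ennreal_tendsto_cmult[OF ennreal_less_top] tendsto_ident_at)
    then show ?thesis
      by (intro continuous_on_compose2[OF continuous_on_enn2ereal]) auto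
  qed
  have mono: "mono ?g"
    by (auto intro!: monoI mult_left_mono simp: less_eq_ennreal.rep_eq[symmetric])
  have "energy 0 V \<le> liminf (\<lambda>n. energy 0 (U n))"
    by (rule energy_lower_semicontinuous[OF U V lim])
  \<comment> \<open>By monotonicity in \<open>s\<close>, Fatou's lemma was needed only for the fixed
    kernel at \<open>s = 0\<close>.\<close>
  also have "\<dots> \<le> liminf (\<lambda>n. energy (s n) (U n))"
    by (intro Liminf_mono always_eventually allI energy_mono s)
  finally have "?g (energy 0 V) \<le> ?g (liminf (\<lambda>n. energy (s n) (U n)))"
    using mono by (auto dest: monoD)
  also have "\<dots> = liminf (\<lambda>n. ?g (energy (s n) (U n)))"
    by (rule Liminf_compose_continuous_mono[OF cont mono, symmetric]) simp
  finally have "Fhat \<Omega> 0 v \<le> ereal (tail 0 V) + liminf (\<lambda>n. ?g (energy (s n) (U n)))"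
    unfolding Fhat_eq[OF v \<Omega> order_refl] by (simp add: add.commute add_left_mono)
  \<comment> \<open>The tails converge to a finite limit, so \<open>liminf\<close> is additive
    here.\<close>
  also have "\<dots> = liminf (\<lambda>n. ereal (tail (s n) (U n)) + ?g (energy (s n) (U n)))"
    using t by (intro ereal_liminf_lim_add[symmetric]) auto
  also have "\<dots> = liminf (\<lambda>n. Fhat \<Omega> (s n) (u n))"
    unfolding Fhat_eq[OF u \<Omega> s(1)] by (simp add: add.commute)
  finally show ?thesis .
qed

section \<open>Averaging against a probability density\<close>

text \<open>An average of the translates \<open>U (x + h)\<close>, that is, convolution with the
  reflected density; the sign matches the increments in \<open>diff2\<close>.\<close>

definition moll :: "('a::euclidean_space \<Rightarrow> real) \<Rightarrow> ('a \<Rightarrow> real) \<Rightarrow> 'a \<Rightarrow> real" where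
  "moll \<rho> U x = (\<integral>h. \<rho> h * U (x + h) \<partial>lborel)"

text \<open>The upper bound \<open>B\<close> makes \<open>\<rho> h * U (x + h)\<close> integrable in
  \<open>h\<close> for every \<open>x\<close> as soon as \<open>U\<close> is integrable.\<close>

definition bounded_density :: "('a::euclidean_space \<Rightarrow> real) \<Rightarrow> real \<Rightarrow> bool" where
  "bounded_density \<rho> B \<longleftrightarrow> \<rho> \<in> borel_measurable borel \<and> (\<forall>h. 0 \<le> \<rho> h \<and> \<rho> h \<le> B) \<and>
     integrable lborel \<rho> \<and> (\<integral>h. \<rho> h \<partial>lborel) = 1"

text \<open>The variance of \<open>f\<close> under \<rho> is nonnegative. If the right side is
  infinite nothing is claimed; otherwise \<open>\<bar>f h\<bar> \<le> 1 + (f h)\<^sup>2\<close>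
  makes the mean exist.\<close>

lemma Jensen_square:
  assumes \<rho>: "bounded_density \<rho> B" and [measurable]: "f \<in> borel_measurable borel"
  shows "ennreal ((\<integral>h. \<rho> h * f h \<partial>lborel)\<^sup>2) \<le> (\<integral>\<^sup>+h. ennreal (\<rho> h) * ennreal ((f h)\<^sup>2) \<partial>lborel)"
proof (cases "(\<integral>\<^sup>+h. ennreal (\<rho> h) * ennreal ((f h)\<^sup>2) \<partial>lborel) = \<infinity>")
  case False
  have [measurable]: "\<rho> \<in> borel_measurable borel" and \<rho>0: "\<And>h. 0 \<le> \<rho> h"
    and \<rho>i: "integrable lborel \<rho>" and \<rho>1: "(\<integral>h. \<rho> h \<partial>lborel) = 1"
    using \<rho> by (auto simp: bounded_density_def)
  have f2: "integrable lborel (\<lambda>h. \<rho> h * (f h)\<^sup>2)"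
    using False \<rho>0 by (intro integrableI_nonneg) (auto simp: ennreal_mult top.not_eq_extremum)
  have f1: "integrable lborel (\<lambda>h. \<rho> h * f h)"
  proof (rule Bochner_Integration.integrable_bound[OF Bochner_Integration.integrable_add[OF \<rho>i f2]])
    show "AE h in lborel. norm (\<rho> h * f h) \<le> norm (\<rho> h + \<rho> h * (f h)\<^sup>2)"
    proof (intro AE_I2)
      fix h
      have "\<bar>f h\<bar> \<le> 1 + (f h)\<^sup>2"
        using sum_squares_bound[of 1 "\<bar>f h\<bar>"] by simp
      then have "\<rho> h * \<bar>f h\<bar> \<le> \<rho> h * (1 + (f h)\<^sup>2)" using \<rho>0 by (rule mult_left_mono)
      then show "norm (\<rho> h * f h) \<le> norm (\<rho> h + \<rho> h * (f h)\<^sup>2)"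
        using \<rho>0[of h] by (simp add: abs_mult algebra_simps)
    qed
  qed measurable
  define c where "c = (\<integral>h. \<rho> h * f h \<partial>lborel)"
  have "0 \<le> (\<integral>h. \<rho> h * (f h - c)\<^sup>2 \<partial>lborel)" using \<rho>0 by simp
  also have "\<dots> = (\<integral>h. \<rho> h * (f h)\<^sup>2 - 2 * c * (\<rho> h * f h) + c\<^sup>2 * \<rho> h \<partial>lborel)"
    by (intro Bochner_Integration.integral_cong) (auto simp: power2_eq_square algebra_simps)
  also have "\<dots> = (\<integral>h. \<rho> h * (f h)\<^sup>2 \<partial>lborel) - 2 * c * c + c\<^sup>2"
    using f1 f2 \<rho>i by (simp add: c_def[symmetric] \<rho>1)
  finally have "c\<^sup>2 \<le> (\<integral>h. \<rho> h * (f h)\<^sup>2 \<partial>lborel)" by (simp add: power2_eq_square)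
  then have "ennreal (c\<^sup>2) \<le> ennreal (\<integral>h. \<rho> h * (f h)\<^sup>2 \<partial>lborel)" by (rule ennreal_leI)
  also have "\<dots> = (\<integral>\<^sup>+h. ennreal (\<rho> h * (f h)\<^sup>2) \<partial>lborel)"
    using f2 \<rho>0 by (subst nn_integral_eq_integral) auto
  finally show ?thesis using \<rho>0 by (simp add: c_def ennreal_mult)
qed simp

text \<open>Averaging is a contraction in \<open>L2\<close>. Applied to \<open>U\<close> it bounds
  the norm of the average, applied to an increment of \<open>U\<close> it bounds the energy, since
  averaging commutes with translations.\<close>

lemma nn_integral_average_le:
  assumes \<rho>: "bounded_density \<rho> B" and [measurable]: "g \<in> borel_measurable borel"
  shows "(\<integral>\<^sup>+x. ennreal ((\<integral>h. \<rho> h * g (x + h) \<partial>lborel)\<^sup>2) \<partial>lborel) \<le> (\<integral>\<^sup>+x. ennreal ((g x)\<^sup>2) \<partial>lborel)"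
proof -
  have [measurable]: "\<rho> \<in> borel_measurable borel" and \<rho>0: "\<And>h. 0 \<le> \<rho> h"
    and \<rho>i: "integrable lborel \<rho>" and \<rho>1: "(\<integral>h. \<rho> h \<partial>lborel) = 1"
    using \<rho> by (auto simp: bounded_density_def)
  have "(\<integral>\<^sup>+x. ennreal ((\<integral>h. \<rho> h * g (x + h) \<partial>lborel)\<^sup>2) \<partial>lborel)
    \<le> (\<integral>\<^sup>+x. \<integral>\<^sup>+h. ennreal (\<rho> h) * ennreal ((g (x + h))\<^sup>2) \<partial>lborel \<partial>lborel)"
    by (intro nn_integral_mono Jensen_square[OF \<rho>]) measurable
  also have "\<dots> = (\<integral>\<^sup>+h. \<integral>\<^sup>+x. ennreal (\<rho> h) * ennreal ((g (x + h))\<^sup>2) \<partial>lborel \<partial>lborel)"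
    by (rule lborel_pair.Fubini') measurable
  also have "\<dots> = (\<integral>\<^sup>+h. ennreal (\<rho> h) * (\<integral>\<^sup>+x. ennreal ((g x)\<^sup>2) \<partial>lborel) \<partial>lborel)"
    by (intro nn_integral_cong, subst nn_integral_cmult)
      (simp_all add: nn_integral_lborel_translate[of "\<lambda>x. ennreal ((g x)\<^sup>2)"])
  also have "\<dots> = (\<integral>\<^sup>+h. ennreal (\<rho> h) \<partial>lborel) * (\<integral>\<^sup>+x. ennreal ((g x)\<^sup>2) \<partial>lborel)"
    by (rule nn_integral_multc) measurable
  also have "(\<integral>\<^sup>+h. ennreal (\<rho> h) \<partial>lborel) = 1"
    using \<rho>0 \<rho>i by (subst nn_integral_eq_integral) (auto simp: \<rho>1)
  finally show ?thesis by simp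
qed

context
  fixes \<rho> U :: "'a::euclidean_space \<Rightarrow> real" and B :: real
  assumes \<rho>: "bounded_density \<rho> B" and U: "sq_int U" and Ui: "integrable lborel U"
begin

lemma moll_integrable: "integrable lborel (\<lambda>h. \<rho> h * U (x + h))"
proof (rule Bochner_Integration.integrable_bound)
  show "integrable lborel (\<lambda>h. B * U (x + h))"
    using integrable_lborel_translate[OF Ui, of x] by (simp add: add.commute)
  show "AE h in lborel. norm (\<rho> h * U (x + h)) \<le> norm (B * U (x + h))"
  proof (intro AE_I2)
    fix h
    have "0 \<le> \<rho> h" "\<rho> h \<le> B" using \<rho> by (auto simp: bounded_density_def)
    then show "norm (\<rho> h * U (x + h)) \<le> norm (B * U (x + h))"
      by (auto simp: abs_mult intro!: mult_right_mono)
  qed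
  have [measurable]: "\<rho> \<in> borel_measurable borel" "U \<in> borel_measurable borel"
    using \<rho> U by (auto simp: bounded_density_def sq_int_def)
  show "(\<lambda>h. \<rho> h * U (x + h)) \<in> borel_measurable lborel" by measurable
qed

lemma moll_measurable[measurable]: "moll \<rho> U \<in> borel_measurable borel"
proof -
  have [measurable]: "\<rho> \<in> borel_measurable borel" "U \<in> borel_measurable borel"
    using \<rho> U by (auto simp: bounded_density_def sq_int_def)
  show ?thesis unfolding moll_def[abs_def] by measurable
qed

lemma sq_int_moll: "sq_int (moll \<rho> U)"
proof (rule sq_intI)
  have "(\<integral>\<^sup>+x. ennreal ((moll \<rho> U x)\<^sup>2) \<partial>lborel) \<le> ennreal (sqn U)"
    using nn_integral_average_le[OF \<rho> sq_int_measurable[OF U]] by (simp add: moll_def nn_integral_sqn U)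
  then show "(\<integral>\<^sup>+x. ennreal ((moll \<rho> U x)\<^sup>2) \<partial>lborel) < \<infinity>"
    using order_le_less_trans by fastforce
qed measurable

lemma diff2_moll_le: "diff2 (moll \<rho> U) z \<le> diff2 U z"
proof -
  have [measurable]: "U \<in> borel_measurable borel" using U by measurable
  have "moll \<rho> U (x + z) - moll \<rho> U x = (\<integral>h. \<rho> h * (U (x + h + z) - U (x + h)) \<partial>lborel)" for x
    using moll_integrable[of "x + z"] moll_integrable[of x]
    by (simp add: moll_def right_diff_distrib add.assoc add.commute[of z])
  then have "ennreal (diff2 (moll \<rho> U) z) =
    (\<integral>\<^sup>+x. ennreal ((\<integral>h. \<rho> h * (U (x + h + z) - U (x + h)) \<partial>lborel)\<^sup>2) \<partial>lborel)"
    using nn_integral_diff2[OF sq_int_moll, of z] by simp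
  also have "\<dots> \<le> (\<integral>\<^sup>+x. ennreal ((U (x + z) - U x)\<^sup>2) \<partial>lborel)"
    using nn_integral_average_le[OF \<rho>, of "\<lambda>x. U (x + z) - U x"] by simp
  also have "\<dots> = ennreal (diff2 U z)" by (rule nn_integral_diff2[OF U])
  finally show ?thesis by simp
qed

lemma energy_moll_le: "energy s (moll \<rho> U) \<le> energy s U"
  unfolding energy_def by (intro nn_integral_mono mult_left_mono ennreal_leI diff2_moll_le) simp

lemma sqn_moll_diff_le:
  assumes c: "\<And>h. h \<noteq> 0 \<Longrightarrow> \<rho> h \<le> c * kern 0 h" "c \<ge> 0" and supp: "\<And>h. norm h \<ge> 1 \<Longrightarrow> \<rho> h = 0"
  shows "ennreal (sqn (\<lambda>x. moll \<rho> U x - U x)) \<le> ennreal c * energy 0 U"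
proof -
  have [measurable]: "\<rho> \<in> borel_measurable borel" "U \<in> borel_measurable borel"
    using \<rho> U by (auto simp: bounded_density_def sq_int_def)
  have [measurable]: "ball (0::'a) 1 \<in> sets borel" by simp
  have \<rho>0: "\<And>h. 0 \<le> \<rho> h" and \<rho>i: "integrable lborel \<rho>" and \<rho>1: "(\<integral>h. \<rho> h \<partial>lborel) = 1"
    using \<rho> by (auto simp: bounded_density_def)
  have eq: "moll \<rho> U x - U x = (\<integral>h. \<rho> h * (U (x + h) - U x) \<partial>lborel)" for x
    using moll_integrable[of x] \<rho>i by (simp add: moll_def right_diff_distrib \<rho>1)
  have "ennreal (sqn (\<lambda>x. moll \<rho> U x - U x)) = (\<integral>\<^sup>+x. ennreal ((\<integral>h. \<rho> h * (U (x + h) - U x) \<partial>lborel)\<^sup>2) \<partial>lborel)"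
    using nn_integral_sqn[OF sq_int_diff[OF sq_int_moll U]] by (simp add: eq)
  also have "\<dots> \<le> (\<integral>\<^sup>+x. \<integral>\<^sup>+h. ennreal (\<rho> h) * ennreal ((U (x + h) - U x)\<^sup>2) \<partial>lborel \<partial>lborel)"
    by (intro nn_integral_mono Jensen_square[OF \<rho>]) measurable
  also have "\<dots> = (\<integral>\<^sup>+h. \<integral>\<^sup>+x. ennreal (\<rho> h) * ennreal ((U (x + h) - U x)\<^sup>2) \<partial>lborel \<partial>lborel)"
    by (rule lborel_pair.Fubini') measurable
  also have "\<dots> = (\<integral>\<^sup>+h. ennreal (\<rho> h) * ennreal (diff2 U h) \<partial>lborel)"
    by (intro nn_integral_cong, subst nn_integral_cmult) (simp_all add: nn_integral_diff2[OF U])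
  also have "\<dots> \<le> (\<integral>\<^sup>+h. ennreal c * (ennreal (kern 0 h) * indicator (ball 0 1) h * ennreal (diff2 U h)) \<partial>lborel)"
  \<comment> \<open>The origin is set aside because \<open>kern 0 0 = 0\<close> while
    \<open>\<rho> 0\<close> may be positive.\<close>
  proof (rule nn_integral_mono_AE, rule AE_mp[OF AE_lborel_singleton[of 0]], intro AE_I2 impI)
    fix h :: 'a assume "h \<noteq> 0"
    then have "ennreal (\<rho> h) \<le> ennreal c * (ennreal (kern 0 h) * indicator (ball 0 1) h)"
      using c(1)[of h] c(2) supp[of h] by (auto simp: ennreal_mult[symmetric] intro!: ennreal_leI split: split_indicator)
    from mult_right_mono[OF this, of "ennreal (diff2 U h)"]
    show "ennreal (\<rho> h) * ennreal (diff2 U h) \<le>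
      ennreal c * (ennreal (kern 0 h) * indicator (ball 0 1) h * ennreal (diff2 U h))"
      by (simp add: mult.assoc)
  qed
  also have "\<dots> = ennreal c * energy 0 U"
    unfolding energy_def by (rule nn_integral_cmult) measurable
  finally show ?thesis .
qed

text \<open>Moves the dependence on \<open>x\<close> from \<open>U\<close> to \<rho>, so that the
  average inherits the boundedness and regularity of the density.\<close>

lemma moll_shift: "moll \<rho> U x = (\<integral>y. \<rho> (y - x) * U y \<partial>lborel)"
proof -
  have [measurable]: "\<rho> \<in> borel_measurable borel" "U \<in> borel_measurable borel"
    using \<rho> U by (auto simp: bounded_density_def sq_int_def)
  show ?thesis
    using integral_lborel_translate[of "\<lambda>y. \<rho> (y - x) * U y" x] by (simp add: moll_def add.commute)
qed

lemma moll_shift_integrable: "integrable lborel (\<lambda>y. \<rho> (y - x) * U y)"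
  using integrable_lborel_translate[OF moll_integrable[of x], of "- x"] by simp

lemma abs_moll_le: "\<bar>moll \<rho> U x\<bar> \<le> B * (\<integral>x. \<bar>U x\<bar> \<partial>lborel)"
proof -
  have b: "0 \<le> \<rho> h" "\<rho> h \<le> B" for h using \<rho> by (auto simp: bounded_density_def)
  have "\<bar>moll \<rho> U x\<bar> \<le> (\<integral>y. \<bar>\<rho> (y - x) * U y\<bar> \<partial>lborel)"
    unfolding moll_shift by (rule integral_abs_bound)
  also have "\<dots> \<le> (\<integral>y. B * \<bar>U y\<bar> \<partial>lborel)"
    using moll_shift_integrable Ui b
    by (intro integral_mono integrable_abs) (auto simp: abs_mult intro!: mult_right_mono)
  finally show ?thesis by simp
qed

text \<open>The constant depends on \<open>U\<close> only through its \<open>L1\<close> norm: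
  averages of a family bounded in \<open>L1\<close> are equi-Lipschitz.\<close>

lemma moll_Lipschitz:
  assumes L: "L-lipschitz_on UNIV \<rho>"
  shows "\<bar>moll \<rho> U x - moll \<rho> U x'\<bar> \<le> L * (\<integral>x. \<bar>U x\<bar> \<partial>lborel) * norm (x - x')"
proof -
  have "moll \<rho> U x - moll \<rho> U x' = (\<integral>y. \<rho> (y - x) * U y - \<rho> (y - x') * U y \<partial>lborel)"
    unfolding moll_shift using moll_shift_integrable by simp
  also have "\<bar>\<dots>\<bar> \<le> (\<integral>y. \<bar>\<rho> (y - x) * U y - \<rho> (y - x') * U y\<bar> \<partial>lborel)"
    by (rule integral_abs_bound)
  also have "\<dots> \<le> (\<integral>y. L * norm (x - x') * \<bar>U y\<bar> \<partial>lborel)"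
  proof (intro integral_mono integrable_abs Bochner_Integration.integrable_diff moll_shift_integrable)
    fix y
    have "\<bar>\<rho> (y - x) - \<rho> (y - x')\<bar> \<le> L * norm (x - x')"
      using lipschitz_onD[OF L, of "y - x" "y - x'"] by (simp add: dist_norm norm_minus_commute)
    then have "\<bar>\<rho> (y - x) - \<rho> (y - x')\<bar> * \<bar>U y\<bar> \<le> L * norm (x - x') * \<bar>U y\<bar>"
      by (rule mult_right_mono) simp
    then show "\<bar>\<rho> (y - x) * U y - \<rho> (y - x') * U y\<bar> \<le> L * norm (x - x') * \<bar>U y\<bar>"
      by (simp add: abs_mult[symmetric] left_diff_distrib)
  qed (use Ui in auto)
  finally show ?thesis by (simp add: mult_ac)
qed

end

lemma moll_eq_0:
  assumes "\<And>h. norm h \<ge> e \<Longrightarrow> \<rho> h = 0" "\<And>y. dist x y < e \<Longrightarrow> U y = 0"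
  shows "moll \<rho> U x = 0"
proof -
  have "\<rho> h * U (x + h) = 0" for h
    using assms(1)[of h] assms(2)[of "x + h"] by (cases "norm h < e") (auto simp: dist_norm)
  then have "(\<lambda>h. \<rho> h * U (x + h)) = (\<lambda>_. 0)" by (rule ext)
  then show ?thesis unfolding moll_def by (simp only: integral_zero)
qed

text \<open>
  The density is a truncation of the non-integrable kernel \<open>|h|\<^sup>-\<^sup>d\<close>, normalised by an integral that
  tends to infinity with the truncation parameter \<open>a \<rightarrow> 0\<close>.
\<close>

lemma Lipschitz_density_exists:
  assumes e: "0 < e" and c: "0 < c"
  obtains \<rho> :: "'a::euclidean_space \<Rightarrow> real" and L B where "bounded_density \<rho> B" "L-lipschitz_on UNIV \<rho>"
    "\<And>h. norm h \<ge> e \<Longrightarrow> \<rho> h = 0" "\<And>h. h \<noteq> 0 \<Longrightarrow> \<rho> h \<le> c * kern 0 h"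
proof -
  define d where "d = DIM('a)"
  define D where "D = measure lborel (cball (0::'a) 1) * d"
  have D: "D > 0" unfolding D_def d_def by (simp add: content_cball)
  \<comment> \<open>Chosen so that the kernel has mass \<open>2 / c\<close> on the annulus between
    the radii \<open>a\<close> and \<open>e / 2\<close>, where \<open>D\<close> is the area of the
    unit sphere.\<close>
  define a where "a = e / 2 * exp (- 2 / (D * c))"
  have a0: "a > 0" and ae: "a \<le> e / 2" using e c D by (auto simp: a_def)
  have lna: "ln (e / 2) - ln a = 2 / (D * c)"
  proof -
    have "ln a = ln (e / 2) + ln (exp (- 2 / (D * c)))"
      unfolding a_def using e by (intro ln_mult_pos) auto
    then show ?thesis by simp
  qed
  \<comment> \<open>The tent \<open>f\<close> confines the support to radius \<open>e\<close>;
    \<open>q h ^ d\<close> is the kernel truncated at radius \<open>a\<close> and scaled by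
    \<open>a ^ d\<close>, so that it is bounded by 1 and Lipschitz.\<close>
  define f :: "'a \<Rightarrow> real" where "f h = max 0 (1 - norm h / e)" for h
  define q :: "'a \<Rightarrow> real" where "q h = a / max (norm h) a" for h
  define k where "k h = f h * q h ^ d" for h
  have f01: "0 \<le> f h" "f h \<le> 1" for h using e by (auto simp: f_def)
  have q01: "0 \<le> q h" "q h \<le> 1" for h using a0 by (auto simp: q_def divide_simps)
  have k01: "0 \<le> k h" "k h \<le> 1" for h
    using f01[of h] q01[of h] by (auto simp: k_def power_le_one mult_le_one)
  have flip: "\<bar>f x - f y\<bar> \<le> norm (x - y) / e" for x y
  proof -
    have "\<bar>f x - f y\<bar> \<le> \<bar>norm x / e - norm y / e\<bar>" by (simp add: f_def)
    also have "\<dots> = \<bar>norm x - norm y\<bar> / e" using e by (simp add: diff_divide_distrib[symmetric])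
    also have "\<dots> \<le> norm (x - y) / e" using e norm_triangle_ineq3[of x y] by (simp add: divide_right_mono)
    finally show ?thesis .
  qed
  have qlip: "\<bar>q x - q y\<bar> \<le> norm (x - y) / a" for x y
  proof -
    let ?X = "max (norm x) a" and ?Y = "max (norm y) a"
    have X: "?X \<ge> a" and Y: "?Y \<ge> a" by auto
    have "\<bar>?Y - ?X\<bar> \<le> norm (x - y)" using norm_triangle_ineq3[of x y] by (auto simp: max_def)
    have "q x - q y = a * (?Y - ?X) / (?X * ?Y)"
      using X Y a0 by (simp add: q_def field_simps)
    then have "\<bar>q x - q y\<bar> = a * \<bar>?Y - ?X\<bar> / (?X * ?Y)"
      using X Y a0 by (simp add: abs_mult)
    also have "\<dots> \<le> a * norm (x - y) / (a * a)"
      using X Y a0 \<open>\<bar>?Y - ?X\<bar> \<le> norm (x - y)\<close> by (intro frac_le mult_mono) auto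
    also have "\<dots> = norm (x - y) / a" using a0 by simp
    finally show ?thesis .
  qed
  have klip: "\<bar>k x - k y\<bar> \<le> (1 / e + d / a) * norm (x - y)" for x y
  proof -
    have p: "\<bar>q x ^ d - q y ^ d\<bar> \<le> d * (norm (x - y) / a)"
    proof -
      have "\<bar>q x ^ d - q y ^ d\<bar> \<le> d * \<bar>q x - q y\<bar>"
        using norm_power_diff[of "q x" "q y" d] q01[of x] q01[of y] by simp
      also have "\<dots> \<le> d * (norm (x - y) / a)" by (intro mult_left_mono qlip) simp
      finally show ?thesis .
    qed
    have "k x - k y = (f x - f y) * q x ^ d + f y * (q x ^ d - q y ^ d)"
      by (simp add: k_def algebra_simps)
    also have "\<bar>\<dots>\<bar> \<le> \<bar>f x - f y\<bar> * q x ^ d + f y * \<bar>q x ^ d - q y ^ d\<bar>"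
      using f01[of y] q01[of x] by (intro order_trans[OF abs_triangle_ineq]) (simp add: abs_mult)
    also have "\<dots> \<le> norm (x - y) / e * 1 + 1 * (d * (norm (x - y) / a))"
      using f01[of y] q01[of x] flip[of x y] p e by (intro add_mono mult_mono) (auto simp: power_le_one)
    also have "\<dots> = (1 / e + d / a) * norm (x - y)" by (simp add: algebra_simps)
    finally show ?thesis .
  qed
  have [measurable]: "k \<in> borel_measurable borel"
    unfolding k_def f_def q_def by measurable
  have ksupp: "k h = 0" if "norm h \<ge> e" for h
    using that e by (auto simp: k_def f_def divide_simps)
  have ki: "integrable lborel k"
  proof (rule Bochner_Integration.integrable_bound)
    show "integrable lborel (indicator (cball 0 e) :: 'a \<Rightarrow> real)"
      using emeasure_lborel_cball_finite[of "0::'a" e] by simp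
    show "AE h in lborel. norm (k h) \<le> norm (indicator (cball 0 e) h :: real)"
      using k01 ksupp by (intro AE_I2) (auto split: split_indicator)
  qed measurable
  have kle: "k h \<le> a ^ d * kern 0 h" if "h \<noteq> 0" for h
  proof -
    have "k h \<le> 1 * q h ^ d" unfolding k_def using f01 q01 by (intro mult_right_mono) auto
    also have "q h \<le> a / norm h" using that a0 by (auto simp: q_def intro!: frac_le)
    then have "1 * q h ^ d \<le> (a / norm h) ^ d" using q01 by (simp add: power_mono)
    also have "\<dots> = a ^ d * kern 0 h"
      using that by (simp add: kern_def d_def powr_realpow power_divide)
    finally show ?thesis .
  qed
  \<comment> \<open>On this annulus the truncation is inactive and the tent is at least 1/2.\<close>
  have kge: "a ^ d / 2 * kern 0 h \<le> k h" if "a \<le> norm h" "norm h \<le> e / 2" for h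
  proof -
    have h0: "norm h > 0" using that a0 by linarith
    have "q h = a / norm h" using that by (simp add: q_def max_def)
    then have "q h ^ d = a ^ d * kern 0 h"
      using h0 by (simp add: kern_def d_def powr_realpow power_divide)
    moreover have "1 / 2 \<le> f h" using that e by (auto simp: f_def field_simps)
    then have "1 / 2 * q h ^ d \<le> f h * q h ^ d" using q01 by (intro mult_right_mono) auto
    ultimately show ?thesis by (simp add: k_def)
  qed
  define I where "I = (\<integral>h. k h \<partial>lborel)"
  have "ennreal (a ^ d / 2 * (D * (2 / (D * c)))) = ennreal (a ^ d / 2) *
    (\<integral>\<^sup>+h. indicator UNIV (h::'a) * (ennreal (kern 0 h) * indicator {a..e/2} (norm h)) \<partial>lborel)"
    using a0 D c ae lna by (subst nn_integral_cone_kern_annulus) (auto simp: D_def d_def simp flip: ennreal_mult)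
  also have "\<dots> = (\<integral>\<^sup>+h. ennreal (a ^ d / 2) * (ennreal (kern 0 h) * indicator {a..e/2} (norm (h::'a))) \<partial>lborel)"
    by (subst nn_integral_cmult) auto
  also have "\<dots> \<le> (\<integral>\<^sup>+h. ennreal (k h) \<partial>lborel)"
    using kge a0 by (intro nn_integral_mono) (auto simp: ennreal_mult[symmetric] intro!: ennreal_leI split: split_indicator)
  also have "\<dots> = ennreal I"
    unfolding I_def using k01 by (intro nn_integral_eq_integral ki) auto
  finally have "a ^ d / 2 * (D * (2 / (D * c))) \<le> I"
    using k01 by (subst (asm) ennreal_le_iff) (auto simp: I_def)
  \<comment> \<open>With \<open>k h \<le> a ^ d * kern 0 h\<close> this is exactly what gives
    \<open>k h / I \<le> c * kern 0 h\<close>.\<close>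
  then have I: "a ^ d / c \<le> I" using D c by simp
  moreover have "a ^ d / c > 0" using a0 c by simp
  ultimately have I0: "I > 0" by linarith
  define \<rho> where "\<rho> h = k h / I" for h
  show thesis
  proof (rule that)
    show "bounded_density \<rho> (1 / I)"
      unfolding bounded_density_def
      using ki k01 I0 by (auto simp: \<rho>_def[abs_def] I_def[symmetric] divide_right_mono)
    show "((1 / e + d / a) / I)-lipschitz_on UNIV \<rho>"
    proof (rule lipschitz_onI)
      fix x y :: 'a
      have "dist (\<rho> x) (\<rho> y) = \<bar>k x - k y\<bar> / I"
        using I0 by (simp add: \<rho>_def dist_norm diff_divide_distrib[symmetric])
      also have "\<dots> \<le> (1 / e + d / a) * norm (x - y) / I"
        using klip I0 by (simp add: divide_right_mono)
      finally show "dist (\<rho> x) (\<rho> y) \<le> (1 / e + d / a) / I * dist x y"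
        by (simp add: dist_norm)
    qed (use e a0 I0 in auto)
    show "\<rho> h = 0" if "e \<le> norm h" for h using ksupp[OF that] by (simp add: \<rho>_def)
    show "\<rho> h \<le> c * kern 0 h" if "h \<noteq> 0" for h
    proof -
      have "k h \<le> (c * I) * kern 0 h"
        using kle[OF that] I c by (intro order_trans[OF kle[OF that]] mult_right_mono) (auto simp: field_simps)
      then show ?thesis using I0 by (simp add: \<rho>_def field_simps)
    qed
  qed
qed

section \<open>Compactness\<close>

text \<open>The rate \<open>(1/4) ^ k\<close> leaves room for the weight \<open>2 ^ k\<close> in the
  proof of completeness.\<close>

lemma subseq_square_diffs:
  fixes a :: "nat \<Rightarrow> nat \<Rightarrow> real"
  assumes "\<And>e. e > 0 \<Longrightarrow> \<exists>N. \<forall>m\<ge>N. \<forall>n\<ge>N. a m n \<le> e"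
  obtains r :: "nat \<Rightarrow> nat" where "strict_mono r" "\<And>k. a (r (Suc k)) (r k) \<le> (1/4) ^ k"
proof -
  have "\<forall>k. \<exists>N. \<forall>m\<ge>N. \<forall>n\<ge>N. a m n \<le> (1/4) ^ k" using assms by simp
  then obtain N where N: "\<And>k m n. m \<ge> N k \<Longrightarrow> n \<ge> N k \<Longrightarrow> a m n \<le> (1/4) ^ k" by metis
  define r where "r = rec_nat (N 0) (\<lambda>k x. max (Suc x) (N (Suc k)))"
  have r: "r 0 = N 0" "r (Suc k) = max (Suc (r k)) (N (Suc k))" for k by (simp_all add: r_def)
  have "strict_mono r" by (rule strict_monoI_Suc) (simp add: r)
  moreover have ge: "r k \<ge> N k" for k by (cases k) (simp_all add: r)
  have "a (r (Suc k)) (r k) \<le> (1/4) ^ k" for k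
    using ge[of k] r(2)[of k] by (intro N) auto
  ultimately show thesis using that by blast
qed

text \<open>The Riesz-Fischer theorem, with a limit that is Borel and vanishes exactly off
  \<Omega>.\<close>

lemma L2_complete:
  fixes U :: "nat \<Rightarrow> 'a::euclidean_space \<Rightarrow> real"
  assumes U: "\<And>n. sq_int (U n)" and z: "\<And>n x. x \<notin> \<Omega> \<Longrightarrow> U n x = 0"
    and cau: "\<And>e. e > 0 \<Longrightarrow> \<exists>N. \<forall>m\<ge>N. \<forall>n\<ge>N. sqn (\<lambda>x. U m x - U n x) \<le> e"
  obtains V where "sq_int V" "\<And>x. x \<notin> \<Omega> \<Longrightarrow> V x = 0" "(\<lambda>n. sqn (\<lambda>x. U n x - V x)) \<longlonglongrightarrow> 0"
proof -
  have [measurable]: "U n \<in> borel_measurable borel" for n using U by measurable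
  obtain r where r: "strict_mono r" and
    r4: "\<And>k. sqn (\<lambda>x. U (r (Suc k)) x - U (r k) x) \<le> (1/4) ^ k"
    using subseq_square_diffs[of "\<lambda>m n. sqn (\<lambda>x. U m x - U n x)"] cau by blast
  define D where "D k x = U (r (Suc k)) x - U (r k) x" for k x
  have Dsq: "sq_int (D k)" for k unfolding D_def[abs_def] by (intro sq_int_diff U)
  have [measurable]: "D k \<in> borel_measurable borel" for k using Dsq by measurable
  \<comment> \<open>The weights \<open>2 ^ k\<close> turn control of squares into absolute
    convergence, through
    \<open>\<bar>D k x\<bar> \<le> (1/2) ^ k + 2 ^ k * (D k x)\<^sup>2\<close>.\<close>
  have "(\<integral>\<^sup>+x. (\<Sum>k. ennreal (2 ^ k * (D k x)\<^sup>2)) \<partial>lborel) = (\<Sum>k. \<integral>\<^sup>+x. ennreal (2 ^ k * (D k x)\<^sup>2) \<partial>lborel)"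
    by (rule nn_integral_suminf) measurable
  also have "\<dots> \<le> (\<Sum>k. ennreal ((1/2) ^ k))"
  proof (intro suminf_le summableI)
    fix k
    have "(\<integral>\<^sup>+x. ennreal (2 ^ k * (D k x)\<^sup>2) \<partial>lborel) = ennreal (2 ^ k) * ennreal (sqn (D k))"
      by (simp add: ennreal_mult nn_integral_cmult nn_integral_sqn Dsq)
    also have "\<dots> \<le> ennreal (2 ^ k * (1/4) ^ k)"
      using r4[of k] by (simp add: ennreal_mult[symmetric] D_def[abs_def])
    also have "(2::real) ^ k * (1/4) ^ k = (1/2) ^ k" by (simp add: power_mult_distrib[symmetric])
    finally show "(\<integral>\<^sup>+x. ennreal (2 ^ k * (D k x)\<^sup>2) \<partial>lborel) \<le> ennreal ((1/2) ^ k)" .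
  qed
  also have "\<dots> < \<infinity>"
    by (subst suminf_ennreal2) (auto intro: summable_geometric)
  finally have "AE x in lborel. (\<Sum>k. ennreal (2 ^ k * (D k x)\<^sup>2)) \<noteq> \<infinity>"
    by (intro nn_integral_PInf_AE) auto
  then have conv: "AE x in lborel. convergent (\<lambda>n. U (r n) x)"
  proof eventually_elim
    fix x assume "(\<Sum>k. ennreal (2 ^ k * (D k x)\<^sup>2)) \<noteq> \<infinity>"
    then have s2: "summable (\<lambda>k. 2 ^ k * (D k x)\<^sup>2)"
      by (intro summable_suminf_not_top) auto
    have "summable (\<lambda>k. D k x)"
    proof (rule summable_comparison_test')
      show "summable (\<lambda>k. (1/2) ^ k + 2 ^ k * (D k x)\<^sup>2)"
        by (intro summable_add s2 summable_geometric) simp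
      fix k
      have "0 \<le> 2 ^ k * ((1/2) ^ k - \<bar>D k x\<bar>)\<^sup>2" by simp
      also have "\<dots> = (1/2) ^ k - 2 * \<bar>D k x\<bar> + 2 ^ k * (D k x)\<^sup>2"
        by (simp add: power2_diff power_one_over field_simps power2_eq_square)
      finally show "norm (D k x) \<le> (1/2) ^ k + 2 ^ k * (D k x)\<^sup>2"
        by simp
    qed
    then have "convergent (\<lambda>n. \<Sum>k<n. D k x)" by (simp add: summable_iff_convergent)
    moreover have "(\<Sum>k<n. D k x) = U (r n) x - U (r 0) x" for n
      unfolding D_def by (rule sum_lessThan_telescope)
    ultimately show "convergent (\<lambda>n. U (r n) x)"
      using convergent_add_const_iff[of "- U (r 0) x" "\<lambda>n. U (r n) x"] by (simp add: add.commute)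
  qed
  \<comment> \<open>The default 0 makes \<open>V\<close> a total Borel function. Off \<Omega> the
    sequence is constantly 0, and so is its limit.\<close>
  define V where "V x = (if Cauchy (\<lambda>n. U (r n) x) then lim (\<lambda>n. U (r n) x) else 0)" for x
  have [measurable]: "V \<in> borel_measurable borel" unfolding V_def by measurable
  have Vlim: "AE x in lborel. (\<lambda>n. U (r n) x) \<longlonglongrightarrow> V x"
    using conv by eventually_elim (simp add: V_def Cauchy_convergent_iff convergent_LIMSEQ_iff)
  have Vz: "V x = 0" if "x \<notin> \<Omega>" for x using that z by (simp add: V_def convergent_const)
  \<comment> \<open>Fatou along the subsequence, with \<open>n\<close> fixed, upgrades convergence
    of the subsequence to that of the whole sequence.\<close>
  have fat: "\<exists>N. \<forall>n\<ge>N. (\<integral>\<^sup>+x. ennreal ((U n x - V x)\<^sup>2) \<partial>lborel) \<le> ennreal e" if e: "e > 0" for e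
  proof -
    obtain N where N: "\<And>m n. m \<ge> N \<Longrightarrow> n \<ge> N \<Longrightarrow> sqn (\<lambda>x. U m x - U n x) \<le> e"
      using cau[OF e] by blast
    have "(\<integral>\<^sup>+x. ennreal ((U n x - V x)\<^sup>2) \<partial>lborel) \<le> ennreal e" if n: "n \<ge> N" for n
    proof -
      have "(\<integral>\<^sup>+x. ennreal ((U n x - V x)\<^sup>2) \<partial>lborel) =
          (\<integral>\<^sup>+x. liminf (\<lambda>k. ennreal ((U n x - U (r k) x)\<^sup>2)) \<partial>lborel)"
        using Vlim
      proof (intro nn_integral_cong_AE, eventually_elim)
        fix x assume "(\<lambda>n. U (r n) x) \<longlonglongrightarrow> V x"
        then have "(\<lambda>k. ennreal ((U n x - U (r k) x)\<^sup>2)) \<longlonglongrightarrow> ennreal ((U n x - V x)\<^sup>2)"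
          by (intro tendsto_ennrealI tendsto_intros)
        then show "ennreal ((U n x - V x)\<^sup>2) = liminf (\<lambda>k. ennreal ((U n x - U (r k) x)\<^sup>2))"
          by (intro lim_imp_Liminf[symmetric]) auto
      qed
      also have "\<dots> \<le> liminf (\<lambda>k. \<integral>\<^sup>+x. ennreal ((U n x - U (r k) x)\<^sup>2) \<partial>lborel)"
        by (rule nn_integral_liminf) measurable
      also have "\<dots> \<le> liminf (\<lambda>k. ennreal e)"
      proof (rule Liminf_mono)
        show "\<forall>\<^sub>F k in sequentially. (\<integral>\<^sup>+x. ennreal ((U n x - U (r k) x)\<^sup>2) \<partial>lborel) \<le> ennreal e"
          using eventually_ge_at_top[of N]
        proof eventually_elim
          case (elim k)
          then have "sqn (\<lambda>x. U n x - U (r k) x) \<le> e"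
            using seq_suble[OF r, of k] by (intro N n) auto
          then show ?case
            by (simp add: nn_integral_sqn[OF sq_int_diff[OF U U]] ennreal_leI)
        qed
      qed
      also have "\<dots> = ennreal e" by (simp add: Liminf_const)
      finally show ?thesis .
    qed
    then show ?thesis by blast
  qed
  obtain N where "(\<integral>\<^sup>+x. ennreal ((U N x - V x)\<^sup>2) \<partial>lborel) \<le> ennreal 1" using fat[of 1] by auto
  then have "sq_int (\<lambda>x. U N x - V x)"
    by (intro sq_intI) (auto intro: order_le_less_trans)
  from sq_int_diff[OF U[of N] this] have V: "sq_int V" by simp
  have "(\<lambda>n. sqn (\<lambda>x. U n x - V x)) \<longlonglongrightarrow> 0"
  proof (rule LIMSEQ_I)
    fix e :: real assume "e > 0"
    then obtain N where N: "\<And>n. n \<ge> N \<Longrightarrow> (\<integral>\<^sup>+x. ennreal ((U n x - V x)\<^sup>2) \<partial>lborel) \<le> ennreal (e/2)"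
      using fat[of "e/2"] by auto
    show "\<exists>no. \<forall>n\<ge>no. norm (sqn (\<lambda>x. U n x - V x) - 0) < e"
    proof (intro exI allI impI)
      fix n assume "n \<ge> N"
      from N[OF this] show "norm (sqn (\<lambda>x. U n x - V x) - 0) < e"
        using \<open>e > 0\<close> by (simp add: nn_integral_sqn[OF sq_int_diff[OF U V]] ennreal_le_iff)
    qed
  qed
  with V Vz show thesis using that by blast
qed

lemma convergent_equi_Lipschitz:
  fixes w :: "nat \<Rightarrow> 'a::euclidean_space \<Rightarrow> real"
  assumes L: "\<And>n x y. \<bar>w n x - w n y\<bar> \<le> L * norm (x - y)"
    and D: "closure D = UNIV" and conv: "\<And>q. q \<in> D \<Longrightarrow> convergent (\<lambda>n. w n q)"
  shows "convergent (\<lambda>n. w n x)"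
proof -
  have "Cauchy (\<lambda>n. w n x)"
  proof (rule metric_CauchyI)
    fix e :: real assume e: "e > 0"
    \<comment> \<open>The added 1 avoids division by zero when \<open>L = 0\<close>.\<close>
    define d where "d = e / (3 * (\<bar>L\<bar> + 1))"
    have d: "d > 0" using e by (auto simp: d_def)
    have "x \<in> closure D" using D by simp
    then obtain q where q: "q \<in> D" "dist q x < d" using d by (auto simp: closure_approachable)
    have Lq: "\<bar>w n x - w n q\<bar> < e / 3" for n
    proof -
      have "\<bar>w n x - w n q\<bar> \<le> L * norm (x - q)" by (rule L)
      also have "\<dots> \<le> (\<bar>L\<bar> + 1) * norm (x - q)" by (intro mult_right_mono) auto
      also have "\<dots> < (\<bar>L\<bar> + 1) * d"
        using q(2) by (intro mult_strict_left_mono) (auto simp: dist_norm norm_minus_commute)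
      also have "\<dots> = e / 3" by (simp add: d_def field_simps)
      finally show ?thesis .
    qed
    have "Cauchy (\<lambda>n. w n q)" using conv[OF q(1)] by (simp add: Cauchy_convergent_iff)
    then obtain N where N: "\<And>m n. m \<ge> N \<Longrightarrow> n \<ge> N \<Longrightarrow> dist (w m q) (w n q) < e / 3"
      using e unfolding Cauchy_def by (metis zero_less_divide_iff zero_less_numeral)
    show "\<exists>M. \<forall>m\<ge>M. \<forall>n\<ge>M. dist (w m x) (w n x) < e"
    proof (intro exI allI impI)
      fix m n assume "m \<ge> N" "n \<ge> N"
      from N[OF this, unfolded dist_real_def] Lq[of m] Lq[of n] show "dist (w m x) (w n x) < e"
        unfolding dist_real_def by linarith
    qed
  qed
  then show ?thesis by (simp add: Cauchy_convergent_iff)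
qed

text \<open>Up to an error of order \<open>1 / (m + 1)\<close>, uniform in \<open>n\<close>,
  \<open>U n\<close> is its \<open>m\<close>-th average. For each \<open>m\<close> the averages
  converge in \<open>L2\<close> along one common subsequence, so that subsequence of
  \<open>U\<close> is Cauchy.\<close>

lemma energy_compactness:
  fixes U :: "nat \<Rightarrow> 'a::euclidean_space \<Rightarrow> real"
  assumes \<Omega>: "open \<Omega>" "bounded \<Omega>" and r: "\<And>n. repr \<Omega> (u n) (U n)"
    and A: "\<And>n. sqn (U n) \<le> A" and E: "\<And>n. energy 0 (U n) \<le> ennreal E"
  obtains k V where "strict_mono (k :: nat \<Rightarrow> nat)" "repr \<Omega> V V" "(\<lambda>n. sqn (\<lambda>x. U (k n) x - V x)) \<longlonglongrightarrow> 0"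
proof -
  have U: "sq_int (U n)" and Uz: "x \<notin> \<Omega> \<Longrightarrow> U n x = 0" for n x using r by (auto simp: repr_def)
  have Ui: "integrable lborel (U n)" for n by (rule repr_integrable[OF r \<Omega>])
  obtain R where R: "\<Omega> \<subseteq> cball 0 R" using \<Omega>(2) unfolding bounded_iff by (auto simp: subset_iff)
  define C where "C = sqrt (measure lebesgue \<Omega> * A)"
  have A0: "A \<ge> 0" using A[of 0] sqn_nonneg[of "U 0"] by linarith
  have C0: "C \<ge> 0" using A0 by (simp add: C_def)
  have C: "(\<integral>x. \<bar>U n x\<bar> \<partial>lborel) \<le> C" for n
  proof -
    have "(\<integral>x. \<bar>U n x\<bar> \<partial>lborel)\<^sup>2 \<le> measure lebesgue \<Omega> * A"
      using repr_integrable(2)[OF r \<Omega>, of n] mult_left_mono[OF A[of n], of "measure lebesgue \<Omega>"] by simp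
    then have "sqrt ((\<integral>x. \<bar>U n x\<bar> \<partial>lborel)\<^sup>2) \<le> C" unfolding C_def by (rule real_sqrt_le_mono)
    then show ?thesis by simp
  qed
  have "\<forall>m. \<exists>\<rho> :: 'a \<Rightarrow> real. \<exists>L B. bounded_density \<rho> B \<and> L-lipschitz_on UNIV \<rho> \<and>
    (\<forall>h. norm h \<ge> 1 \<longrightarrow> \<rho> h = 0) \<and> (\<forall>h. h \<noteq> 0 \<longrightarrow> \<rho> h \<le> 1 / real (Suc m) * kern 0 h)"
  proof
    fix m
    have "1 / real (Suc m) > 0" by simp
    from Lipschitz_density_exists[OF zero_less_one this] show "\<exists>\<rho> :: 'a \<Rightarrow> real. \<exists>L B. bounded_density \<rho> B \<and> L-lipschitz_on UNIV \<rho> \<and>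
      (\<forall>h. norm h \<ge> 1 \<longrightarrow> \<rho> h = 0) \<and> (\<forall>h. h \<noteq> 0 \<longrightarrow> \<rho> h \<le> 1 / real (Suc m) * kern 0 h)"
      by metis
  qed
  then obtain \<rho> :: "nat \<Rightarrow> 'a \<Rightarrow> real" and L B where
    \<rho>: "\<And>m. bounded_density (\<rho> m) (B m)" and L: "\<And>m. (L m)-lipschitz_on UNIV (\<rho> m)"
    and \<rho>0: "\<And>m h. norm h \<ge> 1 \<Longrightarrow> \<rho> m h = 0"
    and \<rho>k: "\<And>m h. h \<noteq> 0 \<Longrightarrow> \<rho> m h \<le> 1 / real (Suc m) * kern 0 h" by metis
  define W where "W m n = moll (\<rho> m) (U n)" for m n
  have Wsq: "sq_int (W m n)" for m n unfolding W_def by (rule sq_int_moll[OF \<rho> U Ui])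
  have [measurable]: "W m n \<in> borel_measurable borel" for m n using Wsq by measurable
  have WU: "sqn (\<lambda>x. W m n x - U n x) \<le> \<bar>E\<bar> / real (Suc m)" for m n
  proof -
    have "ennreal (sqn (\<lambda>x. W m n x - U n x)) \<le> ennreal (1 / real (Suc m)) * energy 0 (U n)"
      unfolding W_def by (rule sqn_moll_diff_le[OF \<rho> U Ui]) (use \<rho>k \<rho>0 in auto)
    also have "\<dots> \<le> ennreal (1 / real (Suc m)) * ennreal \<bar>E\<bar>"
      by (intro mult_left_mono order_trans[OF E] ennreal_leI) auto
    also have "\<dots> = ennreal (\<bar>E\<bar> / real (Suc m))" by (simp flip: ennreal_mult)
    finally show ?thesis by (subst (asm) ennreal_le_iff) auto
  qed
  have B0: "B m \<ge> 0" for m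
    using \<rho>[of m] unfolding bounded_density_def by (meson order_trans)
  have Wb: "\<bar>W m n x\<bar> \<le> B m * C" for m n x
    using abs_moll_le[OF \<rho> U Ui, of m n x] mult_left_mono[OF C[of n] B0[of m]] by (simp add: W_def)
  have Wl: "\<bar>W m n x - W m n y\<bar> \<le> (L m * C) * norm (x - y)" for m n x y
  proof -
    have "L m \<ge> 0" using lipschitz_on_nonneg[OF L] .
    then have "L m * (\<integral>x. \<bar>U n x\<bar> \<partial>lborel) * norm (x - y) \<le> (L m * C) * norm (x - y)"
      using C[of n] by (intro mult_right_mono mult_left_mono) auto
    then show ?thesis using moll_Lipschitz[OF \<rho> U Ui L, of m n x y] by (simp add: W_def)
  qed
  have W0: "W m n x = 0" if "norm x > R + 1" for m n x
    unfolding W_def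
  proof (rule moll_eq_0[OF \<rho>0])
    fix y assume "dist x y < 1"
    then have "norm y > R" using that norm_triangle_sub[of x y] by (simp add: dist_norm)
    then show "U n y = 0" using R by (intro Uz) auto
  qed
  obtain D :: "'a set" where D: "countable D" "closure D = UNIV"
  proof -
    obtain D :: "'a set" where D: "countable D" "\<And>X. open X \<Longrightarrow> X \<noteq> {} \<Longrightarrow> \<exists>d\<in>D. d \<in> X"
      by (rule countable_dense_setE) blast
    have "x \<in> closure D" for x
      unfolding closure_approachable
    proof (intro allI impI)
      fix e :: real assume "0 < e"
      then obtain d where "d \<in> D" "d \<in> ball x e" using D(2)[of "ball x e"] by auto
      then show "\<exists>y\<in>D. dist y x < e" by (auto simp: dist_commute)
    qed
    with D(1) show thesis by (intro that) auto
  qed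
  \<comment> \<open>Indexing by pairs of a density and a dense point yields one subsequence for all
    densities at once.\<close>
  have cnt: "countable ((UNIV :: nat set) \<times> D)" using D by auto
  \<comment> \<open>The extraction needs one bound for all pairs, so each average is scaled by its
    own bound, plus 1 to keep the divisor positive.\<close>
  have bd: "norm ((\<lambda>(m, q). W m n q / (B m * C + 1)) p) \<le> 1" for n p
  proof -
    obtain m q where p: "p = (m, q)" by (cases p)
    have "0 \<le> B m * C" using B0 C0 by simp
    then show ?thesis using Wb[of m n q] by (simp add: p field_simps)
  qed
  obtain k :: "nat \<Rightarrow> nat" where k: "strict_mono k" and
    kc: "\<And>p. p \<in> UNIV \<times> D \<Longrightarrow> \<exists>l. (\<lambda>n. (\<lambda>(m, q). W m (k n) q / (B m * C + 1)) p) \<longlonglongrightarrow> l"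
    using function_convergent_subsequence[OF cnt, of "\<lambda>n (m, q). W m n q / (B m * C + 1)" 1] bd by blast
  have conv: "convergent (\<lambda>n. W m (k n) x)" for m x
  proof (rule convergent_equi_Lipschitz[OF _ D(2)])
    show "\<bar>W m (k n) x - W m (k n) y\<bar> \<le> (L m * C) * norm (x - y)" for n x y by (rule Wl)
    fix q assume "q \<in> D"
    then obtain l where l: "(\<lambda>n. W m (k n) q / (B m * C + 1)) \<longlonglongrightarrow> l" using kc[of "(m, q)"] by auto
    have "B m * C + 1 \<noteq> 0" using B0[of m] C0 by (smt (verit) mult_nonneg_nonneg)
    then have "(\<lambda>n. W m (k n) q) \<longlonglongrightarrow> l * (B m * C + 1)"
      using tendsto_mult_right[OF l, of "B m * C + 1"] by simp
    then show "convergent (\<lambda>n. W m (k n) q)" by (auto simp: convergent_def)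
  qed
  define c where "c m x = lim (\<lambda>n. W m (k n) x)" for m x
  have clim: "(\<lambda>n. W m (k n) x) \<longlonglongrightarrow> c m x" for m x
    unfolding c_def using conv by (simp add: convergent_LIMSEQ_iff)
  have [measurable]: "c m \<in> borel_measurable borel" for m
    by (rule borel_measurable_LIMSEQ_real[OF clim]) measurable
  have cb: "\<bar>c m x\<bar> \<le> B m * C" for m x
    by (rule LIMSEQ_le_const2[OF tendsto_rabs[OF clim]]) (use Wb in auto)
  have c0: "c m x = 0" if "norm x > R + 1" for m x
    using clim[of m x] W0[OF that] by (simp add: LIMSEQ_const_iff)
  have bint: "integrable lborel (\<lambda>x::'a. (2 * (B m * C))\<^sup>2 * indicator (cball 0 (R + 1)) x)" for m
    using emeasure_lborel_cball_finite[of "0::'a" "R + 1"] by simp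
  have sqb: "(W m n x - c m x)\<^sup>2 \<le> (2 * (B m * C))\<^sup>2 * indicator (cball 0 (R + 1)) x" for m n x
  proof (cases "norm x > R + 1")
    case False
    have "\<bar>W m n x - c m x\<bar> \<le> \<bar>2 * (B m * C)\<bar>"
      using Wb[of m n x] cb[of m x] by linarith
    then have "(W m n x - c m x)\<^sup>2 \<le> (2 * (B m * C))\<^sup>2" by (simp only: abs_le_square_iff)
    then show ?thesis using False by (simp add: indicator_def)
  qed (simp add: W0 c0)
  have Wc: "sq_int (\<lambda>x. W m n x - c m x)" for m n
    unfolding sq_int_def
    by (intro conjI Bochner_Integration.integrable_bound[OF bint[of m]]) (use sqb in auto)
  have Wclim: "(\<lambda>n. sqn (\<lambda>x. W m (k n) x - c m x)) \<longlonglongrightarrow> 0" for m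
  proof -
    have "(\<lambda>n. \<integral>x. (W m (k n) x - c m x)\<^sup>2 \<partial>lborel) \<longlonglongrightarrow> (\<integral>x. 0 \<partial>(lborel :: 'a measure))"
    proof (rule integral_dominated_convergence[OF _ _ bint[of m]])
      have "(\<lambda>n. (W m (k n) x - c m x)\<^sup>2) \<longlonglongrightarrow> (c m x - c m x)\<^sup>2" for x
        by (intro tendsto_intros clim)
      then show "AE x in lborel. (\<lambda>n. (W m (k n) x - c m x)\<^sup>2) \<longlonglongrightarrow> 0" by simp
    qed (use sqb in auto)
    then show ?thesis by (simp add: sqn_def)
  qed
  have Uc: "sqn (\<lambda>x. U n x - c m x) \<le> 2 * (\<bar>E\<bar> / real (Suc m)) + 2 * sqn (\<lambda>x. W m n x - c m x)"
    and Ucsq: "sq_int (\<lambda>x. U n x - c m x)" for m n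
  proof -
    have UW: "sq_int (\<lambda>x. U n x - W m n x)" by (intro sq_int_diff U Wsq)
    show "sq_int (\<lambda>x. U n x - c m x)" using sq_int_add[OF UW Wc[of m n]] by simp
    show "sqn (\<lambda>x. U n x - c m x) \<le> 2 * (\<bar>E\<bar> / real (Suc m)) + 2 * sqn (\<lambda>x. W m n x - c m x)"
      using sqn_add_le[OF UW Wc[of m n]] WU[of m n] by (simp add: sqn_commute[of "U n"])
  qed
  \<comment> \<open>Two rounds of \<open>sqn (A + B) \<le> 2 * sqn A + 2 * sqn B\<close>, with
    \<open>c m\<close> as intermediate point.\<close>
  have UU: "sqn (\<lambda>x. U n x - U n' x) \<le> 8 * (\<bar>E\<bar> / real (Suc m)) +
    4 * sqn (\<lambda>x. W m n x - c m x) + 4 * sqn (\<lambda>x. W m n' x - c m x)" for n n' m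
    using sqn_diff_le[OF Ucsq[of n m] Ucsq[of n' m]] Uc[of n m] Uc[of n' m] by simp
  have cau: "\<exists>N. \<forall>n\<ge>N. \<forall>n'\<ge>N. sqn (\<lambda>x. U (k n) x - U (k n') x) \<le> e" if e: "e > 0" for e
  proof -
    \<comment> \<open>The first error becomes at most \<open>e / 2\<close>, and each of the other
      two is below \<open>4 * (e / 16)\<close>.\<close>
    obtain m where m: "real m > 16 * \<bar>E\<bar> / e" using reals_Archimedean2 by blast
    have "16 * \<bar>E\<bar> < e * real (Suc m)"
      using m e by (simp add: field_simps)
    then have m': "8 * (\<bar>E\<bar> / real (Suc m)) \<le> e / 2"
      by (simp add: field_simps)
    obtain N where N: "\<And>n. n \<ge> N \<Longrightarrow> sqn (\<lambda>x. W m (k n) x - c m x) < e / 16"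
      using LIMSEQ_D[OF Wclim[of m], of "e / 16"] e by auto
    show ?thesis
    proof (intro exI allI impI)
      fix n n' assume "n \<ge> N" "n' \<ge> N"
      then show "sqn (\<lambda>x. U (k n) x - U (k n') x) \<le> e"
        using UU[of "k n" "k n'" m] m' N[of n] N[of n'] by linarith
    qed
  qed
  obtain V where "sq_int V" "\<And>x. x \<notin> \<Omega> \<Longrightarrow> V x = 0" "(\<lambda>n. sqn (\<lambda>x. U (k n) x - V x)) \<longlonglongrightarrow> 0"
    using L2_complete[of "\<lambda>n. U (k n)" \<Omega>] U Uz cau by blast
  with k show thesis by (intro that[of k V] repr_self) auto
qed

section \<open>Exterior cones and the logarithmic Hardy inequality\<close>

text \<open>Starting on or above the graph and rising in direction \<open>e\<close> at least
  \<open>L\<close> times the lateral displacement, one stays on or above the graph. Half the chart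
  radius keeps both points in the chart, so one cone serves all boundary points near
  \<open>p\<close>.\<close>

lemma exterior_cone_local:
  fixes \<Omega> :: "'a::euclidean_space set"
  assumes \<Omega>: "open \<Omega>" and lip: "lipschitz_boundary \<Omega>" and p: "p \<in> frontier \<Omega>"
  shows "\<exists>r S. r > 0 \<and> S \<in> sets borel \<and> (\<forall>c>0. \<forall>z\<in>S. c *\<^sub>R z \<in> S) \<and> 0 < measure lborel (S \<inter> cball 0 1) \<and>
    (\<forall>q\<in>frontier \<Omega> \<inter> ball p r. \<forall>z\<in>S. norm z < r \<longrightarrow> q + z \<notin> \<Omega>)"
proof -
  obtain e r L and g :: "'a \<Rightarrow> real" where e: "norm e = 1" and r: "r > 0"
    and g: "L-lipschitz_on {y. y \<bullet> e = 0} g"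
    and graph: "\<Omega> \<inter> ball p r = {x \<in> ball p r. x \<bullet> e < g (x - (x \<bullet> e) *\<^sub>R e)}"
    using lip p unfolding lipschitz_boundary_def by blast
  define pr where "pr x = x - (x \<bullet> e) *\<^sub>R e" for x
  have ee: "e \<bullet> e = 1" using e by (simp add: dot_square_norm)
  have pr0: "pr x \<bullet> e = 0" for x by (simp add: pr_def inner_diff_left ee)
  have pr_add: "pr (x + y) = pr x + pr y" for x y by (simp add: pr_def inner_add_left algebra_simps)
  have pr_scale: "pr (c *\<^sub>R x) = c *\<^sub>R pr x" for c x by (simp add: pr_def algebra_simps)
  define f where "f z = z \<bullet> e - L * norm (pr z)" for z
  have fcont: "continuous_on UNIV f" unfolding f_def pr_def by (intro continuous_intros)
  define S where "S = {z. f z \<ge> 0}"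
  have Sm: "S \<in> sets borel"
    unfolding S_def using fcont by (intro borel_closed closed_Collect_le continuous_intros) auto
  have fscale: "f (c *\<^sub>R z) = c * f z" if "c > 0" for c z
    using that by (simp add: f_def pr_scale algebra_simps)
  have out: "q + z \<notin> \<Omega>" if q: "q \<in> frontier \<Omega> \<inter> ball p (r / 2)" and z: "z \<in> S" "norm z < r / 2" for q z
  proof
    assume in\<Omega>: "q + z \<in> \<Omega>"
    have qn: "q \<notin> \<Omega>" using q \<Omega> by (auto simp: frontier_def interior_open)
    have qb: "q \<in> ball p r" using q r by auto
    have "dist p (q + z) \<le> dist p q + dist q (q + z)" by (rule dist_triangle)
    then have qzb: "q + z \<in> ball p r" using q z(2) by (simp add: dist_norm)
    have "q \<bullet> e \<ge> g (pr q)" using qn qb graph unfolding pr_def by force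
    moreover have "\<bar>g (pr (q + z)) - g (pr q)\<bar> \<le> L * norm (pr z)"
      using lipschitz_onD[OF g, of "pr (q + z)" "pr q"] pr0[of "q + z"] pr0[of q] by (simp add: dist_norm pr_add)
    moreover have "z \<bullet> e \<ge> L * norm (pr z)" using z(1) by (simp add: S_def f_def)
    ultimately have "(q + z) \<bullet> e \<ge> g (pr (q + z))" by (simp add: inner_add_left)
    moreover have "q + z \<in> {x \<in> ball p r. x \<bullet> e < g (x - (x \<bullet> e) *\<^sub>R e)}"
      using in\<Omega> qzb graph by blast
    ultimately show False by (simp add: pr_def)
  qed
  have "0 < measure lborel (S \<inter> cball 0 1)"
  proof -
    \<comment> \<open>Half the axis vector is an interior point of the truncated cone, which gives
      positive measure.\<close>
    have "f (e /\<^sub>R 2) = 1 / 2" by (simp add: f_def pr_def ee)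
    moreover have "open ({z. f z > 0} \<inter> ball 0 1)"
      using fcont by (intro open_Int open_Collect_less continuous_intros) auto
    ultimately obtain d where d: "d > 0" "ball (e /\<^sub>R 2) d \<subseteq> {z. f z > 0} \<inter> ball 0 1"
      using e open_contains_ball[of "{z. f z > 0} \<inter> ball 0 1"] by (auto dest!: bspec[of _ _ "e /\<^sub>R 2"])
    have "0 < measure lborel (ball (e /\<^sub>R 2) d)" using d(1) by (simp add: content_ball)
    also have "\<dots> \<le> measure lborel (S \<inter> cball 0 1)"
    proof (rule measure_mono_fmeasurable)
      show "ball (e /\<^sub>R 2) d \<subseteq> S \<inter> cball 0 1" using d(2) by (force simp: S_def)
      have "emeasure lborel (S \<inter> cball 0 1) \<le> emeasure lborel (cball (0::'a) 1)"
        by (rule emeasure_mono) auto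
      then show "S \<inter> cball 0 1 \<in> fmeasurable lborel"
        using Sm emeasure_lborel_cball_finite[of "0::'a" 1]
        by (intro fmeasurableI) (auto intro: order_le_less_trans)
    qed simp
    finally show ?thesis .
  qed
  moreover have "\<forall>c>0. \<forall>z\<in>S. c *\<^sub>R z \<in> S" by (auto simp: S_def fscale)
  ultimately show ?thesis
    using r Sm out by (intro exI[of _ "r / 2"] exI[of _ S]) auto
qed

lemma finite_uniform_lower_bound:
  fixes f :: "'b \<Rightarrow> real"
  assumes "finite C" "\<And>p. p \<in> C \<Longrightarrow> f p > 0"
  obtains m where "m > 0" "\<And>p. p \<in> C \<Longrightarrow> m \<le> f p"
\<comment> \<open>The inserted 1 covers the case of empty \<open>C\<close>.\<close>
proof (rule that[of "Min (insert 1 (f ` C))"])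
  show "Min (insert 1 (f ` C)) > 0" using assms by (subst Min_gr_iff) auto
  show "Min (insert 1 (f ` C)) \<le> f p" if "p \<in> C" for p using assms that by (intro Min_le) auto
qed

text \<open>By compactness of the boundary finitely many charts suffice, so radius and measure are
  uniform; the cone itself still varies with the point.\<close>

lemma exterior_cone:
  fixes \<Omega> :: "'a::euclidean_space set"
  assumes \<Omega>: "open \<Omega>" "bounded \<Omega>" and lip: "lipschitz_boundary \<Omega>"
  obtains r \<gamma> where "r > 0" "\<gamma> > 0"
    "\<And>p. p \<in> frontier \<Omega> \<Longrightarrow> \<exists>S. S \<in> sets borel \<and> (\<forall>c>0. \<forall>z\<in>S. c *\<^sub>R z \<in> S) \<and>
      \<gamma> \<le> measure lborel (S \<inter> cball 0 1) \<and> (\<forall>z\<in>S. norm z < r \<longrightarrow> p + z \<notin> \<Omega>)"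
proof -
  obtain R S where RS: "\<And>p. p \<in> frontier \<Omega> \<Longrightarrow> R p > 0 \<and> S p \<in> sets borel \<and>
    (\<forall>c>0. \<forall>z\<in>S p. c *\<^sub>R z \<in> S p) \<and> 0 < measure lborel (S p \<inter> cball 0 1) \<and>
    (\<forall>q\<in>frontier \<Omega> \<inter> ball p (R p). \<forall>z\<in>S p. norm z < R p \<longrightarrow> q + z \<notin> \<Omega>)"
    using exterior_cone_local[OF \<Omega>(1) lip] by metis
  have "compact (frontier \<Omega>)" using \<Omega>(2) by (rule compact_frontier_bounded)
  moreover have "frontier \<Omega> \<subseteq> (\<Union>p\<in>frontier \<Omega>. ball p (R p))" using RS by force
  ultimately obtain C where C: "C \<subseteq> frontier \<Omega>" "finite C" "frontier \<Omega> \<subseteq> (\<Union>p\<in>C. ball p (R p))"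
    using compactE_image[of "frontier \<Omega>" "frontier \<Omega>" "\<lambda>p. ball p (R p)"] by (metis open_ball)
  obtain r where r: "r > 0" "\<And>p. p \<in> C \<Longrightarrow> r \<le> R p"
    using finite_uniform_lower_bound[OF C(2), of R] RS C(1) by blast
  obtain \<gamma> where \<gamma>: "\<gamma> > 0" "\<And>p. p \<in> C \<Longrightarrow> \<gamma> \<le> measure lborel (S p \<inter> cball 0 1)"
    using finite_uniform_lower_bound[OF C(2), of "\<lambda>p. measure lborel (S p \<inter> cball 0 1)"] RS C(1) by blast
  show thesis
  proof (rule that[OF r(1) \<gamma>(1)])
    fix q assume q: "q \<in> frontier \<Omega>"
    then obtain p where p: "p \<in> C" "q \<in> ball p (R p)" using C(3) by blast
    then have pf: "p \<in> frontier \<Omega>" using C(1) by blast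
    have "\<forall>z\<in>S p. norm z < r \<longrightarrow> q + z \<notin> \<Omega>"
      using RS[OF pf] p q r(2)[OF p(1)] by (meson IntI order_less_le_trans)
    then show "\<exists>S. S \<in> sets borel \<and> (\<forall>c>0. \<forall>z\<in>S. c *\<^sub>R z \<in> S) \<and>
      \<gamma> \<le> measure lborel (S \<inter> cball 0 1) \<and> (\<forall>z\<in>S. norm z < r \<longrightarrow> q + z \<notin> \<Omega>)"
      using RS[OF pf] \<gamma>(2)[OF p(1)] by (intro exI[of _ "S p"]) auto
  qed
qed

text \<open>The killing density of the energy, in the language of Dirichlet forms: the price per
  unit of \<open>u\<^sup>2\<close> at \<open>x\<close> for the points within distance 1 where the
  extension by zero vanishes.\<close>

definition killing :: "'a::euclidean_space set \<Rightarrow> 'a \<Rightarrow> ennreal" where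
  "killing \<Omega> x = (\<integral>\<^sup>+z. ennreal (kern 0 z) * indicator (ball 0 1) z * indicator (- \<Omega>) (x + z) \<partial>lborel)"

text \<open>The part of the cone at \<open>p\<close> between radii \<open>dist x p\<close> and
  \<open>r\<close> lies outside \<Omega>. Seen from \<open>x\<close>, its points are at most twice
  as far as from \<open>p\<close>, which costs the factor \<open>2 ^ d\<close>;
  \<open>r < 1 / 2\<close> keeps them in the unit ball around \<open>x\<close>.\<close>

lemma killing_ge_log:
  fixes \<Omega> S :: "'a::euclidean_space set"
  assumes \<Omega>[measurable]: "\<Omega> \<in> sets borel" and S[measurable]: "S \<in> sets borel"
    and cone: "\<And>c z. c > 0 \<Longrightarrow> z \<in> S \<Longrightarrow> c *\<^sub>R z \<in> S"
    and out: "\<And>z. z \<in> S \<Longrightarrow> norm z \<le> r \<Longrightarrow> p + z \<notin> \<Omega>"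
    and r: "0 < dist x p" "dist x p \<le> r" "r < 1 / 2"
  shows "ennreal (measure lborel (S \<inter> cball 0 1) * DIM('a) * (ln r - ln (dist x p)) / 2 ^ DIM('a)) \<le> killing \<Omega> x"
proof -
  let ?t = "dist x p" and ?d = "DIM('a)"
  have [measurable]: "ball (0::'a) 1 \<in> sets borel" by simp
  have "ennreal (measure lborel (S \<inter> cball 0 1) * ?d * (ln r - ln ?t) / 2 ^ ?d) =
    ennreal (1 / 2 ^ ?d) * ennreal (measure lborel (S \<inter> cball 0 1) * ?d * (ln r - ln ?t))"
    using r order_less_le_trans[OF r(1,2)] by (subst ennreal_mult[symmetric]) auto
  also have "\<dots> = ennreal (1 / 2 ^ ?d) *
    (\<integral>\<^sup>+w. indicator S w * (ennreal (kern 0 w) * indicator {?t..r} (norm w)) \<partial>lborel)"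
    using nn_integral_cone_kern_annulus[OF S cone r(1,2)] by simp
  also have "\<dots> = (\<integral>\<^sup>+w. ennreal (1 / 2 ^ ?d) * (indicator S w * (ennreal (kern 0 w) * indicator {?t..r} (norm w))) \<partial>lborel)"
    by (rule nn_integral_cmult[symmetric]) measurable
  also have "\<dots> \<le> (\<integral>\<^sup>+w. ennreal (kern 0 (w + (p - x))) * indicator (ball 0 1) (w + (p - x)) *
      indicator (- \<Omega>) (x + (w + (p - x))) \<partial>lborel)"
  proof (rule nn_integral_mono_AE, rule AE_mp[OF AE_lborel_singleton[of "x - p"]], intro AE_I2 impI)
    fix w :: 'a assume w: "w \<noteq> x - p"
    let ?z = "w + (p - x)"
    show "ennreal (1 / 2 ^ ?d) * (indicator S w * (ennreal (kern 0 w) * indicator {?t..r} (norm w)))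
      \<le> ennreal (kern 0 ?z) * indicator (ball 0 1) ?z * indicator (- \<Omega>) (x + ?z)"
    proof (cases "w \<in> S \<and> ?t \<le> norm w \<and> norm w \<le> r")
      case True
      have z0: "norm ?z > 0" using w by (auto simp: algebra_simps)
      have "norm ?z \<le> norm w + norm (p - x)" by (rule norm_triangle_ineq)
      then have z2: "norm ?z \<le> 2 * norm w" using True by (simp add: dist_norm norm_minus_commute)
      then have zb: "?z \<in> ball 0 1" using True r by simp
      have zo: "x + ?z \<in> - \<Omega>" using True out[of w] by (simp add: algebra_simps)
      have "norm ?z ^ ?d \<le> (2 * norm w) ^ ?d" using z2 by (intro power_mono) auto
      moreover have "norm w > 0" using True r(1) by linarith
      ultimately have "1 / 2 ^ ?d * kern 0 w \<le> kern 0 ?z"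
        using z0 by (auto simp: kern_def powr_realpow field_simps)
      then show ?thesis using True zb zo by (simp add: ennreal_mult[symmetric] ennreal_leI)
    qed (auto split: split_indicator)
  qed
  also have "\<dots> = killing \<Omega> x"
    unfolding killing_def
    by (rule nn_integral_lborel_translate[of "\<lambda>z. ennreal (kern 0 z) * indicator (ball 0 1) z * indicator (- \<Omega>) (x + z)"]) measurable
  finally show ?thesis .
qed

text \<open>
  The integrand on the left dominates the squared increments of all cutoff functions of \<open>t\<close>;
  the fatness of the complement of \<open>\<Omega>\<close> makes both sides of order \<open>ln (1 / t)\<close>, where \<open>t\<close> is the distance
  to the boundary.
\<close>

lemma Hardy_log:
  fixes \<Omega> :: "'a::euclidean_space set"
  assumes \<Omega>: "open \<Omega>" "bounded \<Omega>" and lip: "lipschitz_boundary \<Omega>"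
  obtains K where "K \<ge> 0" "\<And>x. x \<in> \<Omega> \<Longrightarrow>
    (\<integral>\<^sup>+z. ennreal (kern 0 (z::'a) * (min 1 (4 * norm z / infdist x (frontier \<Omega>)))\<^sup>2) * indicator (ball 0 1) z \<partial>lborel)
      \<le> ennreal K * (1 + killing \<Omega> x)"
proof -
  define d where "d = DIM('a)"
  define D where "D = measure lborel (cball (0::'a) 1) * d"
  have D0: "D \<ge> 0" by (simp add: D_def)
  have \<Omega>m[measurable]: "\<Omega> \<in> sets borel" using \<Omega> by simp
  obtain r0 \<gamma> where r0: "r0 > 0" and \<gamma>: "\<gamma> > 0" and cones:
    "\<And>p. p \<in> frontier \<Omega> \<Longrightarrow> \<exists>S. S \<in> sets borel \<and> (\<forall>c>0. \<forall>z\<in>S. c *\<^sub>R z \<in> S) \<and>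
      \<gamma> \<le> measure lborel (S \<inter> cball 0 1) \<and> (\<forall>z\<in>S. norm z < r0 \<longrightarrow> p + z \<notin> \<Omega>)"
    using exterior_cone[OF assms] by blast
  define r where "r = min (r0 / 2) (1 / 4)"
  have r: "r > 0" "r < r0" "r < 1 / 2" using r0 by (auto simp: r_def)
  \<comment> \<open>The first entry pays for displacements below \<open>t\<close> (with
    \<open>16 = 4\<^sup>2\<close> from the square) and for those between \<open>r\<close> and 1; the
    second compares the annulus between \<open>t\<close> and \<open>r\<close> with the killing
    term.\<close>
  define K where "K = max (16 * D - D * ln r) (D * 2 ^ d / (\<gamma> * d))"
  have lnr: "ln r \<le> 0" using r by simp
  have d0: "real d > 0" by (simp add: d_def)
  have K1: "16 * D - D * ln r \<le> K" and K2: "D * 2 ^ d / (\<gamma> * d) \<le> K" by (auto simp: K_def)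
  have K0: "K \<ge> 0" using K2 D0 \<gamma> d0 by (smt (verit) divide_nonneg_nonneg mult_nonneg_nonneg zero_le_power)
  have annulus: "(\<integral>\<^sup>+z. ennreal (kern 0 (z::'a)) * indicator {a..b} (norm z) \<partial>lborel) = ennreal (D * (ln b - ln a))"
    if "0 < a" "a \<le> b" for a b
    using nn_integral_cone_kern_annulus[of "UNIV::'a set" a b] that by (simp add: D_def d_def)
  show thesis
  proof (rule that[OF K0])
    fix x assume x: "x \<in> \<Omega>"
    define t where "t = infdist x (frontier \<Omega>)"
    have fne: "frontier \<Omega> \<noteq> {}"
      using x \<Omega>(2) by (auto simp: frontier_eq_empty)
    have "x \<notin> frontier \<Omega>" using x \<Omega>(1) by (auto simp: frontier_def interior_open)
    then have t0: "t > 0" unfolding t_def by (intro infdist_pos_not_in_closed fne) auto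
    obtain p where p: "p \<in> frontier \<Omega>" "t = dist x p"
      using infdist_attains_inf[of "frontier \<Omega>" x] fne unfolding t_def by auto
    have "(\<integral>\<^sup>+z. ennreal (kern 0 (z::'a) * (min 1 (4 * norm z / t))\<^sup>2) * indicator (ball 0 1) z \<partial>lborel) \<le>
      (\<integral>\<^sup>+z. (ennreal (16 / t\<^sup>2) * (ennreal (kern 0 (z::'a) * (norm z)\<^sup>2) * indicator {..t} (norm z)) +
        ennreal (kern 0 z) * indicator {t..r} (norm z)) + ennreal (kern 0 z) * indicator {r..1} (norm z) \<partial>lborel)"
    proof (rule nn_integral_mono)
      fix z :: 'a
      let ?m = "kern 0 z * (min 1 (4 * norm z / t))\<^sup>2"
      have m1: "?m \<le> kern 0 z"
        using t0 by (intro mult_left_le) (auto intro!: power_le_one)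
      have "(min 1 (4 * norm z / t))\<^sup>2 \<le> (4 * norm z / t)\<^sup>2"
        using t0 by (intro power_mono) auto
      then have "?m \<le> kern 0 z * (4 * norm z / t)\<^sup>2" by (rule mult_left_mono) simp
      also have "\<dots> = 16 / t\<^sup>2 * (kern 0 z * (norm z)\<^sup>2)" by (simp add: power_divide power_mult_distrib)
      finally have m2: "ennreal ?m \<le> ennreal (16 / t\<^sup>2) * ennreal (kern 0 z * (norm z)\<^sup>2)"
        by (subst ennreal_mult[symmetric]) (auto intro!: ennreal_leI)
      have m1': "ennreal ?m \<le> ennreal (kern 0 z)" using m1 by (rule ennreal_leI)
      consider "norm z \<le> t" | "t \<le> norm z" "norm z \<le> r" | "t \<le> norm z" "r \<le> norm z" "norm z \<le> 1" | "norm z > 1"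
        by linarith
      then show "ennreal ?m * indicator (ball 0 1) z \<le>
        (ennreal (16 / t\<^sup>2) * (ennreal (kern 0 z * (norm z)\<^sup>2) * indicator {..t} (norm z)) +
        ennreal (kern 0 z) * indicator {t..r} (norm z)) + ennreal (kern 0 z) * indicator {r..1} (norm z)"
      proof cases
        case 1
        have "ennreal ?m * indicator (ball 0 1) z \<le> ennreal ?m * 1" by (intro mult_left_mono) (auto split: split_indicator)
        also have "\<dots> \<le> ennreal (16 / t\<^sup>2) * (ennreal (kern 0 z * (norm z)\<^sup>2) * indicator {..t} (norm z))"
          using m2 1 by simp
        finally show ?thesis by (meson add_increasing2 zero_le)
      next
        case 2
        have "ennreal ?m * indicator (ball 0 1) z \<le> ennreal ?m * 1" by (intro mult_left_mono) (auto split: split_indicator)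
        also have "\<dots> \<le> ennreal (kern 0 z) * indicator {t..r} (norm z)" using m1' 2 by simp
        finally show ?thesis by (meson add_increasing add_increasing2 zero_le)
      next
        case 3
        have "ennreal ?m * indicator (ball 0 1) z \<le> ennreal ?m * 1" by (intro mult_left_mono) (auto split: split_indicator)
        also have "\<dots> \<le> ennreal (kern 0 z) * indicator {r..1} (norm z)" using m1' 3 by simp
        finally show ?thesis by (meson add_increasing zero_le)
      qed auto
    qed
    also have "\<dots> = (ennreal (16 / t\<^sup>2) * (\<integral>\<^sup>+z. ennreal (kern 0 (z::'a) * (norm z)\<^sup>2) * indicator {..t} (norm z) \<partial>lborel) +
        (\<integral>\<^sup>+z. ennreal (kern 0 (z::'a)) * indicator {t..r} (norm z) \<partial>lborel)) +
        (\<integral>\<^sup>+z. ennreal (kern 0 (z::'a)) * indicator {r..1} (norm z) \<partial>lborel)"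
      by (simp add: nn_integral_add nn_integral_cmult)
    also have "\<dots> \<le> (ennreal (16 * D) + ennreal K * killing \<Omega> x) + ennreal (- D * ln r)"
    proof (intro add_mono)
      have "ennreal (16 / t\<^sup>2) * (\<integral>\<^sup>+z. ennreal (kern 0 (z::'a) * (norm z)\<^sup>2) * indicator {..t} (norm z) \<partial>lborel)
        \<le> ennreal (16 / t\<^sup>2) * ennreal (D * t\<^sup>2)"
        using nn_integral_kern_0_moment_le[of t, where ?'a='a] t0 by (intro mult_left_mono) (auto simp: D_def d_def)
      also have "\<dots> = ennreal (16 * D)"
        using t0 D0 by (subst ennreal_mult[symmetric]) auto
      finally show "ennreal (16 / t\<^sup>2) * (\<integral>\<^sup>+z. ennreal (kern 0 (z::'a) * (norm z)\<^sup>2) * indicator {..t} (norm z) \<partial>lborel)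
        \<le> ennreal (16 * D)" .
      show "(\<integral>\<^sup>+z. ennreal (kern 0 (z::'a)) * indicator {r..1} (norm z) \<partial>lborel) \<le> ennreal (- D * ln r)"
        using annulus[of r 1] r by simp
      show "(\<integral>\<^sup>+z. ennreal (kern 0 (z::'a)) * indicator {t..r} (norm z) \<partial>lborel) \<le> ennreal K * killing \<Omega> x"
      \<comment> \<open>For \<open>t > r\<close> the annulus is empty. Otherwise the cone at the
        nearest boundary point makes both sides proportional to \<open>ln r - ln t\<close>.\<close>
      proof (cases "t \<le> r")
        case True
        obtain S where S: "S \<in> sets borel" "\<And>c z. c > 0 \<Longrightarrow> z \<in> S \<Longrightarrow> c *\<^sub>R z \<in> S"
          "\<gamma> \<le> measure lborel (S \<inter> cball 0 1)" "\<And>z. z \<in> S \<Longrightarrow> norm z < r0 \<Longrightarrow> p + z \<notin> \<Omega>"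
          using cones[OF p(1)] by blast
        define m where "m = measure lborel (S \<inter> cball 0 1)"
        have m: "m \<ge> \<gamma>" using S(3) by (simp add: m_def)
        have l0: "ln r - ln t \<ge> 0" using True t0 r by simp
        have "ennreal (m * d * (ln r - ln t) / 2 ^ d) \<le> killing \<Omega> x"
          unfolding m_def d_def p(2) using True t0 r p
          by (intro killing_ge_log[OF \<Omega>m S(1,2)] S(4)) auto
        then have "ennreal K * ennreal (m * d * (ln r - ln t) / 2 ^ d) \<le> ennreal K * killing \<Omega> x"
          by (rule mult_left_mono) simp
        moreover have "D * (ln r - ln t) \<le> K * (m * d * (ln r - ln t) / 2 ^ d)"
        proof -
          have "D * 2 ^ d \<le> K * (\<gamma> * d)" using K2 \<gamma> d0 by (simp add: divide_le_eq)
          also have "\<dots> \<le> K * (m * d)" using m K0 d0 by (intro mult_left_mono mult_right_mono) auto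
          finally have "D * 2 ^ d * (ln r - ln t) \<le> K * (m * d) * (ln r - ln t)"
            using l0 by (rule mult_right_mono)
          then show ?thesis by (simp add: field_simps)
        qed
        ultimately show ?thesis
          using annulus[OF t0 True] K0 m \<gamma> l0
          by (simp add: ennreal_mult[symmetric]) (meson ennreal_leI order_trans)
      next
        case False
        then have "(\<integral>\<^sup>+z. ennreal (kern 0 (z::'a)) * indicator {t..r} (norm z) \<partial>lborel) = 0" by simp
        then show ?thesis by simp
      qed
    qed
    also have "\<dots> = ennreal (16 * D - D * ln r) + ennreal K * killing \<Omega> x"
      using D0 lnr by (simp add: ennreal_plus[symmetric] mult_nonneg_nonpos add_ac del: ennreal_plus)
    also have "\<dots> \<le> ennreal K * (1 + killing \<Omega> x)"
      using K1 by (simp add: distrib_left ennreal_leI add_right_mono)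
    finally show "(\<integral>\<^sup>+z. ennreal (kern 0 (z::'a) * (min 1 (4 * norm z / infdist x (frontier \<Omega>)))\<^sup>2) * indicator (ball 0 1) z \<partial>lborel)
      \<le> ennreal K * (1 + killing \<Omega> x)" unfolding t_def .
  qed
qed

section \<open>Recovery sequences\<close>

text \<open>The zone of width \<open>1 / (j + 1)\<close> on which it vanishes leaves room for
  averaging. The distance is taken to the boundary from either side; off \<Omega> it is the function
  being cut off that vanishes.\<close>

definition cutoff :: "'a::euclidean_space set \<Rightarrow> nat \<Rightarrow> 'a \<Rightarrow> real" where
  "cutoff \<Omega> j x = min 1 (max 0 (real (Suc j) * infdist x (frontier \<Omega>) - 1))"

lemma cutoff_bounds: "0 \<le> cutoff \<Omega> j x" "cutoff \<Omega> j x \<le> 1"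
  by (auto simp: cutoff_def)

lemma cutoff_measurable[measurable]: "cutoff \<Omega> j \<in> borel_measurable borel"
  unfolding cutoff_def[abs_def]
  by (intro borel_measurable_continuous_onI continuous_intros)

text \<open>The bound is independent of \<open>j\<close>. If \<open>n * t x \<le> 4\<close>, the
  slope \<open>n\<close> is at most \<open>4 / t x\<close>. Otherwise either both values are 1, or
  \<open>t y < t x / 2\<close>, and then the distance from \<open>x\<close> to \<open>y\<close>
  exceeds \<open>t x / 2\<close> and the right side is 1.\<close>

lemma cutoff_diff_le:
  assumes t: "infdist x (frontier \<Omega>) > 0"
  shows "\<bar>cutoff \<Omega> j y - cutoff \<Omega> j x\<bar> \<le> min 1 (4 * norm (y - x) / infdist x (frontier \<Omega>))"
proof -
  define t where "t x = infdist x (frontier \<Omega>)" for x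
  define n where "n = real (Suc j)"
  have n: "n > 0" by (simp add: n_def)
  have chi: "cutoff \<Omega> j x = min 1 (max 0 (n * t x - 1))" for x by (simp add: cutoff_def t_def n_def)
  have lip: "\<bar>t y - t x\<bar> \<le> norm (y - x)"
    unfolding t_def using infdist_triangle_abs[of y "frontier \<Omega>" x] by (simp add: dist_norm)
  have t0: "t x > 0" using t by (simp add: t_def)
  have "\<bar>cutoff \<Omega> j y - cutoff \<Omega> j x\<bar> \<le> 4 * norm (y - x) / t x"
  proof (cases "n * t x \<le> 4")
    case True
    have "\<bar>cutoff \<Omega> j y - cutoff \<Omega> j x\<bar> \<le> \<bar>n * t y - n * t x\<bar>" unfolding chi by linarith
    also have "\<dots> = n * \<bar>t y - t x\<bar>" using n by (simp add: abs_mult right_diff_distrib[symmetric])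
    also have "\<dots> \<le> n * norm (y - x)" using lip n by simp
    also have "\<dots> = (n * t x) * norm (y - x) / t x" using t0 by simp
    also have "\<dots> \<le> 4 * norm (y - x) / t x" using True t0 by (intro divide_right_mono mult_right_mono) auto
    finally show ?thesis .
  next
    case False
    show ?thesis
    proof (cases "n * t y \<ge> 2")
      case True
      then have "cutoff \<Omega> j y = cutoff \<Omega> j x" using False unfolding chi by simp
      then show ?thesis using t0 by simp
    next
      case y: False
      then have "2 * (n * t y) < n * t x" using False by linarith
      then have "n * (2 * t y) < n * t x" by (simp add: mult_ac)
      then have "2 * t y < t x" using n by (simp only: mult_less_cancel_left_pos)
      then have "1 \<le> 4 * norm (y - x) / t x" using lip t0 by (simp add: field_simps)
      then show ?thesis using cutoff_bounds[of \<Omega> j x] cutoff_bounds[of \<Omega> j y] by linarith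
    qed
  qed
  then show ?thesis using cutoff_bounds[of \<Omega> j x] cutoff_bounds[of \<Omega> j y] by (simp add: t_def)
qed

lemma tendsto_cutoff:
  assumes t: "infdist x (frontier \<Omega>) > 0"
  shows "(\<lambda>j. cutoff \<Omega> j x) \<longlonglongrightarrow> 1"
proof (rule tendsto_eventually)
  obtain N where N: "real N * infdist x (frontier \<Omega>) > 2"
    using reals_Archimedean3[OF t] by blast
  show "\<forall>\<^sub>F j in sequentially. cutoff \<Omega> j x = 1"
    using eventually_ge_at_top[of N]
  proof eventually_elim
    case (elim j)
    then have "real N * infdist x (frontier \<Omega>) \<le> real (Suc j) * infdist x (frontier \<Omega>)"
      using t by (intro mult_right_mono) auto
    with N show ?case by (simp add: cutoff_def)
  qed
qed

lemma energy_eq_pair: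
  fixes U :: "'a::euclidean_space \<Rightarrow> real"
  assumes U: "sq_int U"
  shows "energy s U = (\<integral>\<^sup>+(z, x). ennreal (kern s z * indicator (ball 0 1) z * (U (x + z) - U x)\<^sup>2) \<partial>(lborel \<Otimes>\<^sub>M lborel))"
proof -
  have [measurable]: "U \<in> borel_measurable borel" using U by measurable
  have [measurable]: "ball (0::'a) 1 \<in> sets borel" by simp
  have "energy s U = (\<integral>\<^sup>+z. \<integral>\<^sup>+x. ennreal (kern s z * indicator (ball 0 1) z * (U (x + z) - U x)\<^sup>2) \<partial>lborel \<partial>lborel)"
    unfolding energy_def
  proof (intro nn_integral_cong)
    fix z :: 'a
    have "(\<integral>\<^sup>+x. ennreal (kern s z * indicator (ball 0 1) z * (U (x + z) - U x)\<^sup>2) \<partial>lborel) =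
      (\<integral>\<^sup>+x. ennreal (kern s z) * indicator (ball 0 1) z * ennreal ((U (x + z) - U x)\<^sup>2) \<partial>lborel)"
      by (intro nn_integral_cong) (auto simp: ennreal_mult split: split_indicator)
    also have "\<dots> = ennreal (kern s z) * indicator (ball 0 1) z * ennreal (diff2 U z)"
      by (subst nn_integral_cmult) (auto simp: nn_integral_diff2[OF U])
    finally show "ennreal (kern s z) * indicator (ball 0 1) z * ennreal (diff2 U z) =
      (\<integral>\<^sup>+x. ennreal (kern s z * indicator (ball 0 1) z * (U (x + z) - U x)\<^sup>2) \<partial>lborel)" ..
  qed
  also have "\<dots> = (\<integral>\<^sup>+(z, x). ennreal (kern s z * indicator (ball 0 1) z * (U (x + z) - U x)\<^sup>2) \<partial>(lborel \<Otimes>\<^sub>M lborel))"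
    by (subst lborel.nn_integral_fst[symmetric]) auto
  finally show ?thesis .
qed

lemma killing_measurable[measurable]:
  fixes \<Omega> :: "'a::euclidean_space set"
  assumes [measurable]: "\<Omega> \<in> sets borel"
  shows "killing \<Omega> \<in> borel_measurable borel"
proof -
  have [measurable]: "ball (0::'a) 1 \<in> sets borel" by simp
  show ?thesis unfolding killing_def[abs_def] by measurable
qed

text \<open>Where \<open>x + z\<close> lies outside \<Omega>, the increment of \<open>V\<close> is
  just \<open>- V x\<close>.\<close>

lemma nn_integral_killing_le_energy:
  fixes V :: "'a::euclidean_space \<Rightarrow> real"
  assumes [measurable]: "\<Omega> \<in> sets borel" and V: "sq_int V" and z: "\<And>x. x \<notin> \<Omega> \<Longrightarrow> V x = 0"
  shows "(\<integral>\<^sup>+x. ennreal ((V x)\<^sup>2) * killing \<Omega> x \<partial>lborel) \<le> energy 0 V"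
proof -
  have [measurable]: "V \<in> borel_measurable borel" using V by measurable
  have [measurable]: "ball (0::'a) 1 \<in> sets borel" by simp
  have "(\<integral>\<^sup>+x. ennreal ((V x)\<^sup>2) * killing \<Omega> x \<partial>lborel) =
    (\<integral>\<^sup>+x. \<integral>\<^sup>+z. ennreal ((V x)\<^sup>2) * (ennreal (kern 0 z) * indicator (ball 0 1) z * indicator (- \<Omega>) (x + z)) \<partial>lborel \<partial>lborel)"
    unfolding killing_def by (intro nn_integral_cong nn_integral_cmult[symmetric]) measurable
  also have "\<dots> \<le> (\<integral>\<^sup>+x. \<integral>\<^sup>+z. ennreal (kern 0 z * indicator (ball 0 1) z * (V (x + z) - V x)\<^sup>2) \<partial>lborel \<partial>lborel)"
    by (intro nn_integral_mono) (auto simp: z ennreal_mult mult.commute split: split_indicator)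
  also have "\<dots> = energy 0 V"
    unfolding energy_eq_pair[OF V]
    by (subst lborel_pair.nn_integral_snd[symmetric]) auto
  finally show ?thesis .
qed

lemma infdist_frontier_pos:
  fixes \<Omega> :: "'a::euclidean_space set"
  assumes "open \<Omega>" "bounded \<Omega>" "x \<in> \<Omega>"
  shows "infdist x (frontier \<Omega>) > 0"
proof -
  have "frontier \<Omega> \<noteq> {}" using assms by (auto simp: frontier_eq_empty)
  moreover have "x \<notin> frontier \<Omega>" using assms by (auto simp: frontier_def interior_open)
  ultimately show ?thesis by (intro infdist_pos_not_in_closed) auto
qed

text \<open>The increment of the product is the cutoff times the increment of \<open>V\<close>, plus
  \<open>V x\<close> times the increment of the cutoff. The squares are dominated independently of
  \<open>j\<close>: the first by the energy density of \<open>V\<close>, the second by an integrable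
  function, thanks to \<open>Hardy_log\<close> and the killing bound.\<close>

lemma
  fixes V :: "'a::euclidean_space \<Rightarrow> real"
  assumes \<Omega>: "open \<Omega>" "bounded \<Omega>" and lip: "lipschitz_boundary \<Omega>"
    and V: "sq_int V" and z: "\<And>x. x \<notin> \<Omega> \<Longrightarrow> V x = 0" and fin: "energy 0 V < \<infinity>"
  shows sq_int_cutoff: "sq_int (\<lambda>x. cutoff \<Omega> j x * V x)"
    and tendsto_energy_cutoff: "(\<lambda>j. energy 0 (\<lambda>x. cutoff \<Omega> j x * V x)) \<longlonglongrightarrow> energy 0 V"
    and tendsto_sqn_cutoff: "(\<lambda>j. sqn (\<lambda>x. cutoff \<Omega> j x * V x - V x)) \<longlonglongrightarrow> 0"
proof -
  have [measurable]: "V \<in> borel_measurable borel" using V by measurable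
  have [measurable]: "ball (0::'a) 1 \<in> sets borel" "\<Omega> \<in> sets borel" using \<Omega> by auto
  let ?t = "\<lambda>x. infdist x (frontier \<Omega>)"
  have [measurable]: "?t \<in> borel_measurable borel"
    by (intro borel_measurable_continuous_onI continuous_intros)
  define w where "w j x = cutoff \<Omega> j x * V x" for j x
  have [measurable]: "w j \<in> borel_measurable borel" for j unfolding w_def by measurable
  have wlim: "(\<lambda>j. w j x) \<longlonglongrightarrow> V x" for x
  proof (cases "x \<in> \<Omega>")
    case True
    from tendsto_mult[OF tendsto_cutoff[OF infdist_frontier_pos[OF \<Omega> True]] tendsto_const[of "V x"]]
    show ?thesis by (simp add: w_def)
  qed (simp add: w_def z)
  have wV: "\<bar>w j x\<bar> \<le> \<bar>V x\<bar>" for j x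
    using cutoff_bounds[of \<Omega> j x] by (simp add: w_def abs_mult mult_left_le_one_le)
  have wsq: "sq_int (w j)" for j
    unfolding sq_int_def
  proof
    show "integrable lborel (\<lambda>x. (w j x)\<^sup>2)"
      by (rule Bochner_Integration.integrable_bound[OF sq_int_integrable[OF V]])
        (use wV in \<open>auto simp: abs_le_square_iff\<close>)
  qed measurable
  then show "sq_int (\<lambda>x. cutoff \<Omega> j x * V x)" by (simp add: w_def[abs_def])
  have "(\<lambda>j. sqn (\<lambda>x. w j x - V x)) \<longlonglongrightarrow> (\<integral>x. 0 \<partial>(lborel :: 'a measure))"
    unfolding sqn_def
  proof (rule integral_dominated_convergence)
    show "integrable lborel (\<lambda>x. (V x)\<^sup>2)" by (rule sq_int_integrable[OF V])
    have "(\<lambda>j. (w j x - V x)\<^sup>2) \<longlonglongrightarrow> (V x - V x)\<^sup>2" for x by (intro tendsto_intros wlim)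
    then show "AE x in lborel. (\<lambda>j. (w j x - V x)\<^sup>2) \<longlonglongrightarrow> 0" by simp
    fix j
    have "\<bar>w j x - V x\<bar> \<le> \<bar>V x\<bar>" for x
    proof -
      have "w j x - V x = (cutoff \<Omega> j x - 1) * V x" by (simp add: w_def algebra_simps)
      then show ?thesis using cutoff_bounds[of \<Omega> j x] by (simp add: abs_mult mult_left_le_one_le)
    qed
    then show "AE x in lborel. norm ((w j x - V x)\<^sup>2) \<le> (V x)\<^sup>2"
      by (auto simp: abs_le_square_iff)
  qed measurable
  then show "(\<lambda>j. sqn (\<lambda>x. cutoff \<Omega> j x * V x - V x)) \<longlonglongrightarrow> 0" by (simp add: w_def)
  define m where "m z x = (min 1 (4 * norm z / ?t x))\<^sup>2" for z x :: 'a
  have [measurable]: "(\<lambda>p. m (fst p) (snd p)) \<in> borel_measurable (borel \<Otimes>\<^sub>M borel)"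
    unfolding m_def by measurable
  have [measurable]: "(\<lambda>z. m z x) \<in> borel_measurable borel" for x
    unfolding m_def by measurable
  define k where "k z = kern 0 z * indicator (ball 0 1) z" for z :: 'a
  have [measurable]: "k \<in> borel_measurable borel" unfolding k_def by measurable
  have k0: "k z \<ge> 0" for z by (simp add: k_def)
  have m0: "m z x \<ge> 0" for z x by (simp add: m_def)
  have wbound: "(w j (x + z) - w j x)\<^sup>2 \<le> 2 * (V (x + z) - V x)\<^sup>2 + 2 * ((V x)\<^sup>2 * m z x)" for j z x
  proof -
    let ?a = "cutoff \<Omega> j (x + z) * (V (x + z) - V x)" and ?b = "V x * (cutoff \<Omega> j (x + z) - cutoff \<Omega> j x)"
    have "w j (x + z) - w j x = ?a + ?b" by (simp add: w_def algebra_simps)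
    then have "(w j (x + z) - w j x)\<^sup>2 \<le> 2 * ?a\<^sup>2 + 2 * ?b\<^sup>2"
      using sum_squares_bound[of ?a ?b] by (simp add: power2_sum)
    moreover have "?a\<^sup>2 \<le> (V (x + z) - V x)\<^sup>2"
      using cutoff_bounds[of \<Omega> j "x + z"]
      by (simp add: abs_le_square_iff[symmetric] abs_mult mult_left_le_one_le)
    moreover have "?b\<^sup>2 \<le> (V x)\<^sup>2 * m z x"
    proof (cases "x \<in> \<Omega>")
      case True
      have "\<bar>cutoff \<Omega> j (x + z) - cutoff \<Omega> j x\<bar> \<le> min 1 (4 * norm z / ?t x)"
        using cutoff_diff_le[OF infdist_frontier_pos[OF \<Omega> True], of j "x + z"] by simp
      from power_mono[OF this, of 2] have "(cutoff \<Omega> j (x + z) - cutoff \<Omega> j x)\<^sup>2 \<le> m z x"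
        by (simp add: m_def)
      then show ?thesis by (simp add: power_mult_distrib mult_left_mono)
    qed (simp add: z)
    ultimately show ?thesis by linarith
  qed
  obtain K where K: "K \<ge> 0" "\<And>x. x \<in> \<Omega> \<Longrightarrow>
    (\<integral>\<^sup>+z. ennreal (kern 0 (z::'a) * m z x) * indicator (ball 0 1) z \<partial>lborel) \<le> ennreal K * (1 + killing \<Omega> x)"
    using Hardy_log[OF \<Omega> lip] unfolding m_def by blast
  have I2: "(\<integral>\<^sup>+(z, x). ennreal (k z * ((V x)\<^sup>2 * m z x)) \<partial>(lborel \<Otimes>\<^sub>M lborel)) < \<infinity>"
  proof -
    \<comment> \<open>The order of integration is exchanged because \<open>Hardy_log\<close> is an
      estimate in \<open>z\<close> at fixed \<open>x\<close>.\<close>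
    have "(\<integral>\<^sup>+(z, x). ennreal (k z * ((V x)\<^sup>2 * m z x)) \<partial>(lborel \<Otimes>\<^sub>M lborel)) =
      (\<integral>\<^sup>+x. \<integral>\<^sup>+z. ennreal (k z * ((V x)\<^sup>2 * m z x)) \<partial>lborel \<partial>lborel)"
      by (subst lborel_pair.nn_integral_snd[symmetric]) (auto simp: split_beta')
    also have "\<dots> \<le> (\<integral>\<^sup>+x. ennreal K * (ennreal ((V x)\<^sup>2) + ennreal ((V x)\<^sup>2) * killing \<Omega> x) \<partial>lborel)"
    proof (rule nn_integral_mono)
      fix x
      show "(\<integral>\<^sup>+z. ennreal (k z * ((V x)\<^sup>2 * m z x)) \<partial>lborel) \<le>
        ennreal K * (ennreal ((V x)\<^sup>2) + ennreal ((V x)\<^sup>2) * killing \<Omega> x)"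
      proof (cases "x \<in> \<Omega>")
        case True
        have "(\<integral>\<^sup>+z. ennreal (k z * ((V x)\<^sup>2 * m z x)) \<partial>lborel) =
          (\<integral>\<^sup>+z. ennreal ((V x)\<^sup>2) * (ennreal (kern 0 z * m z x) * indicator (ball 0 1) z) \<partial>lborel)"
          by (intro nn_integral_cong) (auto simp: k_def ennreal_mult[symmetric] m0 mult_ac split: split_indicator)
        also have "\<dots> = ennreal ((V x)\<^sup>2) * (\<integral>\<^sup>+z. ennreal (kern 0 z * m z x) * indicator (ball 0 1) z \<partial>lborel)"
          by (rule nn_integral_cmult) measurable
        also have "\<dots> \<le> ennreal ((V x)\<^sup>2) * (ennreal K * (1 + killing \<Omega> x))"
          by (intro mult_left_mono K(2) True) simp
        finally show ?thesis by (simp add: distrib_left mult_ac)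
      qed (simp add: z)
    qed
    also have "\<dots> = ennreal K * ((\<integral>\<^sup>+x. ennreal ((V x)\<^sup>2) \<partial>lborel) + (\<integral>\<^sup>+x. ennreal ((V x)\<^sup>2) * killing \<Omega> x \<partial>lborel))"
      by (subst nn_integral_cmult; (subst nn_integral_add)?) auto
    also have "\<dots> \<le> ennreal K * (ennreal (sqn V) + energy 0 V)"
      using nn_integral_killing_le_energy[OF _ V z] \<Omega>
      by (intro mult_left_mono add_mono) (auto simp: nn_integral_sqn[OF V])
    also have "\<dots> < \<infinity>" using fin by (simp add: ennreal_mult_less_top)
    finally show ?thesis .
  qed
  have "(\<lambda>j. \<integral>\<^sup>+(z, x). ennreal (k z * (w j (x + z) - w j x)\<^sup>2) \<partial>(lborel \<Otimes>\<^sub>M lborel)) \<longlonglongrightarrow>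
    (\<integral>\<^sup>+(z, x). ennreal (k z * (V (x + z) - V x)\<^sup>2) \<partial>(lborel \<Otimes>\<^sub>M lborel))"
  proof (rule nn_integral_dominated_convergence[where
        w = "\<lambda>(z, x). 2 * ennreal (k z * (V (x + z) - V x)\<^sup>2) + 2 * ennreal (k z * ((V x)\<^sup>2 * m z x))"])
    show "(\<lambda>(z, x). 2 * ennreal (k z * (V (x + z) - V x)\<^sup>2) + 2 * ennreal (k z * ((V x)\<^sup>2 * m z x)))
      \<in> borel_measurable (lborel \<Otimes>\<^sub>M lborel)"
      unfolding split_beta' by measurable
    show "AE p in lborel \<Otimes>\<^sub>M lborel. (\<lambda>j. case p of (z, x) \<Rightarrow> ennreal (k z * (w j (x + z) - w j x)\<^sup>2))
      \<longlonglongrightarrow> (case p of (z, x) \<Rightarrow> ennreal (k z * (V (x + z) - V x)\<^sup>2))"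
      by (intro AE_I2) (auto simp: split_beta' intro!: tendsto_ennrealI tendsto_intros wlim)
    have "(\<integral>\<^sup>+(z, x). 2 * ennreal (k z * (V (x + z) - V x)\<^sup>2) + 2 * ennreal (k z * ((V x)\<^sup>2 * m z x)) \<partial>(lborel \<Otimes>\<^sub>M lborel))
      = 2 * (\<integral>\<^sup>+(z, x). ennreal (k z * (V (x + z) - V x)\<^sup>2) \<partial>(lborel \<Otimes>\<^sub>M lborel)) +
        2 * (\<integral>\<^sup>+(z, x). ennreal (k z * ((V x)\<^sup>2 * m z x)) \<partial>(lborel \<Otimes>\<^sub>M lborel))"
      unfolding split_beta'
      by (subst nn_integral_add; (subst nn_integral_cmult)?; (subst nn_integral_cmult)?) measurable
    also have "\<dots> < \<infinity>"
      using I2 fin unfolding energy_eq_pair[OF V] k_def[symmetric] by (simp add: ennreal_mult_less_top)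
    finally show "(\<integral>\<^sup>+p. (case p of (z, x) \<Rightarrow> 2 * ennreal (k z * (V (x + z) - V x)\<^sup>2) + 2 * ennreal (k z * ((V x)\<^sup>2 * m z x))) \<partial>(lborel \<Otimes>\<^sub>M lborel)) < \<infinity>" .
    fix j
    have "ennreal (k z * (w j (x + z) - w j x)\<^sup>2) \<le>
      2 * ennreal (k z * (V (x + z) - V x)\<^sup>2) + 2 * ennreal (k z * ((V x)\<^sup>2 * m z x))" for z x
    proof -
      have "ennreal (k z * (w j (x + z) - w j x)\<^sup>2) \<le> ennreal (k z * (2 * (V (x + z) - V x)\<^sup>2 + 2 * ((V x)\<^sup>2 * m z x)))"
        by (intro ennreal_leI mult_left_mono wbound k0)
      also have "\<dots> = ennreal (2 * (k z * (V (x + z) - V x)\<^sup>2) + 2 * (k z * ((V x)\<^sup>2 * m z x)))"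
        by (simp add: algebra_simps)
      also have "\<dots> = 2 * ennreal (k z * (V (x + z) - V x)\<^sup>2) + 2 * ennreal (k z * ((V x)\<^sup>2 * m z x))"
        using k0 m0 by (subst ennreal_plus) (auto simp: ennreal_mult)
      finally show ?thesis .
    qed
    then show "AE p in lborel \<Otimes>\<^sub>M lborel. (case p of (z, x) \<Rightarrow> ennreal (k z * (w j (x + z) - w j x)\<^sup>2)) \<le>
      (case p of (z, x) \<Rightarrow> 2 * ennreal (k z * (V (x + z) - V x)\<^sup>2) + 2 * ennreal (k z * ((V x)\<^sup>2 * m z x)))"
      by auto
  qed measurable
  then have "(\<lambda>j. energy 0 (w j)) \<longlonglongrightarrow> energy 0 V"
    unfolding energy_eq_pair[OF V] energy_eq_pair[OF wsq] k_def .
  then show "(\<lambda>j. energy 0 (\<lambda>x. cutoff \<Omega> j x * V x)) \<longlonglongrightarrow> energy 0 V"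
    by (simp add: w_def[abs_def])
qed

text \<open>For a Lipschitz function of bounded support \<open>diff2\<close> is of order
  \<open>(norm z)\<^sup>2\<close>, which makes the kernel with exponent 1/2 an integrable
  majorant.\<close>

lemma tendsto_energy_Lipschitz:
  fixes w :: "'a::euclidean_space \<Rightarrow> real"
  assumes w: "sq_int w" and lip: "\<And>x y. \<bar>w x - w y\<bar> \<le> L * norm (x - y)"
    and supp: "\<And>x. norm x > R \<Longrightarrow> w x = 0" and s: "s \<longlonglongrightarrow> 0"
  shows "(\<lambda>n. energy (s n) w) \<longlonglongrightarrow> energy 0 w"
proof -
  have [measurable]: "w \<in> borel_measurable borel" using w by measurable
  have [measurable]: "ball (0::'a) 1 \<in> sets borel" by simp
  define C where "C = L\<^sup>2 * measure lborel (cball (0::'a) (R + 1))"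
  have C0: "C \<ge> 0" by (simp add: C_def)
  have d2: "diff2 w z \<le> C * (norm z)\<^sup>2" if "norm z < 1" for z
  proof -
    have fin: "emeasure lborel (cball (0::'a) (R + 1)) < \<infinity>" by (rule emeasure_lborel_cball_finite)
    have "diff2 w z \<le> (\<integral>x. (L * norm z)\<^sup>2 * indicator (cball 0 (R + 1)) (x::'a) \<partial>lborel)"
      unfolding diff2_def sqn_def
    proof (rule integral_mono)
      show "integrable lborel (\<lambda>x. (w (x + z) - w x)\<^sup>2)"
        by (intro sq_int_integrable sq_int_diff sq_int_translate w)
      show "integrable lborel (\<lambda>x::'a. (L * norm z)\<^sup>2 * indicator (cball 0 (R + 1)) x)"
        using fin by simp
      fix x
      show "(w (x + z) - w x)\<^sup>2 \<le> (L * norm z)\<^sup>2 * indicator (cball 0 (R + 1)) x"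
      proof (cases "norm x \<le> R + 1")
        case True
        have "\<bar>w (x + z) - w x\<bar> \<le> L * norm z" using lip[of "x + z" x] by simp
        from power_mono[OF this, of 2] show ?thesis using True by simp
      next
        case False
        then have "norm (x + z) > R" using that norm_triangle_ineq4[of "x + z" z] by simp
        then show ?thesis using supp[of "x + z"] supp[of x] False by simp
      qed
    qed
    also have "\<dots> = C * (norm z)\<^sup>2" by (simp add: C_def power_mult_distrib)
    finally show ?thesis .
  qed
  \<comment> \<open>Truncation makes the domination hold for every \<open>n\<close>; eventually
    nothing is changed.\<close>
  define s' where "s' n = min (s n) (1 / 2)" for n
  have ss': "\<forall>\<^sub>F n in sequentially. s' n = s n"
    using order_tendstoD(2)[OF s, of "1/2"] by (auto simp: s'_def elim: eventually_mono)
  have s': "s' \<longlonglongrightarrow> 0" by (rule Lim_transform_eventually[OF s]) (use ss' in \<open>auto elim: eventually_mono\<close>)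
  have "(\<lambda>n. energy (s' n) w) \<longlonglongrightarrow> energy 0 w"
    unfolding energy_def
  proof (rule nn_integral_dominated_convergence[where
      w = "\<lambda>z. ennreal C * (ennreal (kern (1/2) z * (norm z)\<^sup>2) * indicator {..1} (norm z))"])
    have "(\<integral>\<^sup>+z. ennreal C * (ennreal (kern (1/2) (z::'a) * (norm z)\<^sup>2) * indicator {..1} (norm z)) \<partial>lborel) =
      ennreal C * (\<integral>\<^sup>+z. ennreal (kern (1/2) (z::'a) * (norm z)\<^sup>2) * indicator {..1} (norm z) \<partial>lborel)"
      by (rule nn_integral_cmult) measurable
    also have "\<dots> < \<infinity>"
      using nn_integral_kern_half_moment_finite[of 1, where ?'a='a] by (simp add: ennreal_mult_less_top)
    finally show "(\<integral>\<^sup>+z. ennreal C * (ennreal (kern (1/2) (z::'a) * (norm z)\<^sup>2) * indicator {..1} (norm z)) \<partial>lborel) < \<infinity>" .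
    have "(\<lambda>n. ennreal (kern (s' n) z)) \<longlonglongrightarrow> ennreal (kern 0 z)" for z :: 'a
      by (intro tendsto_ennrealI tendsto_kern s')
    then have "(\<lambda>n. (indicator (ball 0 1) z * ennreal (diff2 w z)) * ennreal (kern (s' n) z))
      \<longlonglongrightarrow> (indicator (ball 0 1) z * ennreal (diff2 w z)) * ennreal (kern 0 z)" for z :: 'a
      by (intro ennreal_tendsto_cmult) (auto split: split_indicator)
    then show "AE z in lborel. (\<lambda>n. ennreal (kern (s' n) (z::'a)) * indicator (ball 0 1) z * ennreal (diff2 w z))
      \<longlonglongrightarrow> ennreal (kern 0 z) * indicator (ball 0 1) z * ennreal (diff2 w z)"
      by (simp add: mult_ac)
    fix n
    show "AE z in lborel. ennreal (kern (s' n) (z::'a)) * indicator (ball 0 1) z * ennreal (diff2 w z)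
      \<le> ennreal C * (ennreal (kern (1/2) z * (norm z)\<^sup>2) * indicator {..1} (norm z))"
    proof (intro AE_I2)
      fix z :: 'a
      show "ennreal (kern (s' n) z) * indicator (ball 0 1) z * ennreal (diff2 w z)
        \<le> ennreal C * (ennreal (kern (1/2) z * (norm z)\<^sup>2) * indicator {..1} (norm z))"
      proof (cases "norm z < 1")
        case True
        have "kern (s' n) z * diff2 w z \<le> kern (1/2) z * (C * (norm z)\<^sup>2)"
          using True by (intro mult_mono d2 kern_mono) (auto simp: s'_def)
        also have "\<dots> = C * (kern (1/2) z * (norm z)\<^sup>2)" by simp
        finally show ?thesis using True C0 by (simp add: ennreal_mult[symmetric] ennreal_leI)
      qed auto
    qed
  qed measurable
  then show ?thesis
    by (rule Lim_transform_eventually) (use ss' in \<open>auto elim: eventually_mono\<close>)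
qed

lemma diagonal_choice:
  fixes P :: "nat \<Rightarrow> nat \<Rightarrow> bool"
  assumes "\<And>k. eventually (P k) sequentially"
  obtains \<kappa> :: "nat \<Rightarrow> nat" where "filterlim \<kappa> at_top sequentially" "eventually (\<lambda>n. P (\<kappa> n) n) sequentially"
proof -
  have "\<forall>k. \<exists>N. \<forall>n\<ge>N. P k n" using assms by (simp add: eventually_sequentially)
  then obtain N where N: "\<And>k n. n \<ge> N k \<Longrightarrow> P k n" by metis
  \<comment> \<open>\<open>\<kappa> n\<close> is the largest index whose threshold \<open>n\<close>
    has passed; \<open>k \<le> n\<close> keeps the candidates finite.\<close>
  define A where "A n = {k. k \<le> n \<and> N k \<le> n}" for n
  define \<kappa> where "\<kappa> n = Max (A n)" for n
  have A: "finite (A n)" for n unfolding A_def by (rule finite_subset[of _ "{..n}"]) auto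
  have in_A: "\<kappa> n \<in> A n" if "n \<ge> N 0" for n
    unfolding \<kappa>_def using that A by (intro Max_in) (auto simp: A_def)
  show thesis
  proof (rule that)
    show "filterlim \<kappa> at_top sequentially"
      unfolding filterlim_at_top
    proof
      fix K
      show "\<forall>\<^sub>F n in sequentially. K \<le> \<kappa> n"
        using eventually_ge_at_top[of "max K (N K)"]
        by eventually_elim (auto simp: \<kappa>_def A_def intro!: Max_ge finite_subset[of _ "{.._}"])
    qed
    show "\<forall>\<^sub>F n in sequentially. P (\<kappa> n) n"
      using eventually_ge_at_top[of "N 0"]
      by eventually_elim (use in_A N in \<open>auto simp: A_def\<close>)
  qed
qed

lemma Lipschitz_approximation:
  fixes V :: "'a::euclidean_space \<Rightarrow> real"
  assumes \<Omega>: "open \<Omega>" "bounded \<Omega>" and lip: "lipschitz_boundary \<Omega>"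
    and V: "repr \<Omega> V V" and fin: "energy 0 V < \<infinity>" and e: "e > 0"
  obtains w L where "repr \<Omega> w w" "\<And>x y. \<bar>w x - w y\<bar> \<le> L * norm (x - y)"
    "sqn (\<lambda>x. w x - V x) \<le> e" "energy 0 w < energy 0 V + ennreal e"
proof -
  have Vsq: "sq_int V" and Vz: "\<And>x. x \<notin> \<Omega> \<Longrightarrow> V x = 0" using V by (auto simp: repr_def)
  have cut1: "sq_int (\<lambda>x. cutoff \<Omega> j x * V x)" for j
    by (rule sq_int_cutoff[OF \<Omega> lip Vsq Vz fin])
  have cut2: "(\<lambda>j. energy 0 (\<lambda>x. cutoff \<Omega> j x * V x)) \<longlonglongrightarrow> energy 0 V"
    by (rule tendsto_energy_cutoff[OF \<Omega> lip Vsq Vz fin])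
  have cut3: "(\<lambda>j. sqn (\<lambda>x. cutoff \<Omega> j x * V x - V x)) \<longlonglongrightarrow> 0"
    by (rule tendsto_sqn_cutoff[OF \<Omega> lip Vsq Vz fin])
  have "energy 0 V < energy 0 V + ennreal e"
    using fin e by (cases "energy 0 V") (auto simp: ennreal_less_iff simp flip: ennreal_plus)
  then have "\<forall>\<^sub>F j in sequentially. energy 0 (\<lambda>x. cutoff \<Omega> j x * V x) < energy 0 V + ennreal e"
    by (rule order_tendstoD(2)[OF cut2])
  moreover have "\<forall>\<^sub>F j in sequentially. sqn (\<lambda>x. cutoff \<Omega> j x * V x - V x) < e / 4"
    using e by (intro order_tendstoD(2)[OF cut3]) auto
  ultimately have "\<forall>\<^sub>F j in sequentially. energy 0 (\<lambda>x. cutoff \<Omega> j x * V x) < energy 0 V + ennreal e \<and>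
    sqn (\<lambda>x. cutoff \<Omega> j x * V x - V x) < e / 4" by (rule eventually_conj)
  then obtain j where j: "energy 0 (\<lambda>x. cutoff \<Omega> j x * V x) < energy 0 V + ennreal e"
    "sqn (\<lambda>x. cutoff \<Omega> j x * V x - V x) < e / 4"
    using eventually_happens'[OF sequentially_bot] by blast
  define W where "W x = cutoff \<Omega> j x * V x" for x
  have Wr: "repr \<Omega> W W" using cut1 Vz unfolding W_def by (intro repr_self) auto
  then have Wsq: "sq_int W" by (auto simp: repr_def)
  have Wi: "integrable lborel W" by (rule repr_integrable[OF Wr \<Omega>])
  have Wt: "1 / real (Suc j) < infdist y (frontier \<Omega>) \<and> y \<in> \<Omega>" if "W y \<noteq> 0" for y
  proof -
    have "cutoff \<Omega> j y \<noteq> 0" "y \<in> \<Omega>" using that Vz by (auto simp: W_def)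
    then show ?thesis by (auto simp: cutoff_def field_simps split: if_splits)
  qed
  obtain E where E: "energy 0 W = ennreal E" "E \<ge> 0"
    using j(1) fin unfolding W_def[symmetric] by (cases "energy 0 W") auto
  \<comment> \<open>Radius 1 is required by the error estimate; \<open>1 / (j + 1)\<close> is the
    width of the zone left empty by the cutoff.\<close>
  define d where "d = min 1 (1 / real (Suc j))"
  have d: "d > 0" "d \<le> 1" "d \<le> 1 / real (Suc j)" by (auto simp: d_def)
  \<comment> \<open>Makes the averaging error at most \<open>e / 4\<close>, with
    \<open>E + 1\<close> guarding against \<open>E = 0\<close>. With the cutoff error below
    \<open>e / 4\<close>, doubling both gives \<open>e\<close>.\<close>
  have c: "e / (4 * (E + 1)) > 0" using e E by simp
  obtain \<rho> :: "'a \<Rightarrow> real" and L B where \<rho>: "bounded_density \<rho> B" "L-lipschitz_on UNIV \<rho>"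
    "\<And>h. norm h \<ge> d \<Longrightarrow> \<rho> h = 0" "\<And>h. h \<noteq> 0 \<Longrightarrow> \<rho> h \<le> e / (4 * (E + 1)) * kern 0 h"
    using Lipschitz_density_exists[OF d(1) c] by metis
  define w where "w = moll \<rho> W"
  have wsq: "sq_int w" unfolding w_def by (rule sq_int_moll[OF \<rho>(1) Wsq Wi])
  have wz: "w x = 0" if x: "x \<notin> \<Omega>" for x
    unfolding w_def
  proof (rule moll_eq_0[OF \<rho>(3)])
    fix y assume y: "dist x y < d"
    show "W y = 0"
    proof (rule ccontr)
      assume "W y \<noteq> 0"
      then have t: "1 / real (Suc j) < infdist y (frontier \<Omega>)" and "y \<in> \<Omega>" using Wt by auto
      \<comment> \<open>A segment from \<Omega> to its complement meets the boundary, so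
        \<open>x\<close> is at least as far from \<open>y\<close> as the boundary is.\<close>
      then have "closed_segment y x \<inter> frontier \<Omega> \<noteq> {}"
        using x by (intro connected_Int_frontier) auto
      then obtain f where f: "f \<in> closed_segment y x" "f \<in> frontier \<Omega>" by blast
      have "infdist y (frontier \<Omega>) \<le> dist y f" by (rule infdist_le[OF f(2)])
      also have "\<dots> \<le> dist y x" using dist_in_closed_segment[OF f(1)] by (simp add: dist_commute)
      finally show False using t y d(3) by (simp add: dist_commute)
    qed
  qed
  have "ennreal (sqn (\<lambda>x. w x - W x)) \<le> ennreal (e / (4 * (E + 1))) * energy 0 W"
    unfolding w_def
    by (rule sqn_moll_diff_le[OF \<rho>(1) Wsq Wi]) (use \<rho>(3,4) c d(2) in auto)
  also have "\<dots> = ennreal (e / (4 * (E + 1)) * E)"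
    unfolding E(1) using E(2) c by (intro ennreal_mult[symmetric]) auto
  also have "\<dots> \<le> ennreal (e / 4)" using E e by (intro ennreal_leI) (simp add: field_simps)
  finally have "sqn (\<lambda>x. w x - W x) \<le> e / 4" using e by (subst (asm) ennreal_le_iff) auto
  moreover have "sqn (\<lambda>x. W x - V x) < e / 4" using j(2) by (simp add: W_def)
  moreover have "sqn (\<lambda>x. w x - V x) \<le> 2 * sqn (\<lambda>x. w x - W x) + 2 * sqn (\<lambda>x. W x - V x)"
    using sqn_add_le[OF sq_int_diff[OF wsq Wsq] sq_int_diff[OF Wsq Vsq]] by simp
  ultimately have "sqn (\<lambda>x. w x - V x) \<le> e" by linarith
  moreover have "energy 0 w < energy 0 V + ennreal e"
    using energy_moll_le[OF \<rho>(1) Wsq Wi, of 0] j(1) unfolding w_def W_def[symmetric] by (rule order_le_less_trans)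
  moreover have "\<bar>w x - w y\<bar> \<le> (L * (\<integral>x. \<bar>W x\<bar> \<partial>lborel)) * norm (x - y)" for x y
    unfolding w_def by (rule moll_Lipschitz[OF \<rho>(1) Wsq Wi \<rho>(2)])
  ultimately show thesis using that repr_self[OF wsq wz] by blast
qed

text \<open>Only an upper bound has to be arranged; the liminf inequality supplies the lower one.
  For fixed \<open>k\<close> the strict bound at \<open>s = 0\<close> persists for small
  \<open>s n\<close>, and the index is then sent to infinity slowly enough.\<close>

lemma recovery_sequence:
  fixes V :: "'a::euclidean_space \<Rightarrow> real"
  assumes \<Omega>: "open \<Omega>" "bounded \<Omega>" and lip: "lipschitz_boundary \<Omega>"
    and V: "repr \<Omega> V V" and fin: "energy 0 V < \<infinity>"
    and s: "\<And>n. s n \<ge> 0" "s \<longlonglongrightarrow> 0"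
  obtains U where "\<And>n. repr \<Omega> (U n) (U n)" "(\<lambda>n. sqn (\<lambda>x. U n x - V x)) \<longlonglongrightarrow> 0"
    "(\<lambda>n. Fhat \<Omega> (s n) (U n)) \<longlonglongrightarrow> Fhat \<Omega> 0 V"
proof -
  have Vsq: "sq_int V" using V by (auto simp: repr_def)
  define e where "e k = 1 / real (Suc k)" for k
  have e0: "e k > 0" for k by (simp add: e_def)
  have elim: "e \<longlonglongrightarrow> 0" unfolding e_def using LIMSEQ_inverse_real_of_nat by (simp add: inverse_eq_divide)
  have "\<forall>k. \<exists>w L. repr \<Omega> w w \<and> (\<forall>x y. \<bar>w x - w y\<bar> \<le> L * norm (x - y)) \<and>
    sqn (\<lambda>x. w x - V x) \<le> e k \<and> energy 0 w < energy 0 V + ennreal (e k)"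
    using Lipschitz_approximation[OF \<Omega> lip V fin e0] by metis
  then obtain w L where w: "\<And>k. repr \<Omega> (w k) (w k)"
    and wl: "\<And>k x y. \<bar>w k x - w k y\<bar> \<le> L k * norm (x - y)"
    and wV: "\<And>k. sqn (\<lambda>x. w k x - V x) \<le> e k" and wE: "\<And>k. energy 0 (w k) < energy 0 V + ennreal (e k)"
    by metis
  obtain R where R: "\<Omega> \<subseteq> cball 0 R" using \<Omega>(2) unfolding bounded_iff by (auto simp: subset_iff)
  have "\<forall>\<^sub>F n in sequentially. energy (s n) (w k) < energy 0 V + ennreal (e k)" for k
  proof (rule order_tendstoD(2)[OF tendsto_energy_Lipschitz wE])
    show "sq_int (w k)" using w by (auto simp: repr_def)
    show "w k x = 0" if "norm x > R" for x by (rule repr_zero_far[OF w R that])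
  qed (rule wl s)+
  then obtain \<kappa> where \<kappa>: "filterlim \<kappa> at_top sequentially"
    and \<kappa>E: "\<forall>\<^sub>F n in sequentially. energy (s n) (w (\<kappa> n)) < energy 0 V + ennreal (e (\<kappa> n))"
    using diagonal_choice[of "\<lambda>k n. energy (s n) (w k) < energy 0 V + ennreal (e k)"] by blast
  define U where "U n = w (\<kappa> n)" for n
  have Ur: "repr \<Omega> (U n) (U n)" for n unfolding U_def by (rule w)
  have Usq: "sq_int (U n)" for n using Ur by (auto simp: repr_def)
  have e\<kappa>: "(\<lambda>n. e (\<kappa> n)) \<longlonglongrightarrow> 0" by (rule filterlim_compose[OF elim \<kappa>])
  have UV: "(\<lambda>n. sqn (\<lambda>x. U n x - V x)) \<longlonglongrightarrow> 0"
    by (rule tendsto_sandwich[OF _ _ tendsto_const e\<kappa>]) (auto simp: U_def wV)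
  have low: "Fhat \<Omega> 0 V \<le> liminf (\<lambda>n. Fhat \<Omega> (s n) (U n))"
    by (rule liminf_Fhat[OF \<Omega> s Ur V UV])
  have t: "(\<lambda>n. tail (s n) (U n)) \<longlonglongrightarrow> tail 0 V"
    by (rule tendsto_tail[OF Usq Vsq UV _ s]) (rule repr_zero_far[OF Ur R])
  obtain E where E: "energy 0 V = ennreal E" "E \<ge> 0" using fin by (cases "energy 0 V") auto
  have half: "enn2ereal (ennreal (1/2) * ennreal x) = ereal (x / 2)" if "x \<ge> 0" for x
    using that by (subst ennreal_mult[symmetric]) (auto simp: enn2ereal_ennreal)
  have F0: "Fhat \<Omega> 0 V = ereal (E / 2 + tail 0 V)"
    unfolding Fhat_eq[OF V \<Omega> order_refl] E(1) half[OF E(2)] by simp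
  have "\<forall>\<^sub>F n in sequentially. Fhat \<Omega> (s n) (U n) \<le> ereal ((E + e (\<kappa> n)) / 2 + tail (s n) (U n))"
    using \<kappa>E
  proof eventually_elim
    case (elim n)
    then have "energy (s n) (U n) \<le> ennreal (E + e (\<kappa> n))"
      using E e0[of "\<kappa> n"] by (simp add: U_def)
    then have "ennreal (1/2) * energy (s n) (U n) \<le> ennreal (1/2) * ennreal (E + e (\<kappa> n))"
      by (rule mult_left_mono) simp
    then have "enn2ereal (ennreal (1/2) * energy (s n) (U n)) \<le> enn2ereal (ennreal (1/2) * ennreal (E + e (\<kappa> n)))"
      by (simp only: less_eq_ennreal.rep_eq)
    also have "\<dots> = ereal ((E + e (\<kappa> n)) / 2)" using E(2) e0[of "\<kappa> n"] by (intro half) simp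
    finally have "Fhat \<Omega> (s n) (U n) \<le> ereal ((E + e (\<kappa> n)) / 2) + ereal (tail (s n) (U n))"
      unfolding Fhat_eq[OF Ur \<Omega> s(1)] by (rule add_right_mono)
    then show ?case by simp
  qed
  then have "limsup (\<lambda>n. Fhat \<Omega> (s n) (U n)) \<le> limsup (\<lambda>n. ereal ((E + e (\<kappa> n)) / 2 + tail (s n) (U n)))"
    by (rule Limsup_mono)
  also have "\<dots> = ereal ((E + 0) / 2 + tail 0 V)"
    by (intro lim_imp_Limsup tendsto_intros e\<kappa> t) auto
  finally have up: "limsup (\<lambda>n. Fhat \<Omega> (s n) (U n)) \<le> Fhat \<Omega> 0 V" by (simp add: F0)
  have "(\<lambda>n. Fhat \<Omega> (s n) (U n)) \<longlonglongrightarrow> Fhat \<Omega> 0 V"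
  proof (rule Liminf_eq_Limsup)
    have "liminf (\<lambda>n. Fhat \<Omega> (s n) (U n)) \<le> limsup (\<lambda>n. Fhat \<Omega> (s n) (U n))" by (rule Liminf_le_Limsup) simp
    then show "liminf (\<lambda>n. Fhat \<Omega> (s n) (U n)) = Fhat \<Omega> 0 V" "limsup (\<lambda>n. Fhat \<Omega> (s n) (U n)) = Fhat \<Omega> 0 V"
      using low up by auto
  qed simp
  then show thesis using that Ur UV by blast
qed

section \<open>Return to the functionals on \<Omega> and conclusion\<close>

lemma H00_iff:
  assumes "repr \<Omega> u U" "u \<in> L2 \<Omega>"
  shows "u \<in> H00 \<Omega> \<longleftrightarrow> energy 0 U < \<infinity>"
proof -
  have "inverse (2::ennreal) < top" using ennreal_less_top[of "1/2"] by simp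
  then have "ennreal (1/2) * energy 0 U < \<infinity> \<longleftrightarrow> energy 0 U < \<infinity>"
    by (cases "energy 0 U") (auto simp: ennreal_mult_less_top ennreal_mult_top)
  then show ?thesis unfolding H00_def using assms(2) by (simp add: G1_eq[OF assms(1)])
qed

text \<open>Of the two copies of \<open>measure lebesgue \<Omega> * sqn U\<close> in the hypothesis,
  one absorbs the negative part of the tail and the other survives as a bound on the norm.\<close>

lemma energy_bounds_of_Fhat_bound:
  fixes U :: "'a::euclidean_space \<Rightarrow> real"
  assumes \<Omega>: "open \<Omega>" "bounded \<Omega>" and r: "repr \<Omega> u U" and s: "s \<ge> 0"
    and le: "Fhat \<Omega> s u + ereal (2 * measure lebesgue \<Omega> * (L2_norm \<Omega> u)\<^sup>2) \<le> ereal M"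
  shows "energy 0 U \<le> ennreal (2 * M)" "measure lebesgue \<Omega> * sqn U \<le> M"
proof -
  let ?m = "measure lebesgue \<Omega>"
  have n: "(L2_norm \<Omega> u)\<^sup>2 = sqn U" by (simp add: L2_norm_eq[OF r \<Omega>(1)])
  have "tail s U \<ge> - (\<integral>x. \<bar>U x\<bar> \<partial>lborel)\<^sup>2" by (rule tail_ge[OF repr_integrable(1)[OF r \<Omega>] s])
  then have t: "tail s U \<ge> - (?m * sqn U)" using repr_integrable(2)[OF r \<Omega>] by linarith
  have le': "enn2ereal (ennreal (1/2) * energy s U) + ereal (tail s U) + ereal (2 * ?m * sqn U) \<le> ereal M"
    using le unfolding Fhat_eq[OF r \<Omega> s] n .
  then obtain E where E: "energy s U = ennreal E" "E \<ge> 0"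
    by (cases "energy s U") (auto simp: ennreal_mult_top)
  have "enn2ereal (ennreal (1/2) * ennreal E) = ereal (E / 2)"
    using E(2) by (subst ennreal_mult[symmetric]) (auto simp: enn2ereal_ennreal)
  with le' have le'': "E / 2 + tail s U + 2 * ?m * sqn U \<le> M" by (simp add: E(1))
  have m0: "?m * sqn U \<ge> 0" by simp
  then show "?m * sqn U \<le> M" using le'' t E(2) by linarith
  have "E \<le> 2 * M" using le'' t m0 by linarith
  moreover have "energy 0 U \<le> energy s U" using s by (rule energy_mono)
  ultimately show "energy 0 U \<le> ennreal (2 * M)" using E by (metis ennreal_leI order_trans)
qed

theorem theorem1p4:
  fixes \<Omega> :: "'a::euclidean_space set" and s :: "nat \<Rightarrow> real"
  assumes "open \<Omega>" and "bounded \<Omega>" and "lipschitz_boundary \<Omega>"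
    and "\<And>n. s n \<in> {0<..<1}" and "s \<longlonglongrightarrow> 0"
  shows
    "(\<forall>(u::nat \<Rightarrow> 'a \<Rightarrow> real) (M::real).
        (\<forall>n. u n \<in> L2 \<Omega>) \<longrightarrow>
        (\<forall>n. Fhat \<Omega> (s n) (u n) + ereal (2 * measure lebesgue \<Omega> * (L2_norm \<Omega> (u n))\<^sup>2) \<le> ereal M) \<longrightarrow>
        (\<exists>k::nat \<Rightarrow> nat. strict_mono k \<and> (\<exists>v\<in>H00 \<Omega>. L2_tendsto \<Omega> (\<lambda>n. u (k n)) v)))
     \<and> (\<forall>v\<in>L2 \<Omega>. \<forall>u::nat \<Rightarrow> 'a \<Rightarrow> real.
        (\<forall>n. u n \<in> L2 \<Omega>) \<longrightarrow> L2_tendsto \<Omega> u v \<longrightarrow>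
        Fhat \<Omega> 0 v \<le> liminf (\<lambda>n. Fhat \<Omega> (s n) (u n)))
     \<and> (\<forall>v\<in>H00 \<Omega>. \<exists>u::nat \<Rightarrow> 'a \<Rightarrow> real.
        (\<forall>n. u n \<in> L2 \<Omega>) \<and> L2_tendsto \<Omega> u v \<and>
        (\<lambda>n. Fhat \<Omega> (s n) (u n)) \<longlonglongrightarrow> Fhat \<Omega> 0 v)"
proof (intro conjI allI ballI impI)
  note \<Omega> = assms(1,2)
  have s0: "s n \<ge> 0" for n using assms(4)[of n] by simp
  {
    fix u :: "nat \<Rightarrow> 'a \<Rightarrow> real" and M :: real
    assume u: "\<forall>n. u n \<in> L2 \<Omega>"
      and le: "\<forall>n. Fhat \<Omega> (s n) (u n) + ereal (2 * measure lebesgue \<Omega> * (L2_norm \<Omega> (u n))\<^sup>2) \<le> ereal M"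
    have "\<forall>n. \<exists>U. repr \<Omega> (u n) U" using u repr_exists[OF _ \<Omega>(1)] by metis
    then obtain U where U: "\<And>n. repr \<Omega> (u n) (U n)" by metis
    have Usq: "sq_int (U n)" for n using U by (auto simp: repr_def)
    note bounds = energy_bounds_of_Fhat_bound[OF \<Omega> U s0 le[rule_format]]
    \<comment> \<open>If \<Omega> is empty, both sides are 0 since \<open>M / 0 = 0\<close>;
      otherwise an open set has positive measure and one may divide.\<close>
    have A: "sqn (U n) \<le> M / measure lebesgue \<Omega>" for n
    proof (cases "\<Omega> = {}")
      case True
      then have "U n = (\<lambda>_. 0)" using U[of n] by (auto simp: repr_def)
      then show ?thesis using True by (simp add: sqn_def)
    next
      case False
      then have "emeasure lborel \<Omega> \<noteq> 0"
        using open_not_negligible[OF \<Omega>(1)] \<Omega>(1) by (auto simp: negligible_iff_null_sets null_sets_completion_iff)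
      moreover have "emeasure lborel \<Omega> < \<infinity>" using \<Omega>(2) by (rule emeasure_bounded_finite)
      ultimately have "measure lebesgue \<Omega> > 0"
        using \<Omega>(1) by (simp add: measure_def enn2real_positive_iff top.not_eq_extremum zero_less_iff_neq_zero)
      then show ?thesis using bounds(2)[of n] by (simp add: field_simps)
    qed
    obtain k V where k: "strict_mono k" and V: "repr \<Omega> V V" and lim: "(\<lambda>n. sqn (\<lambda>x. U (k n) x - V x)) \<longlonglongrightarrow> 0"
      by (rule energy_compactness[OF \<Omega> U A bounds(1)])
    have "energy 0 V \<le> liminf (\<lambda>n. energy 0 (U (k n)))"
      by (rule energy_lower_semicontinuous[OF Usq _ lim]) (use V in \<open>auto simp: repr_def\<close>)
    also have "\<dots> \<le> liminf (\<lambda>n. ennreal (2 * M))"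
      by (intro Liminf_mono always_eventually allI bounds(1))
    also have "\<dots> < \<infinity>" by (simp add: Liminf_const)
    finally have "V \<in> H00 \<Omega>" using H00_iff[OF V repr_L2[OF V \<Omega>(1)]] by simp
    moreover have "L2_tendsto \<Omega> (\<lambda>n. u (k n)) V"
      using lim by (subst L2_tendsto_iff[OF U V \<Omega>(1)])
    ultimately show "\<exists>k. strict_mono k \<and> (\<exists>v\<in>H00 \<Omega>. L2_tendsto \<Omega> (\<lambda>n. u (k n)) v)"
      using k by blast
  next
    fix v and u :: "nat \<Rightarrow> 'a \<Rightarrow> real"
    assume v: "v \<in> L2 \<Omega>" and u: "\<forall>n. u n \<in> L2 \<Omega>" and lim: "L2_tendsto \<Omega> u v"
    have "\<forall>n. \<exists>U. repr \<Omega> (u n) U" using u repr_exists[OF _ \<Omega>(1)] by metis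
    then obtain U where U: "\<And>n. repr \<Omega> (u n) (U n)" by metis
    obtain V where V: "repr \<Omega> v V" using repr_exists[OF v \<Omega>(1)] .
    show "Fhat \<Omega> 0 v \<le> liminf (\<lambda>n. Fhat \<Omega> (s n) (u n))"
      using lim unfolding L2_tendsto_iff[OF U V \<Omega>(1)] by (rule liminf_Fhat[OF \<Omega> s0 assms(5) U V])
  next
    fix v assume v: "v \<in> H00 \<Omega>"
    then have v2: "v \<in> L2 \<Omega>" by (simp add: H00_def)
    obtain V where V: "repr \<Omega> v V" using repr_exists[OF v2 \<Omega>(1)] .
    have VV: "repr \<Omega> V V" using V by (intro repr_self) (auto simp: repr_def)
    have fin: "energy 0 V < \<infinity>" using v H00_iff[OF V v2] by simp
    obtain U where U: "\<And>n. repr \<Omega> (U n) (U n)" and lim: "(\<lambda>n. sqn (\<lambda>x. U n x - V x)) \<longlonglongrightarrow> 0"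
      and F: "(\<lambda>n. Fhat \<Omega> (s n) (U n)) \<longlonglongrightarrow> Fhat \<Omega> 0 V"
      using recovery_sequence[OF \<Omega> assms(3) VV fin s0 assms(5)] by blast
    \<comment> \<open>The sequence was built for the representative \<open>V\<close>;
      \<open>v\<close> and \<open>V\<close> share it, hence also the value of the
      functional.\<close>
    have "Fhat \<Omega> 0 V = Fhat \<Omega> 0 v"
      unfolding Fhat_eq[OF V \<Omega> order_refl] Fhat_eq[OF VV \<Omega> order_refl] ..
    moreover have "L2_tendsto \<Omega> U v" using lim by (subst L2_tendsto_iff[OF U V \<Omega>(1)])
    ultimately show "\<exists>u. (\<forall>n. u n \<in> L2 \<Omega>) \<and> L2_tendsto \<Omega> u v \<and> (\<lambda>n. Fhat \<Omega> (s n) (u n)) \<longlonglongrightarrow> Fhat \<Omega> 0 v"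
      using F repr_L2[OF U \<Omega>(1)] by (intro exI[of _ U]) simp
  }
qed

end
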